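(* Let $k$ be a field of characteristic $p>0$, let $(R,\mathfrak m,k)$ be a noetherian $F$-finite normal local integral domain which is a $k$-algebra, let $\Gamma$ be a finite abelian group, and let $S=\bigoplus_{\gamma\in\Gamma}R(D_\gamma)$ be a $\Gamma$-graded $R$-algebra of the divisorial type described in the context, such that the induced homomorphism $\Gamma\to\operatorname{Cl}R$ is injective. Let $\theta\colon R\to S$ be the inclusion and $\mathfrak T\colon S\to R$ the projection onto the degree-$0$ part. Let $\phi\colon F^e_*R\to R$ ($e\ge1$) be an $R$-linear map with $(R,\phi)$ $F$-pure (i.e. $\phi$ surjective) and let $\phi^{\mathfrak T}\colon F^e_*S\to S$ be its unique $\mathfrak T$-transpose. Then $\theta$ is tamely $\mathfrak T$-ramified over every $\mathfrak p\in\mathrm{Schpec}(R,\phi)$, and so the transposition $(\theta,\mathfrak T)\colon(R,\phi)\to(S,\phi^{\mathfrak T})$ is fibered. Furthermore, for all $\mathfrak p\in\operatorname{Spec}R$, with $Y_{\mathfrak p}$ the set of primes of $S$ lying over $\mathfrak p$: $$\mathfrak p\in\mathrm{Schpec}(R,\phi)\iff Y_{\mathfrak p}\subset\mathrm{Schpec}(S,\phi^{\mathfrak T})\iff Y_{\mathfrak p}\cap\mathrm{Schpec}(S,\phi^{\mathfrak T})\neq\emptyset.$$ Thus, $\operatorname{Spec}S\to\operatorname{Spec}R$ restricts to a homeomorphism $\mathrm{Schpec}(S,\phi^{\mathfrak T})\to\mathrm{Schpec}(R,\phi)$ if $\Gamma$ is a $p$-group.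
   Context: The graded algebra $S$: $K$ is the field of fractions of $R$; for each $\gamma\in\Gamma$, $D_\gamma$ is a (Weil) divisor on $\operatorname{Spec}R$ with $D_0=0$, and $R(D)=\{f\in K\mid \operatorname{div}f+D\ge0\}\cup\{0\}$. $S=\bigoplus_\gamma R(D_\gamma)$ is a commutative $\Gamma$-graded ring with degree-$0$ part $R$, where the multiplication of the degree-$\gamma$ and degree-$\gamma'$ parts is the composite $R(D_\gamma)\otimes_RR(D_{\gamma'})\to R(D_\gamma+D_{\gamma'})\to R(D_{\gamma+\gamma'})$ of the canonical map with the isomorphism given by multiplication by some $\kappa_{\gamma,\gamma'}\in K^\times$ satisfying $\operatorname{div}\kappa_{\gamma,\gamma'}+D_{\gamma+\gamma'}=D_\gamma+D_{\gamma'}$. In particular $\gamma\mapsto[D_\gamma]$ is a homomorphism $\Gamma\to\operatorname{Cl}R$. In this situation $S$ is a finite $R$-algebra, a local integral domain, and $\mathfrak T$ generates $\operatorname{Hom}_R(S,R)$ freely as an $S$-module, so that each $\phi$ has a unique $\mathfrak T$-transpose, i.e. a unique $S$-linear $\phi^{\mathfrak T}\colon F^e_*S\to S$ with $\mathfrak T\circ\phi^{\mathfrak T}=\phi\circ F^e_*\mathfrak T$. $F^e_*R$ is $R$ with $R$-module structure via $r\mapsto r^{p^e}$; $F$-finite means $F_*R$ is finitely generated. $\phi^0=\mathrm{id}$, $\phi^n=\phi\circ F^e_*\phi^{n-1}$. $\mathrm{CSpec}(R,\phi)$: the primes $\mathfrak p$ with $\phi(F^e_*\mathfrak p)\subset\mathfrak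 p$; such $\mathfrak p$ gives $\bar\phi_{\mathfrak p}\colon F^e_*\kappa(\mathfrak p)\to\kappa(\mathfrak p)$. $\mathrm{Schpec}(R,\phi)$ (centers of $F$-purity): those $\mathfrak p\in\mathrm{CSpec}(R,\phi)$ with $\bar\phi_{\mathfrak p}\ne0$, with the subspace Zariski topology. Same for $(S,\phi^{\mathfrak T})$. $\mathfrak p^{\mathfrak T}=\{s\in S\mid\mathfrak T(sS)\subset\mathfrak p\}$; $\theta$ is tamely $\mathfrak T$-ramified over $\mathfrak p$ if $\mathfrak p^{\mathfrak T}=\sqrt{\mathfrak pS}$. Fibered transposition: with $\beta_{\mathfrak p}(R,\phi)=\bigcap_{n\ge0}\{r\in R\mid\phi^n(F^{en}_*(rR))\subset\mathfrak p\}$ (and likewise for $S$), $(\theta,\mathfrak T)$ is fibered if: (1) $\beta_{\mathfrak q\cap R}(R,\phi)\subset\beta_{\mathfrak q}(S,\phi^{\mathfrak T})\cap R$ for all $\mathfrak q\in\operatorname{Spec}S$; (2) $\mathfrak p^{\mathfrak T}$ is radical for all $\mathfrak p\in\mathrm{CSpec}(R,\phi)$, so that $\phi^{\mathfrak T}$ induces $\bar\phi^{\mathfrak T}_{\mathfrak p}\colon F^e_*\bar S_{\kappa(\mathfrak p)}\to\bar S_{\kappa(\mathfrak p)}$ where $\bar S_{\kappa(\mathfrak p)}=S_{\mathfrak p}/\sqrt{\mathfrak pS_{\mathfrak p}}$, compatibly (via the map $\bar S_{\kappa(\mathfrak p)}\to\kappa(\mathfrak p)$ induced by $\mathfrak T$)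 with $\bar\phi_{\mathfrak p}$; (3) $\bar\phi_{\mathfrak p}\ne0$ implies $\bar\phi^{\mathfrak T}_{\mathfrak p}$ surjective; (4) $\bar\phi_{\mathfrak p}=0$ implies $\bar\phi^{\mathfrak T}_{\mathfrak p}=0$, for all $\mathfrak p\in\mathrm{CSpec}(R,\phi)$. *)

theory Defs
  imports
    "HOL-Algebra.Free_Abelian_Groups"
    "HOL-Algebra.Polynomials"
    "HOL-Algebra.Ring_Divisibility"
    "HOL-Algebra.QuotRing"
    "HOL-Analysis.Abstract_Topology"
begin

section \<open>Commutative rings\<close>

definition ring_char :: "('a, 'm) ring_scheme \<Rightarrow> nat" where
  "ring_char A = (if \<exists>n::nat. 0 < n \<and> [n] \<cdot>\<^bsub>A\<^esub> \<one>\<^bsub>A\<^esub> = \<zero>\<^bsub>A\<^esub>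
                  then (LEAST n::nat. 0 < n \<and> [n] \<cdot>\<^bsub>A\<^esub> \<one>\<^bsub>A\<^esub> = \<zero>\<^bsub>A\<^esub>) else 0)"

definition local_ring :: "('a, 'm) ring_scheme \<Rightarrow> 'a set \<Rightarrow> bool" where
  "local_ring A \<mm> \<longleftrightarrow> cring A \<and> maximalideal \<mm> A \<and> (\<forall>M. maximalideal M A \<longrightarrow> M = \<mm>)"

definition radical :: "('a, 'm) ring_scheme \<Rightarrow> 'a set \<Rightarrow> 'a set" where
  "radical A I = {x \<in> carrier A. \<exists>n::nat. x [^]\<^bsub>A\<^esub> n \<in> I}"

definition contraction :: "('a, 'm) ring_scheme \<Rightarrow> ('a \<Rightarrow> 'b) \<Rightarrow> 'b set \<Rightarrow> 'a set" where
  "contraction A h I = {a \<in> carrier A. h a \<in> I}"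

definition spec :: "('a, 'm) ring_scheme \<Rightarrow> 'a set set" where
  "spec A = {P. primeideal P A}"

definition zariski :: "('a, 'm) ring_scheme \<Rightarrow> 'a set topology" where
  "zariski A = topology (\<lambda>U. \<exists>E \<subseteq> carrier A. U = {P \<in> spec A. \<not> E \<subseteq> P})"

lemma istopology_zariski:
  "istopology (\<lambda>U. \<exists>E \<subseteq> carrier A. U = {P \<in> spec A. \<not> E \<subseteq> P})"
  unfolding istopology_def
proof (intro conjI allI impI)
  fix U V
  assume "\<exists>E \<subseteq> carrier A. U = {P \<in> spec A. \<not> E \<subseteq> P}"
    and "\<exists>E \<subseteq> carrier A. V = {P \<in> spec A. \<not> E \<subseteq> P}"
  then obtain E F where E: "E \<subseteq> carrier A" "U = {P \<in> spec A. \<not> E \<subseteq> P}"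
    and F: "F \<subseteq> carrier A" "V = {P \<in> spec A. \<not> F \<subseteq> P}" by blast
  let ?G = "{x \<otimes>\<^bsub>A\<^esub> y | x y. x \<in> E \<and> y \<in> F} \<inter> carrier A"
  have "U \<inter> V = {P \<in> spec A. \<not> ?G \<subseteq> P}"
  proof (rule Set.set_eqI, rule iffI)
    fix P assume "P \<in> U \<inter> V"
    then have P: "primeideal P A" "\<not> E \<subseteq> P" "\<not> F \<subseteq> P" using E F by (auto simp: spec_def)
    then obtain x y where xy: "x \<in> E" "x \<notin> P" "y \<in> F" "y \<notin> P" by blast
    interpret primeideal P A by fact
    have "x \<otimes>\<^bsub>A\<^esub> y \<notin> P" using I_prime xy E F by blast
    moreover have "x \<otimes>\<^bsub>A\<^esub> y \<in> ?G" using xy E F by blast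
    ultimately show "P \<in> {P \<in> spec A. \<not> ?G \<subseteq> P}" using P by (auto simp: spec_def)
  next
    fix P assume P: "P \<in> {P \<in> spec A. \<not> ?G \<subseteq> P}"
    then interpret primeideal P A by (simp add: spec_def)
    obtain x y where "x \<in> E" "y \<in> F" "x \<otimes>\<^bsub>A\<^esub> y \<notin> P" using P by blast
    then have "x \<notin> P" "y \<notin> P" using I_l_closed I_r_closed E F by blast+
    then show "P \<in> U \<inter> V" using P E F \<open>x \<in> E\<close> \<open>y \<in> F\<close> by blast
  qed
  then show "\<exists>E \<subseteq> carrier A. U \<inter> V = {P \<in> spec A. \<not> E \<subseteq> P}" by blast
next
  fix \<K> assume "\<forall>K \<in> \<K>. \<exists>E \<subseteq> carrier A. K = {P \<in> spec A. \<not> E \<subseteq> P}"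
  then obtain f where f: "\<And>K. K \<in> \<K> \<Longrightarrow> f K \<subseteq> carrier A \<and> K = {P \<in> spec A. \<not> f K \<subseteq> P}"
    by metis
  have "\<Union>\<K> = {P \<in> spec A. \<not> (\<Union>K\<in>\<K>. f K) \<subseteq> P}" using f by blast
  moreover have "(\<Union>K\<in>\<K>. f K) \<subseteq> carrier A" using f by blast
  ultimately show "\<exists>E \<subseteq> carrier A. \<Union>\<K> = {P \<in> spec A. \<not> E \<subseteq> P}" by blast
qed


section \<open>Localization\<close>

definition frac_rel :: "('a, 'm) ring_scheme \<Rightarrow> 'a set \<Rightarrow> (('a \<times> 'a) \<times> ('a \<times> 'a)) set" where
  "frac_rel A M = {((a, s), (b, t)). a \<in> carrier A \<and> b \<in> carrier A \<and> s \<in> M \<and> t \<in> M \<and>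
     (\<exists>u \<in> M. u \<otimes>\<^bsub>A\<^esub> (a \<otimes>\<^bsub>A\<^esub> t) = u \<otimes>\<^bsub>A\<^esub> (b \<otimes>\<^bsub>A\<^esub> s))}"

definition frac :: "('a, 'm) ring_scheme \<Rightarrow> 'a set \<Rightarrow> 'a \<Rightarrow> 'a \<Rightarrow> ('a \<times> 'a) set" where
  "frac A M a s = frac_rel A M `` {(a, s)}"

definition localization :: "('a, 'm) ring_scheme \<Rightarrow> 'a set \<Rightarrow> ('a \<times> 'a) set ring" where
  "localization A M =
    \<lparr>carrier = (carrier A \<times> M) // frac_rel A M,
     monoid.mult = (\<lambda>x y. \<Union>(a, s)\<in>x. \<Union>(b, t)\<in>y. frac A M (a \<otimes>\<^bsub>A\<^esub> b) (s \<otimes>\<^bsub>A\<^esub> t)),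
     one = frac A M \<one>\<^bsub>A\<^esub> \<one>\<^bsub>A\<^esub>,
     zero = frac A M \<zero>\<^bsub>A\<^esub> \<one>\<^bsub>A\<^esub>,
     add = (\<lambda>x y. \<Union>(a, s)\<in>x. \<Union>(b, t)\<in>y.
              frac A M ((a \<otimes>\<^bsub>A\<^esub> t) \<oplus>\<^bsub>A\<^esub> (b \<otimes>\<^bsub>A\<^esub> s)) (s \<otimes>\<^bsub>A\<^esub> t))\<rparr>"

definition extend_loc :: "('a, 'm) ring_scheme \<Rightarrow> 'a set \<Rightarrow> 'a set \<Rightarrow> ('a \<times> 'a) set set" where
  "extend_loc A M I = Idl\<^bsub>localization A M\<^esub> ((\<lambda>a. frac A M a \<one>\<^bsub>A\<^esub>) ` I)"

text \<open>The map \<open>B / J \<rightarrow> B' / J'\<close> induced by an additive map \<open>g\<close> with \<open>g J \<subseteq> J'\<close>: the union is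
  then taken over equal cosets.\<close>

definition quot_map :: "('b, 'm) ring_scheme \<Rightarrow> 'b set \<Rightarrow> ('c \<Rightarrow> 'b) \<Rightarrow> 'c set \<Rightarrow> 'b set" where
  "quot_map B' J' g C = (\<Union>x\<in>C. J' +>\<^bsub>B'\<^esub> g x)"

definition residue_field :: "('a, 'm) ring_scheme \<Rightarrow> 'a set \<Rightarrow> ('a \<times> 'a) set set ring" where
  "residue_field A P = localization A (carrier A - P) Quot extend_loc A (carrier A - P) P"


section \<open>Maps \<open>F\<^sup>e\<^sub>*A \<rightarrow> A\<close>, compatible primes and centers of F-purity\<close>

text \<open>Throughout, \<open>q = p\<^sup>e\<close>. As an additive group \<open>F\<^sup>e\<^sub>*A\<close> is \<open>A\<close>, so its elements are not wrapped.\<close>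

definition F_finite :: "('a, 'm) ring_scheme \<Rightarrow> nat \<Rightarrow> bool" where
  "F_finite A p \<longleftrightarrow> (\<exists>G \<subseteq> carrier A. finite G \<and>
     (\<forall>x \<in> carrier A. \<exists>c \<in> G \<rightarrow> carrier A. x = (\<Oplus>\<^bsub>A\<^esub>g\<in>G. (c g [^]\<^bsub>A\<^esub> p) \<otimes>\<^bsub>A\<^esub> g)))"

definition frob_linear :: "('a, 'm) ring_scheme \<Rightarrow> nat \<Rightarrow> ('a \<Rightarrow> 'a) \<Rightarrow> bool" where
  "frob_linear A q f \<longleftrightarrow> f \<in> carrier A \<rightarrow> carrier A \<and>
     (\<forall>x \<in> carrier A. \<forall>y \<in> carrier A. f (x \<oplus>\<^bsub>A\<^esub> y) = f x \<oplus>\<^bsub>A\<^esub> f y) \<and>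
     (\<forall>a \<in> carrier A. \<forall>x \<in> carrier A. f ((a [^]\<^bsub>A\<^esub> q) \<otimes>\<^bsub>A\<^esub> x) = a \<otimes>\<^bsub>A\<^esub> f x)"

text \<open>The localization \<open>F\<^sup>e\<^sub>*(M\<^sup>-\<^sup>1A) \<rightarrow> M\<^sup>-\<^sup>1A\<close> of \<open>f\<close>: since \<open>a/s = a s\<^bsup>q-1\<^esup> / s\<^sup>q\<close>, it maps \<open>a/s\<close> to
  \<open>f (a s\<^bsup>q-1\<^esup>) / s\<close>.\<close>

definition loc_map :: "('a, 'm) ring_scheme \<Rightarrow> 'a set \<Rightarrow> nat \<Rightarrow> ('a \<Rightarrow> 'a) \<Rightarrow> ('a \<times> 'a) set \<Rightarrow> ('a \<times> 'a) set"
  where "loc_map A M q f x = (\<Union>(a, s)\<in>x. frac A M (f (a \<otimes>\<^bsub>A\<^esub> (s [^]\<^bsub>A\<^esub> (q - 1)))) s)"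

definition CSpec :: "('a, 'm) ring_scheme \<Rightarrow> ('a \<Rightarrow> 'a) \<Rightarrow> 'a set set" where
  "CSpec A f = {P \<in> spec A. f ` P \<subseteq> P}"

definition residue_map ::
  "('a, 'm) ring_scheme \<Rightarrow> nat \<Rightarrow> ('a \<Rightarrow> 'a) \<Rightarrow> 'a set \<Rightarrow> ('a \<times> 'a) set set \<Rightarrow> ('a \<times> 'a) set set" where
  "residue_map A q f P = (let M = carrier A - P in
     quot_map (localization A M) (extend_loc A M P) (loc_map A M q f))"

definition zero_on :: "('b, 'm) ring_scheme \<Rightarrow> ('b \<Rightarrow> 'b) \<Rightarrow> bool" where
  "zero_on B g \<longleftrightarrow> (\<forall>x \<in> carrier B. g x = \<zero>\<^bsub>B\<^esub>)"

definition Schpec :: "('a, 'm) ring_scheme \<Rightarrow> nat \<Rightarrow> ('a \<Rightarrow> 'a) \<Rightarrow> 'a set set" where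
  "Schpec A q f = {P \<in> CSpec A f. \<not> zero_on (residue_field A P) (residue_map A q f P)}"

definition schpec_space :: "('a, 'm) ring_scheme \<Rightarrow> nat \<Rightarrow> ('a \<Rightarrow> 'a) \<Rightarrow> 'a set topology" where
  "schpec_space A q f = subtopology (zariski A) (Schpec A q f)"

definition \<beta> :: "('a, 'm) ring_scheme \<Rightarrow> ('a \<Rightarrow> 'a) \<Rightarrow> 'a set \<Rightarrow> 'a set" where
  "\<beta> A f P = {r \<in> carrier A. \<forall>n. (f ^^ n) ` (PIdl\<^bsub>A\<^esub> r) \<subseteq> P}"


section \<open>Transposition along \<open>\<theta> : R \<rightarrow> S\<close> and \<open>T : S \<rightarrow> R\<close>\<close>

definition is_transpose ::
  "('b, 'n) ring_scheme \<Rightarrow> ('b \<Rightarrow> 'a) \<Rightarrow> nat \<Rightarrow> ('a \<Rightarrow> 'a) \<Rightarrow> ('b \<Rightarrow> 'b) \<Rightarrow> bool" where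
  "is_transpose S T q \<phi> \<psi> \<longleftrightarrow> frob_linear S q \<psi> \<and> (\<forall>s \<in> carrier S. T (\<psi> s) = \<phi> (T s))"

definition trace_ideal :: "('b, 'n) ring_scheme \<Rightarrow> ('b \<Rightarrow> 'a) \<Rightarrow> 'a set \<Rightarrow> 'b set" where
  "trace_ideal S T P = {s \<in> carrier S. T ` (PIdl\<^bsub>S\<^esub> s) \<subseteq> P}"

definition tamely_ramified ::
  "('b, 'n) ring_scheme \<Rightarrow> ('a \<Rightarrow> 'b) \<Rightarrow> ('b \<Rightarrow> 'a) \<Rightarrow> 'a set \<Rightarrow> bool" where
  "tamely_ramified S \<theta> T P \<longleftrightarrow> trace_ideal S T P = radical S (Idl\<^bsub>S\<^esub> (\<theta> ` P))"

definition fiber_mset :: "('a, 'm) ring_scheme \<Rightarrow> ('a \<Rightarrow> 'b) \<Rightarrow> 'a set \<Rightarrow> 'b set" where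
  "fiber_mset R \<theta> P = \<theta> ` (carrier R - P)"

abbreviation loc_fiber ::
  "('a, 'm) ring_scheme \<Rightarrow> ('b, 'n) ring_scheme \<Rightarrow> ('a \<Rightarrow> 'b) \<Rightarrow> 'a set \<Rightarrow> ('b \<times> 'b) set ring" where
  "loc_fiber R S \<theta> P \<equiv> localization S (fiber_mset R \<theta> P)"

definition fiber_nilrad ::
  "('a, 'm) ring_scheme \<Rightarrow> ('b, 'n) ring_scheme \<Rightarrow> ('a \<Rightarrow> 'b) \<Rightarrow> 'a set \<Rightarrow> ('b \<times> 'b) set set" where
  "fiber_nilrad R S \<theta> P =
     radical (loc_fiber R S \<theta> P) (extend_loc S (fiber_mset R \<theta> P) (\<theta> ` P))"

definition reduced_fiber ::
  "('a, 'm) ring_scheme \<Rightarrow> ('b, 'n) ring_scheme \<Rightarrow> ('a \<Rightarrow> 'b) \<Rightarrow> 'a set \<Rightarrow> ('b \<times> 'b) set set ring" where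
  "reduced_fiber R S \<theta> P = loc_fiber R S \<theta> P Quot fiber_nilrad R S \<theta> P"

definition fiber_map ::
  "('a, 'm) ring_scheme \<Rightarrow> ('b, 'n) ring_scheme \<Rightarrow> ('a \<Rightarrow> 'b) \<Rightarrow> nat \<Rightarrow> ('b \<Rightarrow> 'b) \<Rightarrow> 'a set
     \<Rightarrow> ('b \<times> 'b) set set \<Rightarrow> ('b \<times> 'b) set set" where
  "fiber_map R S \<theta> q \<psi> P =
     quot_map (loc_fiber R S \<theta> P) (fiber_nilrad R S \<theta> P) (loc_map S (fiber_mset R \<theta> P) q \<psi>)"

text \<open>The \<open>R\<^sub>P\<close>-linear localization \<open>S\<^sub>P \<rightarrow> R\<^sub>P\<close> of \<open>T\<close>, mapping \<open>s / \<theta> m\<close> to \<open>T s / m\<close>.\<close>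

definition loc_trace ::
  "('a, 'm) ring_scheme \<Rightarrow> ('a \<Rightarrow> 'b) \<Rightarrow> ('b \<Rightarrow> 'a) \<Rightarrow> 'a set \<Rightarrow> ('b \<times> 'b) set \<Rightarrow> ('a \<times> 'a) set" where
  "loc_trace R \<theta> T P x =
     (\<Union>m \<in> carrier R - P. \<Union>s \<in> {s. (s, \<theta> m) \<in> x}. frac R (carrier R - P) (T s) m)"

definition fiber_trace ::
  "('a, 'm) ring_scheme \<Rightarrow> ('a \<Rightarrow> 'b) \<Rightarrow> ('b \<Rightarrow> 'a) \<Rightarrow> 'a set \<Rightarrow> ('b \<times> 'b) set set \<Rightarrow> ('a \<times> 'a) set set"
  where "fiber_trace R \<theta> T P =
     quot_map (localization R (carrier R - P)) (extend_loc R (carrier R - P) P) (loc_trace R \<theta> T P)"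

text \<open>The second to fourth conjuncts for \<open>P \<in> CSpec R \<phi>\<close> say that \<open>\<psi>\<close> and \<open>T\<close> do induce maps on
  the reduced fiber, so that \<^const>\<open>fiber_map\<close> and \<^const>\<open>fiber_trace\<close> are meaningful, and that
  these are compatible with the map on the residue field.\<close>

definition fibered ::
  "('a, 'm) ring_scheme \<Rightarrow> ('b, 'n) ring_scheme \<Rightarrow> ('a \<Rightarrow> 'b) \<Rightarrow> ('b \<Rightarrow> 'a) \<Rightarrow> nat
     \<Rightarrow> ('a \<Rightarrow> 'a) \<Rightarrow> ('b \<Rightarrow> 'b) \<Rightarrow> bool" where
  "fibered R S \<theta> T q \<phi> \<psi> \<longleftrightarrow>
     (\<forall>Q \<in> spec S. \<beta> R \<phi> (contraction R \<theta> Q) \<subseteq> contraction R \<theta> (\<beta> S \<psi> Q)) \<and>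
     (\<forall>P \<in> CSpec R \<phi>.
        radical S (trace_ideal S T P) = trace_ideal S T P \<and>
        loc_map S (fiber_mset R \<theta> P) q \<psi> ` fiber_nilrad R S \<theta> P \<subseteq> fiber_nilrad R S \<theta> P \<and>
        loc_trace R \<theta> T P ` fiber_nilrad R S \<theta> P \<subseteq> extend_loc R (carrier R - P) P \<and>
        (\<forall>x \<in> carrier (reduced_fiber R S \<theta> P).
           fiber_trace R \<theta> T P (fiber_map R S \<theta> q \<psi> P x) =
           residue_map R q \<phi> P (fiber_trace R \<theta> T P x)) \<and>
        (\<not> zero_on (residue_field R P) (residue_map R q \<phi> P) \<longrightarrow>
           fiber_map R S \<theta> q \<psi> P ` carrier (reduced_fiber R S \<theta> P) =
           carrier (reduced_fiber R S \<theta> P)) \<and>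
        (zero_on (residue_field R P) (residue_map R q \<phi> P) \<longrightarrow>
           zero_on (reduced_fiber R S \<theta> P) (fiber_map R S \<theta> q \<psi> P)))"

definition primes_over ::
  "('a, 'm) ring_scheme \<Rightarrow> ('b, 'n) ring_scheme \<Rightarrow> ('a \<Rightarrow> 'b) \<Rightarrow> 'a set \<Rightarrow> 'b set set" where
  "primes_over R S \<theta> P = {Q \<in> spec S. contraction R \<theta> Q = P}"


section \<open>Subrings of a field and Weil divisors\<close>

text \<open>Here \<open>R\<close> is a subset of the carrier of the field \<open>K\<close>, viewed as a ring.\<close>

abbreviation sub :: "('a, 'm) ring_scheme \<Rightarrow> 'a set \<Rightarrow> ('a, 'm) ring_scheme" where
  "sub K R \<equiv> K\<lparr>carrier := R\<rparr>"

definition is_fraction_field :: "('a, 'm) ring_scheme \<Rightarrow> 'a set \<Rightarrow> bool" where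
  "is_fraction_field K R \<longleftrightarrow> field K \<and> subring R K \<and>
     (\<forall>x \<in> carrier K. \<exists>a \<in> R. \<exists>b \<in> R - {\<zero>\<^bsub>K\<^esub>}. x = a \<otimes>\<^bsub>K\<^esub> inv\<^bsub>K\<^esub> b)"

definition integrally_closed :: "('a, 'm) ring_scheme \<Rightarrow> 'a set \<Rightarrow> bool" where
  "integrally_closed K R \<longleftrightarrow>
     (\<forall>x \<in> carrier K. (\<exists>f. polynomial\<^bsub>K\<^esub> R f \<and> f \<noteq> [] \<and> lead_coeff f = \<one>\<^bsub>K\<^esub> \<and>
        ring.eval K f x = \<zero>\<^bsub>K\<^esub>) \<longrightarrow> x \<in> R)"

definition height_one :: "('a, 'm) ring_scheme \<Rightarrow> 'a set \<Rightarrow> 'a set set" where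
  "height_one K R = {P \<in> spec (sub K R). P \<noteq> {\<zero>\<^bsub>K\<^esub>} \<and>
     (\<forall>Q \<in> spec (sub K R). Q \<subset> P \<longrightarrow> Q = {\<zero>\<^bsub>K\<^esub>})}"

definition loc_in :: "('a, 'm) ring_scheme \<Rightarrow> 'a set \<Rightarrow> 'a set \<Rightarrow> 'a set" where
  "loc_in K R P = {a \<otimes>\<^bsub>K\<^esub> inv\<^bsub>K\<^esub> s | a s. a \<in> R \<and> s \<in> R - P}"

text \<open>The valuation of the discrete valuation ring \<open>R\<^sub>P\<close>: \<open>x\<close> has valuation \<open>n\<close> if \<open>x = u t\<^sup>n\<close> with
  \<open>u\<close> a unit of \<open>R\<^sub>P\<close> and \<open>t\<close> a generator of its maximal ideal.\<close>

definition valuation :: "('a, 'm) ring_scheme \<Rightarrow> 'a set \<Rightarrow> 'a set \<Rightarrow> 'a \<Rightarrow> int" where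
  "valuation K R P x = (THE n. \<exists>t u. maximalideal (PIdl\<^bsub>sub K (loc_in K R P)\<^esub> t) (sub K (loc_in K R P)) \<and>
     t \<in> loc_in K R P \<and> u \<in> Units (sub K (loc_in K R P)) \<and> x = u \<otimes>\<^bsub>K\<^esub> (t [^]\<^bsub>K\<^esub> (n::int)))"

abbreviation Div :: "('a, 'm) ring_scheme \<Rightarrow> 'a set \<Rightarrow> ('a set \<Rightarrow>\<^sub>0 int) monoid" where
  "Div K R \<equiv> free_Abelian_group (height_one K R)"

definition div_of :: "('a, 'm) ring_scheme \<Rightarrow> 'a set \<Rightarrow> 'a \<Rightarrow> ('a set \<Rightarrow>\<^sub>0 int)" where
  "div_of K R f = Abs_poly_mapping (\<lambda>P. if P \<in> height_one K R then valuation K R P f else 0)"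

definition principal_divisors :: "('a, 'm) ring_scheme \<Rightarrow> 'a set \<Rightarrow> ('a set \<Rightarrow>\<^sub>0 int) set" where
  "principal_divisors K R = div_of K R ` (carrier K - {\<zero>\<^bsub>K\<^esub>})"

definition Cl :: "('a, 'm) ring_scheme \<Rightarrow> 'a set \<Rightarrow> ('a set \<Rightarrow>\<^sub>0 int) set monoid" where
  "Cl K R = Div K R Mod principal_divisors K R"

definition divisor_class ::
  "('a, 'm) ring_scheme \<Rightarrow> 'a set \<Rightarrow> ('a set \<Rightarrow>\<^sub>0 int) \<Rightarrow> ('a set \<Rightarrow>\<^sub>0 int) set" where
  "divisor_class K R D = principal_divisors K R #>\<^bsub>Div K R\<^esub> D"

definition sections :: "('a, 'm) ring_scheme \<Rightarrow> 'a set \<Rightarrow> ('a set \<Rightarrow>\<^sub>0 int) \<Rightarrow> 'a set" where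
  "sections K R D = {f \<in> carrier K - {\<zero>\<^bsub>K\<^esub>}. \<forall>P. 0 \<le> poly_mapping.lookup (div_of K R f + D) P} \<union> {\<zero>\<^bsub>K\<^esub>}"


section \<open>The graded algebra\<close>

text \<open>The group \<open>\<Gamma>\<close> is written multiplicatively. An element of \<open>S\<close> is the family of its homogeneous
  components (\<open>\<Gamma>\<close> being finite), and \<open>\<kappa> \<gamma> \<gamma>'\<close> twists the product of degrees \<open>\<gamma>\<close> and \<open>\<gamma>'\<close>.\<close>

definition divisorial_algebra ::
  "('a, 'm) ring_scheme \<Rightarrow> 'a set \<Rightarrow> ('g, 'n) monoid_scheme \<Rightarrow> ('g \<Rightarrow> 'a set \<Rightarrow>\<^sub>0 int) \<Rightarrow> ('g \<Rightarrow> 'g \<Rightarrow> 'a)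
     \<Rightarrow> ('g \<Rightarrow> 'a) ring" where
  "divisorial_algebra K R \<Gamma> D \<kappa> =
    \<lparr>carrier = (\<Pi>\<^sub>E \<gamma>\<in>carrier \<Gamma>. sections K R (D \<gamma>)),
     monoid.mult = (\<lambda>s t. \<lambda>\<delta>\<in>carrier \<Gamma>. \<Oplus>\<^bsub>K\<^esub>\<gamma>\<in>carrier \<Gamma>.
       \<kappa> \<gamma> (inv\<^bsub>\<Gamma>\<^esub> \<gamma> \<otimes>\<^bsub>\<Gamma>\<^esub> \<delta>) \<otimes>\<^bsub>K\<^esub> (s \<gamma> \<otimes>\<^bsub>K\<^esub> t (inv\<^bsub>\<Gamma>\<^esub> \<gamma> \<otimes>\<^bsub>\<Gamma>\<^esub> \<delta>))),
     one = (\<lambda>\<gamma>\<in>carrier \<Gamma>. if \<gamma> = \<one>\<^bsub>\<Gamma>\<^esub> then \<one>\<^bsub>K\<^esub> else \<zero>\<^bsub>K\<^esub>),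
     zero = (\<lambda>\<gamma>\<in>carrier \<Gamma>. \<zero>\<^bsub>K\<^esub>),
     add = (\<lambda>s t. \<lambda>\<gamma>\<in>carrier \<Gamma>. s \<gamma> \<oplus>\<^bsub>K\<^esub> t \<gamma>)\<rparr>"

definition deg0_incl :: "('a, 'm) ring_scheme \<Rightarrow> ('g, 'n) monoid_scheme \<Rightarrow> 'a \<Rightarrow> 'g \<Rightarrow> 'a" where
  "deg0_incl K \<Gamma> r = (\<lambda>\<gamma>\<in>carrier \<Gamma>. if \<gamma> = \<one>\<^bsub>\<Gamma>\<^esub> then r else \<zero>\<^bsub>K\<^esub>)"

definition deg0_proj :: "('g, 'n) monoid_scheme \<Rightarrow> ('g \<Rightarrow> 'a) \<Rightarrow> 'a" where
  "deg0_proj \<Gamma> s = s \<one>\<^bsub>\<Gamma>\<^esub>"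

text \<open>Requiring a commutative ring imposes the associativity and symmetry conditions on \<open>\<kappa>\<close>, and, the
  unit being 1 in degree 0, also that the degree 0 part is \<open>R\<close> with its own multiplication.\<close>

definition divisorial_data ::
  "('a, 'm) ring_scheme \<Rightarrow> 'a set \<Rightarrow> ('g, 'n) monoid_scheme \<Rightarrow> ('g \<Rightarrow> 'a set \<Rightarrow>\<^sub>0 int) \<Rightarrow> ('g \<Rightarrow> 'g \<Rightarrow> 'a)
     \<Rightarrow> bool" where
  "divisorial_data K R \<Gamma> D \<kappa> \<longleftrightarrow>
     D \<in> carrier \<Gamma> \<rightarrow> carrier (Div K R) \<and> D \<one>\<^bsub>\<Gamma>\<^esub> = 0 \<and>
     (\<forall>\<gamma> \<in> carrier \<Gamma>. \<forall>\<gamma>' \<in> carrier \<Gamma>. \<kappa> \<gamma> \<gamma>' \<in> carrier K - {\<zero>\<^bsub>K\<^esub>} \<and>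
        div_of K R (\<kappa> \<gamma> \<gamma>') + D (\<gamma> \<otimes>\<^bsub>\<Gamma>\<^esub> \<gamma>') = D \<gamma> + D \<gamma>') \<and>
     cring (divisorial_algebra K R \<Gamma> D \<kappa>)"

end

theory Submission
  imports Defs "HOL-Computational_Algebra.Primes"
begin

text \<open>
  Write \<open>q = p\<^sup>e\<close>, \<open>S\<^sub>\<gamma>\<close> for the homogeneous parts of \<open>S\<close>, and \<open>P\<^sup>T\<close> for the trace ideal of \<open>P\<close>.

  That \<open>R\<close> is local and \<open>\<Gamma> \<rightarrow> Cl R\<close> injective enters through one fact: for \<open>\<gamma> \<noteq> 1\<close> the product of
  \<open>f \<in> S\<^sub>\<gamma>\<close> and an element \<open>g\<close> of the inverse degree \<open>\<delta>\<close> lies in \<open>\<mm>\<close> (\<open>deg0_mult_not_unit\<close>). If it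
  were a unit, the effective divisors \<open>div f + D\<^sub>\<gamma>\<close> and \<open>div g + D\<^sub>\<delta>\<close> would add up to zero, hence
  vanish, and \<open>D\<^sub>\<gamma>\<close> would be principal. Consequently \<open>\<psi>\<close> is surjective (\<open>\<psi>_unit\<close>): if \<open>\<phi>(c) = 1\<close>, the
  element \<open>u = \<psi>(c)\<close> has trace \<open>1\<close> and components only in degrees killed by \<open>q\<close>, so \<open>u\<^sup>q\<close> lies in \<open>R\<close>
  and is \<open>1\<close> modulo \<open>\<mm>\<close>.

  A surjective \<open>\<psi>\<close> makes every ideal compatible with it radical, since \<open>\<psi>(x\<^sup>q d) = x\<close> when
  \<open>\<psi>(d) = 1\<close>. If \<open>P\<close> is compatible with \<open>\<phi>\<close> then \<open>P\<^sup>T\<close> is compatible with \<open>\<psi>\<close>, hence radical. On the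
  other hand \<open>P\<^sup>T \<subseteq> \<surd>(P S)\<close> for every ideal \<open>P\<close>, because a homogeneous \<open>s\<close> in \<open>P\<^sup>T\<close> satisfies
  \<open>s\<^sup>N = T(s s\<^sup>N\<^sup>-\<^sup>1)\<close> with \<open>N\<close> the order of \<open>\<Gamma>\<close>. Together these give \<open>P\<^sup>T = \<surd>(P S)\<close>
  (\<open>trace_ideal_eq_radical\<close>), and the fiberedness of the transposition follows by localizing at \<open>P\<close>.

  As \<open>\<phi>\<close> and \<open>\<psi>\<close> both take the value \<open>1\<close>, centers of F-purity are the same as compatible primes
  (\<open>Schpec_eq_CSpec\<close>), so what remains is to compare the compatible primes of \<open>R\<close> and \<open>S\<close>.
  Going up (\<open>CSpec_over\<close>): modulo \<open>P\<^sup>T\<close> the powers of an element \<open>y\<close> of a prime \<open>Q\<close> over \<open>P\<close> are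
  linearly dependent, which yields \<open>x\<close> outside \<open>Q\<close> with \<open>x y \<in> P\<^sup>T\<close>; then \<open>x \<psi>(y) = \<psi>(x\<^sup>q y)\<close> lies
  in \<open>P\<^sup>T\<close> and so \<open>\<psi>(y) \<in> Q\<close>. Going down (\<open>CSpec_contraction\<close>): an iterate \<open>\<psi>\<^sup>n\<close> only sees the
  components in degrees \<open>H = {\<gamma>\<^bsup>q^n\<^esup>}\<close>, whence a compatible prime \<open>Q\<close> of \<open>S\<close> is stable under the
  projection onto these degrees (\<open>prs_pow_image_mem_prime\<close>). For large \<open>n\<close> the group \<open>H\<close> has no
  \<open>p\<close>-torsion, and the projection of \<open>\<psi>(r)\<close> is \<open>\<phi>(r)\<close>. If \<open>\<Gamma>\<close> is a \<open>p\<close>-group, the projection is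
  \<open>T\<close> itself, and \<open>P \<mapsto> P\<^sup>T\<close> becomes a continuous inverse of the contraction.

  The facts on divisors that this uses, namely that \<open>div\<close> is additive and \<open>R = R(0)\<close>, come from the
  complete integral closedness of a normal noetherian domain: an ideal of denominators
  \<open>{x. x f \<in> R}\<close> that is maximal among the proper ones of the multiples of \<open>f\<close> is a height-one prime
  at which \<open>R\<close> has a uniformizer.
\<close>

section \<open>Ideals, radicals and Frobenius in commutative rings\<close>

lemma (in cring) idealI_closed:
  assumes "I \<subseteq> carrier R" "\<zero> \<in> I" "\<And>x y. x \<in> I \<Longrightarrow> y \<in> I \<Longrightarrow> x \<oplus> y \<in> I"
    and mult: "\<And>x a. x \<in> I \<Longrightarrow> a \<in> carrier R \<Longrightarrow> a \<otimes> x \<in> I"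
  shows "ideal I R"
proof (rule idealI)
  show "subgroup I (add_monoid R)"
  proof (rule add.subgroupI)
    fix x assume x: "x \<in> I"
    then have "\<ominus> x = (\<ominus> \<one>) \<otimes> x" using assms(1) l_minus[of \<one> x] by auto
    then show "\<ominus> x \<in> I" using mult[OF x, of "\<ominus> \<one>"] by simp
  qed (use assms in auto)
  fix x a assume xa: "x \<in> I" "a \<in> carrier R"
  then show "x \<otimes> a \<in> I" using mult[OF xa] assms(1) m_comm[of x a] by auto
qed (use mult ring_axioms in auto)

text \<open>The factor \<open>z\<close> absorbs the powers already split off, which makes the induction on the exponent go
  through without a binomial expansion.\<close>

lemma (in cring) ideal_mult_pow_add:
  assumes "ideal I R" and "x \<in> carrier R" "y \<in> carrier R" "z \<in> carrier R"
    and "z \<otimes> x [^] a \<in> I" and "z \<otimes> y [^] b \<in> I"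
  shows "z \<otimes> (x \<oplus> y) [^] (a + b :: nat) \<in> I"
  using assms(4-6)
proof (induction "a + b" arbitrary: a b z)
  case 0
  then show ?case by simp
next
  case (Suc n)
  interpret ideal I R by fact
  note xy = assms(2,3)
  show ?case
  proof (cases "a = 0 \<or> b = 0")
    case True
    then have "z \<in> I" using Suc.prems by auto
    then show ?thesis using I_r_closed xy by simp
  next
    case False
    then obtain a' b' where ab: "a = Suc a'" "b = Suc b'" by (metis not0_implies_Suc)
    have "(z \<otimes> x) \<otimes> (x \<oplus> y) [^] (a' + b) \<in> I"
    proof (rule Suc.hyps(1))
      show "n = a' + b" using Suc.hyps(2) ab by simp
      show "z \<otimes> x \<otimes> x [^] a' \<in> I"
        using Suc.prems xy unfolding ab nat_pow_Suc by (simp add: m_ac)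
      have "z \<otimes> x \<otimes> y [^] b = x \<otimes> (z \<otimes> y [^] b)" using Suc.prems xy by (simp add: m_ac)
      then show "z \<otimes> x \<otimes> y [^] b \<in> I" using Suc.prems xy I_l_closed by simp
    qed (use Suc.prems xy in auto)
    moreover have "(z \<otimes> y) \<otimes> (x \<oplus> y) [^] (a + b') \<in> I"
    proof (rule Suc.hyps(1))
      show "n = a + b'" using Suc.hyps(2) ab by simp
      show "z \<otimes> y \<otimes> y [^] b' \<in> I"
        using Suc.prems xy unfolding ab nat_pow_Suc by (simp add: m_ac)
      have "z \<otimes> y \<otimes> x [^] a = y \<otimes> (z \<otimes> x [^] a)" using Suc.prems xy by (simp add: m_ac)
      then show "z \<otimes> y \<otimes> x [^] a \<in> I" using Suc.prems xy I_l_closed by simp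
    qed (use Suc.prems xy in auto)
    moreover have "z \<otimes> (x \<oplus> y) [^] (a + b)
        = (z \<otimes> x) \<otimes> (x \<oplus> y) [^] (a' + b) \<oplus> (z \<otimes> y) \<otimes> (x \<oplus> y) [^] (a + b')"
      using Suc.prems xy by (simp add: ab m_ac r_distr l_distr)
    ultimately show ?thesis by simp
  qed
qed

lemma (in cring) radical_add:
  assumes I: "ideal I R" and "x \<in> radical R I" "y \<in> radical R I"
  shows "x \<oplus> y \<in> radical R I"
proof -
  obtain a b where "x [^] (a::nat) \<in> I" "y [^] (b::nat) \<in> I" "x \<in> carrier R" "y \<in> carrier R"
    using assms by (auto simp: radical_def)
  then show ?thesis
    using ideal_mult_pow_add[OF I, of x y \<one> a b] by (auto simp: radical_def)
qed

lemma (in cring) radical_finsum: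
  assumes I: "ideal I R" and "finite F" "\<And>i. i \<in> F \<Longrightarrow> f i \<in> radical R I"
  shows "finsum R f F \<in> radical R I"
  using assms(2,3)
proof (induction F rule: finite_induct)
  case empty
  have "\<zero> [^] (1::nat) \<in> I" using additive_subgroup.zero_closed[OF ideal.axioms(1)[OF I]] by simp
  then show ?case unfolding radical_def finsum_empty by blast
next
  case (insert i F)
  then have "f i \<in> carrier R" "f \<in> F \<rightarrow> carrier R" by (auto simp: radical_def)
  then show ?case using insert radical_add[OF I] by simp
qed

lemma (in ideal) finsum_in_ideal:
  assumes "\<And>i. i \<in> F \<Longrightarrow> f i \<in> I"
  shows "finsum R f F \<in> I"
  using assms
proof (induction F rule: infinite_finite_induct)
  case (insert i F)
  then have "f \<in> F \<rightarrow> carrier R" "f i \<in> carrier R" using Icarr by auto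
  then show ?case using insert by simp
qed auto

lemma (in primeideal) pow_mem_imp_mem:
  assumes "x \<in> carrier R" "x [^] (n::nat) \<in> I"
  shows "x \<in> I"
  using assms(2)
proof (induction n)
  case 0
  then show ?case using I_notcarr one_imp_carrier by simp
next
  case (Suc n)
  then show ?case using I_prime[of "x [^] n" x] assms(1) by auto
qed

lemma (in cring) binomial_expansion:
  assumes [simp]: "x \<in> carrier R" "y \<in> carrier R"
  shows "(x \<oplus> y) [^] (n::nat) = (\<Oplus>k\<in>{..n}. [(n choose k)] \<cdot> (x [^] k \<otimes> y [^] (n - k)))"
proof (induction n)
  case 0
  then show ?case by simp
next
  case (Suc n)
  let ?f = "\<lambda>k. x [^] k \<otimes> y [^] (Suc n - k)"
  have f[simp]: "?f k \<in> carrier R" for k by simp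
  have x: "(\<Oplus>k\<in>{..n}. [(n choose k)] \<cdot> (x [^] k \<otimes> y [^] (n - k))) \<otimes> x
      = (\<Oplus>k\<in>{..Suc n}. [(if k = 0 then 0 else n choose (k - 1))] \<cdot> ?f k)"
  proof -
    have "(\<Oplus>k\<in>{..n}. [(n choose k)] \<cdot> (x [^] k \<otimes> y [^] (n - k))) \<otimes> x
        = (\<Oplus>k\<in>{..n}. [(n choose k)] \<cdot> ?f (Suc k))"
      by (subst finsum_ldistr) (auto intro!: add.finprod_cong' simp: add_pow_ldistr add_pow_rdistr m_ac)
    also have "\<dots> = (\<Oplus>k\<in>Suc ` {..n}. [(n choose (k - 1))] \<cdot> ?f k)"
      by (subst add.finprod_reindex) auto
    also have "\<dots> = (\<Oplus>k\<in>{..Suc n}. [(if k = 0 then 0 else n choose (k - 1))] \<cdot> ?f k)"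
    proof (rule add.finprod_mono_neutral_cong_left)
      show "Suc ` {..n} \<subseteq> {..Suc n}" by auto
      show "[(if i = 0 then 0 else n choose (i - 1))] \<cdot> ?f i = \<zero>"
        if "i \<in> {..Suc n} - Suc ` {..n}" for i
      proof -
        from that have "i = 0" by (metis Diff_iff atMost_iff image_eqI not0_implies_Suc Suc_le_mono)
        then show "[(if i = 0 then 0 else n choose (i - 1))] \<cdot> ?f i = \<zero>" by simp
      qed
    qed auto
    finally show ?thesis .
  qed
  have y: "(\<Oplus>k\<in>{..n}. [(n choose k)] \<cdot> (x [^] k \<otimes> y [^] (n - k))) \<otimes> y
      = (\<Oplus>k\<in>{..Suc n}. [(n choose k)] \<cdot> ?f k)"
  proof -
    have "(\<Oplus>k\<in>{..n}. [(n choose k)] \<cdot> (x [^] k \<otimes> y [^] (n - k))) \<otimes> y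
        = (\<Oplus>k\<in>{..n}. [(n choose k)] \<cdot> ?f k)"
      by (subst finsum_ldistr)
        (auto intro!: add.finprod_cong' simp: add_pow_ldistr m_assoc Suc_diff_le)
    also have "\<dots> = (\<Oplus>k\<in>{..Suc n}. [(n choose k)] \<cdot> ?f k)"
      by (rule add.finprod_mono_neutral_cong_left) (auto simp: binomial_eq_0)
    finally show ?thesis .
  qed
  have "(x \<oplus> y) [^] Suc n = (x \<oplus> y) [^] n \<otimes> x \<oplus> (x \<oplus> y) [^] n \<otimes> y"
    by (simp add: r_distr)
  also have "\<dots> = (\<Oplus>k\<in>{..Suc n}. [(if k = 0 then 0 else n choose (k - 1))] \<cdot> ?f k
      \<oplus> [(n choose k)] \<cdot> ?f k)"
    unfolding Suc x y by (subst add.finprod_multf) auto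
  also have "\<dots> = (\<Oplus>k\<in>{..Suc n}. [(Suc n choose k)] \<cdot> ?f k)"
  proof (rule add.finprod_cong')
    fix k
    show "[(if k = 0 then 0 else n choose (k - 1))] \<cdot> ?f k \<oplus> [(n choose k)] \<cdot> ?f k
        = [(Suc n choose k)] \<cdot> ?f k"
      by (cases k) (auto simp: add.nat_pow_mult)
  qed auto
  finally show ?case .
qed

text \<open>The inner binomial coefficients are divisible by \<open>p\<close>.\<close>

lemma (in cring) frobenius_add:
  assumes "Factorial_Ring.prime (p::nat)" and p: "[p] \<cdot> \<one> = \<zero>"
    and [simp]: "x \<in> carrier R" "y \<in> carrier R"
  shows "(x \<oplus> y) [^] p = x [^] p \<oplus> y [^] p"
proof -
  have pz: "[p] \<cdot> z = \<zero>" if "z \<in> carrier R" for z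
    using add_pow_ldistr[of \<one> z p] that p by simp
  have p0: "0 < p" using assms(1) prime_gt_0_nat by blast
  let ?g = "\<lambda>k. [(p choose k)] \<cdot> (x [^] k \<otimes> y [^] (p - k))"
  have "(x \<oplus> y) [^] p = finsum R ?g {..p}" by (simp add: binomial_expansion)
  also have "\<dots> = finsum R ?g {0, p}"
  proof (rule add.finprod_mono_neutral_cong_right)
    show "?g i = \<zero>" if i: "i \<in> {..p} - {0, p}" for i
    proof -
      have "p dvd (p choose i)" using i assms(1) dvd_choose_prime[of i p] by auto
      then obtain m where "p choose i = p * m" ..
      then show "?g i = \<zero>" using pz by (simp add: mult.commute[of p] flip: add.nat_pow_pow)
    qed
  qed auto
  also have "\<dots> = x [^] p \<oplus> y [^] p" using p0 by (simp add: a_comm)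
  finally show ?thesis .
qed

lemma (in cring) frobenius_power_add:
  assumes "Factorial_Ring.prime (p::nat)" and "[p] \<cdot> \<one> = \<zero>"
    and [simp]: "x \<in> carrier R" "y \<in> carrier R"
  shows "(x \<oplus> y) [^] (p ^ e) = x [^] (p ^ e) \<oplus> y [^] (p ^ e)"
proof (induction e)
  case (Suc e)
  have "(x \<oplus> y) [^] (p ^ Suc e) = ((x \<oplus> y) [^] (p ^ e)) [^] p"
    by (simp add: nat_pow_pow mult.commute)
  also have "\<dots> = x [^] (p ^ Suc e) \<oplus> y [^] (p ^ Suc e)"
    unfolding Suc by (subst frobenius_add[OF assms(1,2)]) (simp_all add: nat_pow_pow mult.commute)
  finally show ?case .
qed simp

text \<open>An ideal maximal among those avoiding \<open>M\<close> is prime: if \<open>a\<close> and \<open>b\<close> lie outside it, the ideals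
  generated by \<open>P, a\<close> and by \<open>P, b\<close> meet \<open>M\<close>, and the product of the two elements found there would
  lie in \<open>P\<close> together with \<open>a b\<close>.\<close>

lemma (in cring) exists_prime_avoiding:
  assumes I: "ideal I R" and M: "\<one> \<in> M" "M \<subseteq> carrier R" "\<And>x y. x \<in> M \<Longrightarrow> y \<in> M \<Longrightarrow> x \<otimes> y \<in> M"
    and "I \<inter> M = {}"
  shows "\<exists>P. primeideal P R \<and> I \<subseteq> P \<and> P \<inter> M = {}"
proof -
  let ?F = "{J. ideal J R \<and> I \<subseteq> J \<and> J \<inter> M = {}}"
  have "\<exists>P\<in>?F. \<forall>J\<in>?F. P \<subseteq> J \<longrightarrow> J = P"
  proof (rule subset_Zorn_nonempty)
    fix C assume C: "C \<noteq> {}" "subset.chain ?F C"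
    then have "subset.chain {J. ideal J R} C" by (auto simp: pred_on.chain_def)
    then have "ideal (\<Union>C) R" using C(1) chain_Union_is_ideal[of C] by simp
    then show "\<Union>C \<in> ?F" using C by (auto simp: pred_on.chain_def)
  qed (use assms in auto)
  then obtain P where P: "ideal P R" "I \<subseteq> P" "P \<inter> M = {}"
    and max: "\<And>J. ideal J R \<Longrightarrow> P \<subseteq> J \<Longrightarrow> J \<inter> M = {} \<Longrightarrow> J = P" by auto
  interpret P: ideal P R by fact
  have ext: "\<exists>m\<in>M. \<exists>r\<in>carrier R. \<exists>z\<in>P. m = z \<oplus> r \<otimes> a" if a: "a \<in> carrier R" "a \<notin> P" for a
  proof -
    let ?J = "set_add R P (PIdl a)"
    have J: "ideal ?J R" using add_ideals[OF P(1) cgenideal_ideal[OF a(1)]] .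
    have "P \<subseteq> ?J"
    proof
      fix z assume "z \<in> P"
      then have "z \<oplus> \<zero> \<in> ?J" using set_add_def'[of R P "PIdl a"]
          additive_subgroup.zero_closed[OF ideal.axioms(1)[OF cgenideal_ideal[OF a(1)]]] by blast
      then show "z \<in> ?J" using \<open>z \<in> P\<close> by simp
    qed
    moreover have "a \<in> ?J"
    proof -
      have "\<zero> \<oplus> a \<in> ?J" using set_add_def'[of R P "PIdl a"] cgenideal_self[OF a(1)] P.zero_closed
        by blast
      then show ?thesis using a by simp
    qed
    ultimately have "?J \<inter> M \<noteq> {}" using max[OF J] a by blast
    then show ?thesis unfolding set_add_def' cgenideal_def by blast
  qed
  have "primeideal P R"
  proof (rule primeidealI)
    show "carrier R \<noteq> P" using P(3) M by blast
    fix a b assume ab: "a \<in> carrier R" "b \<in> carrier R" "a \<otimes> b \<in> P"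
    show "a \<in> P \<or> b \<in> P"
    proof (rule ccontr)
      assume "\<not> (a \<in> P \<or> b \<in> P)"
      then obtain m r z m' r' z' where
        1: "m \<in> M" "r \<in> carrier R" "z \<in> P" "m = z \<oplus> r \<otimes> a" and
        2: "m' \<in> M" "r' \<in> carrier R" "z' \<in> P" "m' = z' \<oplus> r' \<otimes> b"
        using ext ab by metis
      have c: "z \<in> carrier R" "z' \<in> carrier R" using 1 2 P.Icarr by auto
      have "m \<otimes> m' = z \<otimes> m' \<oplus> ((r \<otimes> a) \<otimes> z' \<oplus> (r \<otimes> r') \<otimes> (a \<otimes> b))"
        using 1 2 ab c by (simp add: l_distr r_distr m_ac a_ac)
      moreover have "z \<otimes> m' \<in> P" using 1 2 M P.I_r_closed by blast
      moreover have "(r \<otimes> a) \<otimes> z' \<in> P" "(r \<otimes> r') \<otimes> (a \<otimes> b) \<in> P"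
        using 1 2 c ab by (auto intro!: P.I_l_closed)
      ultimately have "m \<otimes> m' \<in> P" by simp
      then show False using P(3) M(3)[OF 1(1) 2(1)] by auto
    qed
  qed (use P is_cring in auto)
  then show ?thesis using P by blast
qed

lemma (in noetherian_ring) exists_maximal_ideal_in:
  assumes "\<I> \<noteq> {}" "\<And>I. I \<in> \<I> \<Longrightarrow> ideal I R"
  shows "\<exists>I\<in>\<I>. \<forall>J\<in>\<I>. I \<subseteq> J \<longrightarrow> J = I"
proof (rule subset_Zorn_nonempty)
  fix C assume C: "C \<noteq> {}" "subset.chain \<I> C"
  then have "subset.chain {I. ideal I R} C" using assms(2) by (auto simp: pred_on.chain_def)
  then have "\<Union>C \<in> C" using C ideal_chain_is_trivial by blast
  then show "\<Union>C \<in> \<I>" using C by (auto simp: pred_on.chain_def)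
qed (use assms in auto)

text \<open>Fraction-free Gaussian elimination over the domain \<open>R/P\<close>, with the entries lifted to \<open>R\<close>.\<close>

lemma (in primeideal) exists_linear_dependence:
  assumes "finite F" "finite J" "card F < card J"
    and "\<And>i j. i \<in> F \<Longrightarrow> j \<in> J \<Longrightarrow> f i j \<in> carrier R"
  shows "\<exists>c. (\<forall>j\<in>J. c j \<in> carrier R) \<and> (\<exists>j\<in>J. c j \<notin> I) \<and>
    (\<forall>i\<in>F. (\<Oplus>j\<in>J. c j \<otimes> f i j) \<in> I)"
  using assms
proof (induction F arbitrary: J f rule: finite_induct)
  case empty
  then obtain j where "j \<in> J" by (metis card.empty equals0I less_irrefl)
  then show ?case using I_notcarr one_imp_carrier by (intro exI[of _ "\<lambda>_. \<one>"]) auto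
next
  case (insert i0 F)
  show ?case
  proof (cases "\<forall>j\<in>J. f i0 j \<in> I")
    case True
    have "\<exists>c. (\<forall>j\<in>J. c j \<in> carrier R) \<and> (\<exists>j\<in>J. c j \<notin> I) \<and>
        (\<forall>i\<in>F. (\<Oplus>j\<in>J. c j \<otimes> f i j) \<in> I)"
      using insert by (intro insert.IH) auto
    then obtain c where c: "\<forall>j\<in>J. c j \<in> carrier R" "\<exists>j\<in>J. c j \<notin> I"
      "\<forall>i\<in>F. (\<Oplus>j\<in>J. c j \<otimes> f i j) \<in> I" by blast
    have "(\<Oplus>j\<in>J. c j \<otimes> f i0 j) \<in> I" using c True by (intro finsum_in_ideal I_l_closed) auto
    then show ?thesis using c by (intro exI[of _ c]) auto
  next
    case False
    then obtain k where k: "k \<in> J" "f i0 k \<notin> I" by blast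
    let ?J = "J - {k}"
    \<comment> \<open>clear the row \<open>i0\<close> with the pivot \<open>f i0 k\<close>; column \<open>k\<close> is restored by \<open>d\<close> below\<close>
    define g where "g i j = f i0 k \<otimes> f i j \<ominus> f i0 j \<otimes> f i k" for i j
    have "\<exists>c. (\<forall>j\<in>?J. c j \<in> carrier R) \<and> (\<exists>j\<in>?J. c j \<notin> I) \<and>
        (\<forall>i\<in>F. (\<Oplus>j\<in>?J. c j \<otimes> g i j) \<in> I)"
      using insert k by (intro insert.IH) (auto simp: g_def)
    then obtain c where c: "\<And>j. j \<in> ?J \<Longrightarrow> c j \<in> carrier R" "\<exists>j\<in>?J. c j \<notin> I"
      "\<And>i. i \<in> F \<Longrightarrow> (\<Oplus>j\<in>?J. c j \<otimes> g i j) \<in> I" by blast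
    define d where "d j = (if j = k then \<ominus> (\<Oplus>j\<in>?J. c j \<otimes> f i0 j) else c j \<otimes> f i0 k)" for j
    have fc: "f i j \<in> carrier R" if "i \<in> insert i0 F" "j \<in> J" for i j using insert.prems that by blast
    have d: "d j \<in> carrier R" if "j \<in> J" for j
      using that k c fc by (auto simp: d_def intro!: a_inv_closed finsum_closed)
    have sum: "(\<Oplus>j\<in>J. d j \<otimes> f i j) = (\<Oplus>j\<in>?J. c j \<otimes> g i j)" if i: "i \<in> insert i0 F" for i
    proof -
      have J: "J = insert k ?J" using k by blast
      have s: "(\<Oplus>j\<in>?J. c j \<otimes> f i0 j) \<in> carrier R" using c fc by (intro finsum_closed) auto
      have "(\<Oplus>j\<in>J. d j \<otimes> f i j) = d k \<otimes> f i k \<oplus> (\<Oplus>j\<in>?J. d j \<otimes> f i j)"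
        by (subst J, subst finsum_insert) (use insert.prems d fc i k in auto)
      also have "d k \<otimes> f i k = (\<Oplus>j\<in>?J. \<ominus> (c j \<otimes> f i0 j \<otimes> f i k))"
      proof -
        have "d k \<otimes> f i k = (\<Oplus>j\<in>?J. c j \<otimes> f i0 j) \<otimes> (\<ominus> f i k)"
          using s fc i k by (simp add: d_def l_minus r_minus)
        also have "\<dots> = (\<Oplus>j\<in>?J. c j \<otimes> f i0 j \<otimes> (\<ominus> f i k))"
          using insert.prems c fc i k by (intro finsum_ldistr) auto
        also have "\<dots> = (\<Oplus>j\<in>?J. \<ominus> (c j \<otimes> f i0 j \<otimes> f i k))"
          using c fc i k by (intro add.finprod_cong') (auto simp: r_minus)
        finally show ?thesis .
      qed
      also have "\<dots> \<oplus> (\<Oplus>j\<in>?J. d j \<otimes> f i j)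
          = (\<Oplus>j\<in>?J. \<ominus> (c j \<otimes> f i0 j \<otimes> f i k) \<oplus> d j \<otimes> f i j)"
        using c fc i k d by (intro add.finprod_multf[symmetric]) auto
      also have "\<dots> = (\<Oplus>j\<in>?J. c j \<otimes> g i j)"
      proof (intro add.finprod_cong')
        fix j assume j: "j \<in> ?J"
        then have "d j = c j \<otimes> f i0 k" by (simp add: d_def)
        then show "\<ominus> (c j \<otimes> f i0 j \<otimes> f i k) \<oplus> d j \<otimes> f i j = c j \<otimes> g i j"
          using j c fc[OF i, of j] fc[OF i, of k] fc[of i0 j] fc[of i0 k] k
          by (simp add: g_def minus_eq r_distr r_minus m_assoc a_comm)
      qed (use c fc i k in \<open>auto simp: g_def\<close>)
      finally show ?thesis .
    qed
    have "(\<Oplus>j\<in>?J. c j \<otimes> g i0 j) = (\<Oplus>j\<in>?J. \<zero>)"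
      using c fc k by (intro add.finprod_cong') (auto simp: g_def m_comm minus_eq r_neg)
    then have "(\<Oplus>j\<in>?J. c j \<otimes> g i0 j) \<in> I" by simp
    then have "\<forall>i\<in>insert i0 F. (\<Oplus>j\<in>J. d j \<otimes> f i j) \<in> I" using sum c(3) by auto
    moreover have "\<exists>j\<in>J. d j \<notin> I"
    proof -
      obtain j where j: "j \<in> ?J" "c j \<notin> I" using c(2) by blast
      then have "c j \<otimes> f i0 k \<notin> I" using I_prime[of "c j" "f i0 k"] c(1) fc k by auto
      then show ?thesis using j by (intro bexI[of _ j]) (auto simp: d_def)
    qed
    ultimately show ?thesis using d by blast
  qed
qed

section \<open>Localization and the maps induced on residue rings\<close>

locale ring_localization = cring +
  fixes M :: "'a set"
  assumes M_carrier: "M \<subseteq> carrier R"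
    and one_in_M [simp, intro]: "\<one> \<in> M"
    and M_mult_closed [simp, intro]: "\<And>s t. s \<in> M \<Longrightarrow> t \<in> M \<Longrightarrow> s \<otimes> t \<in> M"
begin

abbreviation "L \<equiv> localization R M"
abbreviation "fr \<equiv> frac R M"

lemma M_mem [simp, intro]: "s \<in> M \<Longrightarrow> s \<in> carrier R"
  using M_carrier by blast

lemma M_pow_closed [simp, intro]: "s \<in> M \<Longrightarrow> s [^] (n::nat) \<in> M"
  by (induction n) auto

lemma equiv_frac_rel: "equiv (carrier R \<times> M) (frac_rel R M)"
proof (rule equivI)
  show "frac_rel R M \<subseteq> (carrier R \<times> M) \<times> (carrier R \<times> M)" by (auto simp: frac_rel_def)
  show "refl_on (carrier R \<times> M) (frac_rel R M)"
    by (auto simp: refl_on_def frac_rel_def)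
  show "sym (frac_rel R M)" unfolding sym_def frac_rel_def by (auto, metis)
  show "trans (frac_rel R M)"
  proof (rule transI, clarify)
    fix a s b t c w
    assume "((a, s), (b, t)) \<in> frac_rel R M" "((b, t), (c, w)) \<in> frac_rel R M"
    then obtain u v where [simp]: "a \<in> carrier R" "b \<in> carrier R" "c \<in> carrier R"
      "s \<in> M" "t \<in> M" "w \<in> M" "u \<in> M" "v \<in> M"
      and 1: "u \<otimes> (a \<otimes> t) = u \<otimes> (b \<otimes> s)" and 2: "v \<otimes> (b \<otimes> w) = v \<otimes> (c \<otimes> t)"
      by (auto simp: frac_rel_def)
    have "(u \<otimes> (v \<otimes> t)) \<otimes> (a \<otimes> w) = (v \<otimes> w) \<otimes> (u \<otimes> (a \<otimes> t))" by (simp add: m_ac)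
    also have "\<dots> = (u \<otimes> s) \<otimes> (v \<otimes> (b \<otimes> w))" unfolding 1 by (simp add: m_ac)
    also have "\<dots> = (u \<otimes> (v \<otimes> t)) \<otimes> (c \<otimes> s)" unfolding 2 by (simp add: m_ac)
    finally show "((a, s), (c, w)) \<in> frac_rel R M"
      by (auto simp: frac_rel_def intro!: bexI[of _ "u \<otimes> (v \<otimes> t)"])
  qed
qed

lemma frac_eq_iff:
  assumes "a \<in> carrier R" "b \<in> carrier R" "s \<in> M" "t \<in> M"
  shows "fr a s = fr b t \<longleftrightarrow> (\<exists>u\<in>M. u \<otimes> (a \<otimes> t) = u \<otimes> (b \<otimes> s))"
  using eq_equiv_class_iff[OF equiv_frac_rel, of "(a, s)" "(b, t)"] assms
  by (simp add: frac_def) (simp add: frac_rel_def)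

lemma frac_eqE:
  assumes "fr a s = fr b t" and "a \<in> carrier R" "b \<in> carrier R" "s \<in> M" "t \<in> M"
  obtains u where "u \<in> M" "u \<otimes> (a \<otimes> t) = u \<otimes> (b \<otimes> s)"
proof -
  have "\<exists>u\<in>M. u \<otimes> (a \<otimes> t) = u \<otimes> (b \<otimes> s)"
    using assms(1) frac_eq_iff[OF assms(2-5)] by simp
  then show thesis using that by blast
qed

lemma mem_fracD:
  assumes "(b, t) \<in> fr a s"
  shows "b \<in> carrier R" "t \<in> M" "fr b t = fr a s"
proof -
  from assms have *: "((a, s), (b, t)) \<in> frac_rel R M" by (simp add: frac_def)
  then show "b \<in> carrier R" "t \<in> M" by (auto simp: frac_rel_def)
  show "fr b t = fr a s" using equiv_class_eq[OF equiv_frac_rel *] by (simp add: frac_def)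
qed

lemma mem_frac_self:
  assumes "a \<in> carrier R" "s \<in> M" shows "(a, s) \<in> fr a s"
  using assms equiv_class_self[OF equiv_frac_rel, of "(a, s)"] by (simp add: frac_def)

lemma carrier_localization: "carrier L = {fr a s | a s. a \<in> carrier R \<and> s \<in> M}"
  by (auto simp: localization_def quotient_def frac_def)

lemma frac_closed [simp, intro]: "a \<in> carrier R \<Longrightarrow> s \<in> M \<Longrightarrow> fr a s \<in> carrier L"
  by (auto simp: carrier_localization)

lemma frac_cases:
  assumes "x \<in> carrier L" obtains a s where "x = fr a s" "a \<in> carrier R" "s \<in> M"
  using assms by (auto simp: carrier_localization)

lemma frac_union:
  assumes "a \<in> carrier R" "s \<in> M"
    and "\<And>b t. b \<in> carrier R \<Longrightarrow> t \<in> M \<Longrightarrow> fr b t = fr a s \<Longrightarrow> F b t = F a s"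
  shows "(\<Union>(b, t)\<in>fr a s. F b t) = F a s"
proof -
  have "F b t = F a s" if "(b, t) \<in> fr a s" for b t
    using mem_fracD[OF that] by (rule assms(3))
  then have "(\<Union>(b, t)\<in>fr a s. F b t) = (\<Union>(b, t)\<in>fr a s. F a s)" by (intro SUP_cong) auto
  also have "\<dots> = F a s" using mem_frac_self[OF assms(1,2)] by auto
  finally show ?thesis .
qed

lemma mult_frac:
  assumes [simp]: "a \<in> carrier R" "s \<in> M" "b \<in> carrier R" "t \<in> M"
  shows "fr a s \<otimes>\<^bsub>L\<^esub> fr b t = fr (a \<otimes> b) (s \<otimes> t)"
proof -
  have eq: "fr (a' \<otimes> b') (s' \<otimes> t') = fr (a \<otimes> b) (s \<otimes> t)"
    if c [simp]: "a' \<in> carrier R" "s' \<in> M" "b' \<in> carrier R" "t' \<in> M"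
      and e: "fr a' s' = fr a s" "fr b' t' = fr b t" for a' b' s' t'
  proof -
    obtain u where [simp]: "u \<in> M" and u: "u \<otimes> (a' \<otimes> s) = u \<otimes> (a \<otimes> s')"
      by (rule frac_eqE[OF e(1) c(1) assms(1) c(2) assms(2)])
    obtain v where [simp]: "v \<in> M" and v: "v \<otimes> (b' \<otimes> t) = v \<otimes> (b \<otimes> t')"
      by (rule frac_eqE[OF e(2) c(3) assms(3) c(4) assms(4)])
    have "(u \<otimes> v) \<otimes> ((a' \<otimes> b') \<otimes> (s \<otimes> t)) = (u \<otimes> (a' \<otimes> s)) \<otimes> (v \<otimes> (b' \<otimes> t))"
      by (simp add: m_ac)
    also have "\<dots> = (u \<otimes> v) \<otimes> ((a \<otimes> b) \<otimes> (s' \<otimes> t'))" unfolding u v by (simp add: m_ac)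
    finally have "\<exists>w\<in>M. w \<otimes> ((a' \<otimes> b') \<otimes> (s \<otimes> t)) = w \<otimes> ((a \<otimes> b) \<otimes> (s' \<otimes> t'))"
      by (intro bexI[of _ "u \<otimes> v"]) simp_all
    then show ?thesis by (subst frac_eq_iff) simp_all
  qed
  have "fr a s \<otimes>\<^bsub>L\<^esub> fr b t = (\<Union>(a, s)\<in>fr a s. \<Union>(b, t)\<in>fr b t. fr (a \<otimes> b) (s \<otimes> t))"
    by (simp add: localization_def)
  also have "\<dots> = (\<Union>(b', t')\<in>fr b t. fr (a \<otimes> b') (s \<otimes> t'))"
    proof (rule frac_union)
    fix a' s' assume [simp]: "a' \<in> carrier R" "s' \<in> M" and "fr a' s' = fr a s"
    then have "fr (a' \<otimes> b') (s' \<otimes> t') = fr (a \<otimes> b') (s \<otimes> t')" if "(b', t') \<in> fr b t" for b' t'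
      using mem_fracD[OF that] eq[of a' s' b' t'] eq[of a s b' t'] by simp
    then show "(\<Union>(b', t')\<in>fr b t. fr (a' \<otimes> b') (s' \<otimes> t')) = (\<Union>(b', t')\<in>fr b t. fr (a \<otimes> b') (s \<otimes> t'))"
      by (intro SUP_cong) auto
  qed auto
  also have "\<dots> = fr (a \<otimes> b) (s \<otimes> t)" by (rule frac_union, simp, simp, rule eq) simp_all
  finally show ?thesis .
qed

lemma add_frac:
  assumes [simp]: "a \<in> carrier R" "s \<in> M" "b \<in> carrier R" "t \<in> M"
  shows "fr a s \<oplus>\<^bsub>L\<^esub> fr b t = fr ((a \<otimes> t) \<oplus> (b \<otimes> s)) (s \<otimes> t)"
proof -
  have eq: "fr ((a' \<otimes> t') \<oplus> (b' \<otimes> s')) (s' \<otimes> t') = fr ((a \<otimes> t) \<oplus> (b \<otimes> s)) (s \<otimes> t)"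
    if c [simp]: "a' \<in> carrier R" "s' \<in> M" "b' \<in> carrier R" "t' \<in> M"
      and e: "fr a' s' = fr a s" "fr b' t' = fr b t" for a' b' s' t'
  proof -
    obtain u where [simp]: "u \<in> M" and u: "u \<otimes> (a' \<otimes> s) = u \<otimes> (a \<otimes> s')"
      by (rule frac_eqE[OF e(1) c(1) assms(1) c(2) assms(2)])
    obtain v where [simp]: "v \<in> M" and v: "v \<otimes> (b' \<otimes> t) = v \<otimes> (b \<otimes> t')"
      by (rule frac_eqE[OF e(2) c(3) assms(3) c(4) assms(4)])
    have "(u \<otimes> v) \<otimes> (((a' \<otimes> t') \<oplus> (b' \<otimes> s')) \<otimes> (s \<otimes> t))
        = (v \<otimes> (t' \<otimes> t)) \<otimes> (u \<otimes> (a' \<otimes> s)) \<oplus> (u \<otimes> (s' \<otimes> s)) \<otimes> (v \<otimes> (b' \<otimes> t))"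
      by (simp add: m_ac l_distr r_distr)
    also have "\<dots> = (u \<otimes> v) \<otimes> (((a \<otimes> t) \<oplus> (b \<otimes> s)) \<otimes> (s' \<otimes> t'))"
      unfolding u v by (simp add: m_ac l_distr r_distr)
    finally have "\<exists>w\<in>M. w \<otimes> (((a' \<otimes> t') \<oplus> (b' \<otimes> s')) \<otimes> (s \<otimes> t))
        = w \<otimes> (((a \<otimes> t) \<oplus> (b \<otimes> s)) \<otimes> (s' \<otimes> t'))"
      by (intro bexI[of _ "u \<otimes> v"]) simp_all
    then show ?thesis by (subst frac_eq_iff) simp_all
  qed
  have "fr a s \<oplus>\<^bsub>L\<^esub> fr b t
      = (\<Union>(a, s)\<in>fr a s. \<Union>(b, t)\<in>fr b t. fr ((a \<otimes> t) \<oplus> (b \<otimes> s)) (s \<otimes> t))"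
    by (simp add: localization_def)
  also have "\<dots> = (\<Union>(b', t')\<in>fr b t. fr ((a \<otimes> t') \<oplus> (b' \<otimes> s)) (s \<otimes> t'))"
    proof (rule frac_union)
    fix a' s' assume [simp]: "a' \<in> carrier R" "s' \<in> M" and "fr a' s' = fr a s"
    then have "fr ((a' \<otimes> t') \<oplus> (b' \<otimes> s')) (s' \<otimes> t') = fr ((a \<otimes> t') \<oplus> (b' \<otimes> s)) (s \<otimes> t')" if "(b', t') \<in> fr b t" for b' t'
      using mem_fracD[OF that] eq[of a' s' b' t'] eq[of a s b' t'] by simp
    then show "(\<Union>(b', t')\<in>fr b t. fr ((a' \<otimes> t') \<oplus> (b' \<otimes> s')) (s' \<otimes> t')) = (\<Union>(b', t')\<in>fr b t. fr ((a \<otimes> t') \<oplus> (b' \<otimes> s)) (s \<otimes> t'))"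
      by (intro SUP_cong) auto
  qed auto
  also have "\<dots> = fr ((a \<otimes> t) \<oplus> (b \<otimes> s)) (s \<otimes> t)" by (rule frac_union, simp, simp, rule eq) simp_all
  finally show ?thesis .
qed

lemma one_frac: "\<one>\<^bsub>L\<^esub> = fr \<one> \<one>" and zero_frac: "\<zero>\<^bsub>L\<^esub> = fr \<zero> \<one>"
  by (simp_all add: localization_def)

lemma frac_eqI:
  assumes "a \<in> carrier R" "b \<in> carrier R" "s \<in> M" "t \<in> M" "a \<otimes> t = b \<otimes> s"
  shows "fr a s = fr b t"
  using assms frac_eq_iff by (auto intro!: bexI[of _ \<one>])

lemma frac_zero [simp]: "s \<in> M \<Longrightarrow> fr \<zero> s = \<zero>\<^bsub>L\<^esub>"
  unfolding zero_frac by (rule frac_eqI) auto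

lemma cring_localization: "cring L"
proof (rule cringI)
  show "abelian_group L"
  proof (rule abelian_groupI)
    fix x y z assume "x \<in> carrier L" "y \<in> carrier L" "z \<in> carrier L"
    then obtain a s b t c u where [simp]: "a \<in> carrier R" "s \<in> M" "b \<in> carrier R" "t \<in> M"
      "c \<in> carrier R" "u \<in> M" and x: "x = fr a s" "y = fr b t" "z = fr c u"
      by (meson frac_cases)
    show "x \<oplus>\<^bsub>L\<^esub> y \<in> carrier L" by (simp add: x add_frac)
    show "x \<oplus>\<^bsub>L\<^esub> y \<oplus>\<^bsub>L\<^esub> z = x \<oplus>\<^bsub>L\<^esub> (y \<oplus>\<^bsub>L\<^esub> z)"
      unfolding x by (simp add: add_frac) (rule frac_eqI; simp add: m_ac a_ac l_distr r_distr)
    show "x \<oplus>\<^bsub>L\<^esub> y = y \<oplus>\<^bsub>L\<^esub> x"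
      unfolding x by (simp add: add_frac) (rule frac_eqI; simp add: m_ac a_ac l_distr r_distr)
    show "\<zero>\<^bsub>L\<^esub> \<oplus>\<^bsub>L\<^esub> x = x" unfolding x zero_frac by (simp add: add_frac del: frac_zero)
    have "fr (\<ominus> a) s \<oplus>\<^bsub>L\<^esub> x = \<zero>\<^bsub>L\<^esub>"
      by (simp add: x add_frac l_minus l_neg)
    then show "\<exists>y\<in>carrier L. y \<oplus>\<^bsub>L\<^esub> x = \<zero>\<^bsub>L\<^esub>" by (intro bexI[of _ "fr (\<ominus> a) s"]) auto
  qed (use frac_closed[of \<zero> \<one>] in simp)
  show "Group.comm_monoid L"
  proof (rule comm_monoidI)
    fix x y z assume "x \<in> carrier L" "y \<in> carrier L" "z \<in> carrier L"
    then obtain a s b t c u where [simp]: "a \<in> carrier R" "s \<in> M" "b \<in> carrier R" "t \<in> M"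
      "c \<in> carrier R" "u \<in> M" and x: "x = fr a s" "y = fr b t" "z = fr c u"
      by (meson frac_cases)
    show "x \<otimes>\<^bsub>L\<^esub> y \<in> carrier L" by (simp add: x mult_frac)
    show "x \<otimes>\<^bsub>L\<^esub> y \<otimes>\<^bsub>L\<^esub> z = x \<otimes>\<^bsub>L\<^esub> (y \<otimes>\<^bsub>L\<^esub> z)" by (simp add: x mult_frac m_assoc)
    show "x \<otimes>\<^bsub>L\<^esub> y = y \<otimes>\<^bsub>L\<^esub> x" by (simp add: x mult_frac m_comm)
    show "\<one>\<^bsub>L\<^esub> \<otimes>\<^bsub>L\<^esub> x = x" by (simp add: x mult_frac one_frac)
  qed (simp add: one_frac)
  fix x y z assume "x \<in> carrier L" "y \<in> carrier L" "z \<in> carrier L"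
  then obtain a s b t c u where [simp]: "a \<in> carrier R" "s \<in> M" "b \<in> carrier R" "t \<in> M"
    "c \<in> carrier R" "u \<in> M" and x: "x = fr a s" "y = fr b t" "z = fr c u"
    by (meson frac_cases)
  show "(x \<oplus>\<^bsub>L\<^esub> y) \<otimes>\<^bsub>L\<^esub> z = x \<otimes>\<^bsub>L\<^esub> z \<oplus>\<^bsub>L\<^esub> y \<otimes>\<^bsub>L\<^esub> z"
    unfolding x by (simp add: add_frac mult_frac) (rule frac_eqI; simp add: m_ac l_distr r_distr)
qed

sublocale L: cring L by (rule cring_localization)

lemma pow_frac:
  assumes [simp]: "a \<in> carrier R" "s \<in> M"
  shows "fr a s [^]\<^bsub>L\<^esub> (n::nat) = fr (a [^] n) (s [^] n)"
  by (induction n) (simp_all add: one_frac mult_frac)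

lemma frac_add_same_denom:
  assumes [simp]: "a \<in> carrier R" "b \<in> carrier R" "s \<in> M"
  shows "fr a s \<oplus>\<^bsub>L\<^esub> fr b s = fr (a \<oplus> b) s"
  by (simp add: add_frac) (rule frac_eqI; simp add: m_ac l_distr r_distr)

lemma frac_expand:
  assumes "a \<in> carrier R" "s \<in> M" "t \<in> M"
  shows "fr a s = fr (a \<otimes> t) (s \<otimes> t)"
  by (rule frac_eqI) (use assms in \<open>auto simp: m_ac\<close>)

text \<open>The extension of an ideal \<open>I\<close> to the localization, as a set of fractions.\<close>

definition "fractions_of I = {fr a s | a s. a \<in> I \<and> s \<in> M}"

lemma fractions_ofI: "a \<in> I \<Longrightarrow> s \<in> M \<Longrightarrow> fr a s \<in> fractions_of I"
  unfolding fractions_of_def by blast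

lemma fractions_ofE:
  assumes "x \<in> fractions_of I" obtains a s where "a \<in> I" "s \<in> M" "x = fr a s"
  using assms unfolding fractions_of_def by blast

lemma ideal_fractions_of:
  assumes "ideal I R" shows "ideal (fractions_of I) L"
proof (rule idealI)
  interpret I: ideal I R by fact
  show "ring L" by (rule L.ring_axioms)
  show "subgroup (fractions_of I) (add_monoid L)"
  proof (rule L.add.subgroupI)
    show "fractions_of I \<subseteq> carrier L" using I.Icarr by (auto elim!: fractions_ofE)
    show "fractions_of I \<noteq> {}" using fractions_ofI[OF I.zero_closed one_in_M] by blast
  next
    fix x assume "x \<in> fractions_of I"
    then obtain a s where [simp]: "a \<in> I" "s \<in> M" and x: "x = fr a s"
      by (rule fractions_ofE)
    have [simp]: "a \<in> carrier R" by (simp add: I.Icarr)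
    have "fr (\<ominus> a) s \<oplus>\<^bsub>L\<^esub> x = \<zero>\<^bsub>L\<^esub>" by (simp add: x frac_add_same_denom l_neg)
    then have "\<ominus>\<^bsub>L\<^esub> x = fr (\<ominus> a) s" by (intro L.minus_equality) (auto simp: x)
    then show "\<ominus>\<^bsub>L\<^esub> x \<in> fractions_of I" by (simp add: fractions_ofI)
  next
    fix x y assume "x \<in> fractions_of I" "y \<in> fractions_of I"
    then obtain a s b t where [simp]: "a \<in> I" "s \<in> M" "b \<in> I" "t \<in> M"
      and x: "x = fr a s" "y = fr b t" by (meson fractions_ofE)
    have [simp]: "a \<in> carrier R" "b \<in> carrier R" by (simp_all add: I.Icarr)
    have "a \<otimes> t \<oplus> b \<otimes> s \<in> I" by (intro I.a_closed I.I_r_closed) auto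
    moreover have "x \<oplus>\<^bsub>L\<^esub> y = fr (a \<otimes> t \<oplus> b \<otimes> s) (s \<otimes> t)" by (simp add: x add_frac)
    ultimately show "x \<oplus>\<^bsub>L\<^esub> y \<in> fractions_of I" by (simp add: fractions_ofI)
  qed
  have l: "y \<otimes>\<^bsub>L\<^esub> x \<in> fractions_of I" if xy: "x \<in> fractions_of I" "y \<in> carrier L" for x y
  proof -
    obtain a s where [simp]: "a \<in> I" "s \<in> M" and x: "x = fr a s"
      using xy(1) by (rule fractions_ofE)
    obtain b t where [simp]: "b \<in> carrier R" "t \<in> M" and y: "y = fr b t"
      using xy(2) by (rule frac_cases)
    have [simp]: "a \<in> carrier R" by (simp add: I.Icarr)
    have "b \<otimes> a \<in> I" by (intro I.I_l_closed) auto
    moreover have "y \<otimes>\<^bsub>L\<^esub> x = fr (b \<otimes> a) (t \<otimes> s)" by (simp add: x y mult_frac)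
    ultimately show ?thesis by (simp add: fractions_ofI)
  qed
  fix x y assume xy: "x \<in> fractions_of I" "y \<in> carrier L"
  show "y \<otimes>\<^bsub>L\<^esub> x \<in> fractions_of I" using l xy .
  have "x \<in> carrier L" using xy(1) I.Icarr by (auto elim!: fractions_ofE)
  then show "x \<otimes>\<^bsub>L\<^esub> y \<in> fractions_of I" using l[OF xy] xy L.m_comm by simp
qed

lemma frac_in_fractions_of_iff:
  assumes I: "ideal I R" and a: "a \<in> carrier R" "s \<in> M"
  shows "fr a s \<in> fractions_of I \<longleftrightarrow> (\<exists>u\<in>M. u \<otimes> a \<in> I)"
proof
  interpret ideal I R by fact
  assume "fr a s \<in> fractions_of I"
  then obtain b t where b: "b \<in> I" "t \<in> M" "fr a s = fr b t" by (rule fractions_ofE)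
  have [simp]: "b \<in> carrier R" using b by (simp add: Icarr)
  obtain u where u: "u \<in> M" "u \<otimes> (a \<otimes> t) = u \<otimes> (b \<otimes> s)"
    by (rule frac_eqE[OF b(3) a(1) _ a(2) b(2)]) simp
  have "u \<otimes> (b \<otimes> s) \<in> I" using u a b by (intro I_l_closed I_r_closed) auto
  moreover have "(u \<otimes> t) \<otimes> a = u \<otimes> (a \<otimes> t)" using u a b by (simp add: m_ac)
  ultimately have "(u \<otimes> t) \<otimes> a \<in> I" using u by simp
  then show "\<exists>u\<in>M. u \<otimes> a \<in> I" using u b by blast
next
  interpret ideal I R by fact
  assume "\<exists>u\<in>M. u \<otimes> a \<in> I"
  then obtain u where u: "u \<in> M" "u \<otimes> a \<in> I" by blast
  have "a \<otimes> u \<in> I" using u a by (simp add: m_comm)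
  then have "fr (a \<otimes> u) (s \<otimes> u) \<in> fractions_of I" using u a by (intro fractions_ofI) auto
  then show "fr a s \<in> fractions_of I" using frac_expand[OF a u(1)] by simp
qed

lemma extend_loc_subset:
  assumes "ideal I R" "G \<subseteq> I"
  shows "extend_loc R M G \<subseteq> fractions_of I"
  unfolding extend_loc_def
  by (rule L.genideal_minimal[OF ideal_fractions_of]) (use assms in \<open>auto intro: fractions_ofI\<close>)

lemma ideal_extend_loc:
  assumes "G \<subseteq> carrier R" shows "ideal (extend_loc R M G) L"
  unfolding extend_loc_def by (rule L.genideal_ideal) (use assms in auto)

lemma ring_hom_frac: "(\<lambda>a. fr a \<one>) \<in> ring_hom R L"
  by (rule ring_hom_memI) (auto simp: mult_frac one_frac frac_add_same_denom)

text \<open>The elements of \<open>R\<close> that the localization sends into the extended ideal form an ideal containing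
  the generators.\<close>

lemma fractions_of_Idl_subset:
  assumes G: "G \<subseteq> carrier R"
  shows "fractions_of (Idl G) \<subseteq> extend_loc R M G"
proof
  interpret E: ideal "extend_loc R M G" L using ideal_extend_loc[OF G] .
  interpret h: ring_hom_ring R L "\<lambda>a. fr a \<one>"
    by (rule ring_hom_ringI2) (use ring_hom_frac in \<open>auto simp: ring_axioms L.ring_axioms\<close>)
  have "ideal {a \<in> carrier R. fr a \<one> \<in> extend_loc R M G} R"
    using h.ideal_vimage[OF E.ideal_axioms] .
  moreover have "G \<subseteq> {a \<in> carrier R. fr a \<one> \<in> extend_loc R M G}"
    using L.genideal_self[of "(\<lambda>a. fr a \<one>) ` G"] G by (auto simp: extend_loc_def)
  ultimately have sub: "Idl G \<subseteq> {a \<in> carrier R. fr a \<one> \<in> extend_loc R M G}"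
    by (rule genideal_minimal)
  fix x assume "x \<in> fractions_of (Idl G)"
  then obtain a s where a: "a \<in> Idl G" "s \<in> M" "x = fr a s"
    by (rule fractions_ofE)
  then have 1: "a \<in> carrier R" "fr a \<one> \<in> extend_loc R M G" using sub by auto
  have "fr \<one> s \<otimes>\<^bsub>L\<^esub> fr a \<one> \<in> extend_loc R M G" using a 1 by (intro E.I_l_closed) auto
  then show "x \<in> extend_loc R M G" using a 1 by (simp add: mult_frac)
qed

lemma extend_loc_ideal:
  assumes "ideal I R" shows "extend_loc R M I = fractions_of I"
proof
  show "extend_loc R M I \<subseteq> fractions_of I" by (rule extend_loc_subset[OF assms]) simp
  have I: "I \<subseteq> carrier R" using ideal.Icarr[OF assms] by blast
  have "fractions_of I \<subseteq> fractions_of (Idl I)"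
    using genideal_self[OF I] by (auto elim!: fractions_ofE intro!: fractions_ofI)
  then show "fractions_of I \<subseteq> extend_loc R M I" using fractions_of_Idl_subset[OF I] by blast
qed

text \<open>With \<open>k = q - 1\<close>, so that the exponent in \<^const>\<open>loc_map\<close> is visible to rewriting.\<close>

lemma loc_map_well_defined:
  assumes f: "frob_linear R (Suc k) f"
    and [simp]: "a \<in> carrier R" "s \<in> M" "b \<in> carrier R" "t \<in> M" and "fr a s = fr b t"
  shows "fr (f (a \<otimes> s [^] k)) s = fr (f (b \<otimes> t [^] k)) t"
proof -
  have fc [simp]: "f x \<in> carrier R" if "x \<in> carrier R" for x
    using f that by (auto simp: frob_linear_def)
  have fl: "c \<otimes> f x = f (c [^] Suc k \<otimes> x)" if "x \<in> carrier R" "c \<in> carrier R" for x c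
    using f that by (auto simp: frob_linear_def)
  obtain u where [simp]: "u \<in> M" and u: "u \<otimes> (a \<otimes> t) = u \<otimes> (b \<otimes> s)"
    by (rule frac_eqE[OF assms(6) assms(2,4,3,5)])
  have "u \<otimes> (f (a \<otimes> s [^] k) \<otimes> t) = (u \<otimes> t) \<otimes> f (a \<otimes> s [^] k)" by (simp add: m_ac)
  also have "\<dots> = f ((u \<otimes> t) [^] Suc k \<otimes> (a \<otimes> s [^] k))" by (rule fl) auto
  also have "(u \<otimes> t) [^] Suc k \<otimes> (a \<otimes> s [^] k)
      = (u [^] k \<otimes> (s [^] k \<otimes> t [^] k)) \<otimes> (u \<otimes> (a \<otimes> t))"
    by (simp add: nat_pow_distrib m_ac)
  also have "\<dots> = (u \<otimes> s) [^] Suc k \<otimes> (b \<otimes> t [^] k)"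
    unfolding u by (simp add: nat_pow_distrib m_ac)
  also have "f \<dots> = (u \<otimes> s) \<otimes> f (b \<otimes> t [^] k)" by (rule fl[symmetric]) auto
  also have "\<dots> = u \<otimes> (f (b \<otimes> t [^] k) \<otimes> s)" by (simp add: m_ac)
  finally have "\<exists>u\<in>M. u \<otimes> (f (a \<otimes> s [^] k) \<otimes> t) = u \<otimes> (f (b \<otimes> t [^] k) \<otimes> s)"
    by (intro bexI[of _ u]) simp_all
  then show ?thesis by (subst frac_eq_iff) simp_all
qed

lemma loc_map_frac:
  assumes f: "frob_linear R q f" and q: "1 \<le> q" and a: "a \<in> carrier R" "s \<in> M"
  shows "loc_map R M q f (fr a s) = fr (f (a \<otimes> s [^] (q - 1))) s"
proof -
  obtain k where k: "q = Suc k" using q by (cases q) auto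
  show ?thesis unfolding loc_map_def k diff_Suc_1
  proof (rule frac_union[OF a])
    fix b t assume "b \<in> carrier R" "t \<in> M" "fr b t = fr a s"
    then show "fr (f (b \<otimes> t [^] k)) t = fr (f (a \<otimes> s [^] k)) s"
      using f a unfolding k by (intro loc_map_well_defined)
  qed
qed

lemma loc_map_closed:
  assumes f: "frob_linear R q f" and q: "1 \<le> q" and "x \<in> carrier L"
  shows "loc_map R M q f x \<in> carrier L"
proof -
  obtain a s where a: "x = fr a s" "a \<in> carrier R" "s \<in> M"
    using assms(3) by (rule frac_cases)
  then have "f (a \<otimes> s [^] (q - 1)) \<in> carrier R" using f by (auto simp: frob_linear_def)
  then show ?thesis using a loc_map_frac[OF f q] by auto
qed

lemma loc_map_add:
  assumes f: "frob_linear R q f" and q: "1 \<le> q" and x: "x \<in> carrier L" "y \<in> carrier L"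
  shows "loc_map R M q f (x \<oplus>\<^bsub>L\<^esub> y) = loc_map R M q f x \<oplus>\<^bsub>L\<^esub> loc_map R M q f y"
proof -
  obtain k where k: "q = Suc k" using q by (cases q) auto
  have fc [simp]: "f x \<in> carrier R" if "x \<in> carrier R" for x
    using f that by (auto simp: frob_linear_def)
  have fl: "f (c [^] Suc k \<otimes> x) = f x \<otimes> c" if "x \<in> carrier R" "c \<in> carrier R" for x c
    using f that k m_comm[of c "f x"] fc[of x] by (auto simp: frob_linear_def)
  have fa: "f (x \<oplus> y) = f x \<oplus> f y" if "x \<in> carrier R" "y \<in> carrier R" for x y
    using f that by (auto simp: frob_linear_def)
  obtain a s where [simp]: "a \<in> carrier R" "s \<in> M" and xs: "x = fr a s"
    using x(1) by (rule frac_cases)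
  obtain b t where [simp]: "b \<in> carrier R" "t \<in> M" and yt: "y = fr b t"
    using x(2) by (rule frac_cases)
  have 1: "(a \<otimes> t \<oplus> b \<otimes> s) \<otimes> (s \<otimes> t) [^] k
      = t [^] Suc k \<otimes> (a \<otimes> s [^] k) \<oplus> s [^] Suc k \<otimes> (b \<otimes> t [^] k)"
    by (simp add: nat_pow_distrib m_ac l_distr r_distr)
  have "f ((a \<otimes> t \<oplus> b \<otimes> s) \<otimes> (s \<otimes> t) [^] k)
      = f (a \<otimes> s [^] k) \<otimes> t \<oplus> f (b \<otimes> t [^] k) \<otimes> s"
    unfolding 1 using fl[of "a \<otimes> s [^] k" t] fl[of "b \<otimes> t [^] k" s] by (subst fa) simp_all
  then show ?thesis
    unfolding xs yt by (simp add: k add_frac loc_map_frac[OF f q, unfolded k])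
qed

lemma loc_map_fractions_of:
  assumes f: "frob_linear R q f" and q: "1 \<le> q" and I: "ideal I R" "f ` I \<subseteq> I"
  shows "loc_map R M q f ` fractions_of I \<subseteq> fractions_of I"
proof clarify
  interpret ideal I R by fact
  fix x assume "x \<in> fractions_of I"
  then obtain a s where a: "a \<in> I" "s \<in> M" "x = fr a s"
    by (rule fractions_ofE)
  have "f (a \<otimes> s [^] (q - 1)) \<in> I" using I a I_r_closed by auto
  then show "loc_map R M q f x \<in> fractions_of I"
    using a loc_map_frac[OF f q, of a s] Icarr by (simp add: fractions_ofI)
qed

end

lemma quot_map_coset:
  assumes J: "ideal J B" and J': "ideal J' B'"
    and g: "\<And>x. x \<in> carrier B \<Longrightarrow> g x \<in> carrier B'"
    and add: "\<And>x y. x \<in> carrier B \<Longrightarrow> y \<in> carrier B \<Longrightarrow> g (x \<oplus>\<^bsub>B\<^esub> y) = g x \<oplus>\<^bsub>B'\<^esub> g y"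
    and "g ` J \<subseteq> J'" and y: "y \<in> carrier B"
  shows "quot_map B' J' g (J +>\<^bsub>B\<^esub> y) = J' +>\<^bsub>B'\<^esub> g y"
proof -
  interpret J: ideal J B by fact
  interpret J': ideal J' B' by fact
  have "J' +>\<^bsub>B'\<^esub> g x = J' +>\<^bsub>B'\<^esub> g y" if x: "x \<in> J +>\<^bsub>B\<^esub> y" for x
  proof -
    obtain j where j: "j \<in> J" "x = j \<oplus>\<^bsub>B\<^esub> y" using x by (auto simp: a_r_coset_def')
    then have "g x = g j \<oplus>\<^bsub>B'\<^esub> g y" using add y J.Icarr by simp
    moreover have "g j \<in> J'" using assms j by blast
    ultimately have "g x \<in> J' +>\<^bsub>B'\<^esub> g y" by (auto simp: a_r_coset_def')
    then show ?thesis using g[OF y] J'.a_repr_independence[OF _ _ J'.a_subgroup] by auto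
  qed
  moreover have "y \<in> J +>\<^bsub>B\<^esub> y" using J.a_rcos_self y by simp
  ultimately show ?thesis unfolding quot_map_def by blast
qed

lemma (in primeideal) ring_localization_compl: "ring_localization R (carrier R - I)"
proof
  show "\<one> \<in> carrier R - I" using I_notcarr one_imp_carrier by auto
  show "s \<otimes> t \<in> carrier R - I" if "s \<in> carrier R - I" "t \<in> carrier R - I" for s t
    using that I_prime by blast
qed auto

lemma residue_map_coset:
  assumes "cring R" and f: "frob_linear R q f" and q: "1 \<le> q" and P: "P \<in> CSpec R f"
    and x: "x \<in> carrier (localization R (carrier R - P))"
  defines "Lo \<equiv> localization R (carrier R - P)" and "E \<equiv> extend_loc R (carrier R - P) P"
  shows "residue_map R q f P (E +>\<^bsub>Lo\<^esub> x) = E +>\<^bsub>Lo\<^esub> loc_map R (carrier R - P) q f x"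
proof -
  interpret P: primeideal P R using P by (simp add: CSpec_def spec_def)
  interpret ring_localization R "carrier R - P" by (rule P.ring_localization_compl)
  have E: "E = fractions_of P" unfolding E_def by (rule extend_loc_ideal[OF P.is_ideal])
  have I: "ideal E L" unfolding E by (rule ideal_fractions_of[OF P.is_ideal])
  show ?thesis
    unfolding residue_map_def Let_def E_def[symmetric] Lo_def
  proof (rule quot_map_coset[OF I I])
    show "loc_map R (carrier R - P) q f ` E \<subseteq> E"
      unfolding E by (rule loc_map_fractions_of[OF f q P.is_ideal]) (use P in \<open>auto simp: CSpec_def\<close>)
  qed (use x f q loc_map_closed loc_map_add in \<open>auto\<close>)
qed

text \<open>If \<open>f\<close> takes the value \<open>1\<close>, so does the map it induces on every residue field.\<close>

lemma Schpec_eq_CSpec: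
  assumes "cring R" and f: "frob_linear R q f" and q: "1 \<le> q"
    and c: "c \<in> carrier R" "f c = \<one>\<^bsub>R\<^esub>"
  shows "Schpec R q f = CSpec R f"
proof -
  have "\<not> zero_on (residue_field R P) (residue_map R q f P)" if P: "P \<in> CSpec R f" for P
  proof
    assume z: "zero_on (residue_field R P) (residue_map R q f P)"
    interpret P: primeideal P R using P by (simp add: CSpec_def spec_def)
    interpret ring_localization R "carrier R - P" by (rule P.ring_localization_compl)
    let ?E = "extend_loc R (carrier R - P) P"
    have E: "?E = fractions_of P" by (rule extend_loc_ideal[OF P.is_ideal])
    interpret E: ideal ?E L unfolding E by (rule ideal_fractions_of[OF P.is_ideal])
    have "?E +>\<^bsub>L\<^esub> fr c \<one>\<^bsub>R\<^esub> \<in> carrier (residue_field R P)"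
      using c frac_closed[of c "\<one>\<^bsub>R\<^esub>"] one_in_M
      by (auto simp: residue_field_def FactRing_def A_RCOSETS_def')
    then have "residue_map R q f P (?E +>\<^bsub>L\<^esub> fr c \<one>\<^bsub>R\<^esub>) = ?E"
      using z by (auto simp: zero_on_def residue_field_def FactRing_def)
    then have "?E +>\<^bsub>L\<^esub> fr \<one>\<^bsub>R\<^esub> \<one>\<^bsub>R\<^esub> = ?E"
      using residue_map_coset[OF assms(1) f q P, of "fr c \<one>\<^bsub>R\<^esub>"] loc_map_frac[OF f q, of c "\<one>\<^bsub>R\<^esub>"] c
        one_in_M by auto
    then have "fr \<one>\<^bsub>R\<^esub> \<one>\<^bsub>R\<^esub> \<in> fractions_of P"
      using E.rcos_const_imp_mem[of "fr \<one>\<^bsub>R\<^esub> \<one>\<^bsub>R\<^esub>"] one_in_M E by (metis L.one_closed one_frac)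
    then obtain u where "u \<in> carrier R - P" "u \<otimes>\<^bsub>R\<^esub> \<one>\<^bsub>R\<^esub> \<in> P"
      using frac_in_fractions_of_iff[OF P.is_ideal, of "\<one>\<^bsub>R\<^esub>" "\<one>\<^bsub>R\<^esub>"] one_in_M by blast
    then show False by simp
  qed
  then show ?thesis by (auto simp: Schpec_def)
qed

section \<open>Divisors on a normal noetherian domain\<close>

locale normal_noetherian_domain = field K for K (structure) +
  fixes A :: "'a set"
  assumes frac_field: "is_fraction_field K A"
    and normal: "integrally_closed K A"
    and noeth: "noetherian_ring (sub K A)"
begin

lemma subring_A: "subring A K" using frac_field by (simp add: is_fraction_field_def)

lemma A_closed [simp, intro]:
  "x \<in> A \<Longrightarrow> x \<in> carrier K" "\<zero> \<in> A" "\<one> \<in> A" "x \<in> A \<Longrightarrow> \<ominus> x \<in> A"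
  "x \<in> A \<Longrightarrow> y \<in> A \<Longrightarrow> x \<otimes> y \<in> A" "x \<in> A \<Longrightarrow> y \<in> A \<Longrightarrow> x \<oplus> y \<in> A"
  using subringE[OF subring_A] by auto

lemma A_pow_closed [simp, intro]: "x \<in> A \<Longrightarrow> x [^] (n::nat) \<in> A"
  by (induction n) auto

sublocale A: domain "sub K A"
  rewrites "carrier (sub K A) = A" and "monoid.mult (sub K A) = monoid.mult K"
    and "monoid.one (sub K A) = \<one>" and "ring.add (sub K A) = ring.add K"
    and "ring.zero (sub K A) = \<zero>"
  using subring_is_domain[OF subring_A] by auto

lemma inv_closed [simp, intro]: "x \<in> carrier K \<Longrightarrow> x \<noteq> \<zero> \<Longrightarrow> inv x \<in> carrier K"
  and inv_nonzero [simp]: "x \<in> carrier K \<Longrightarrow> x \<noteq> \<zero> \<Longrightarrow> inv x \<noteq> \<zero>"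
  and inv_r [simp]: "x \<in> carrier K \<Longrightarrow> x \<noteq> \<zero> \<Longrightarrow> x \<otimes> inv x = \<one>"
  and inv_l [simp]: "x \<in> carrier K \<Longrightarrow> x \<noteq> \<zero> \<Longrightarrow> inv x \<otimes> x = \<one>"
  using field_Units by auto

lemma fraction:
  assumes "x \<in> carrier K"
  obtains a b where "a \<in> A" "b \<in> A" "b \<noteq> \<zero>" "x = a \<otimes> inv b"
  using assms frac_field unfolding is_fraction_field_def by blast

lemma primeD:
  assumes "primeideal P (sub K A)"
  shows "P \<subseteq> A" "\<zero> \<in> P" "\<one> \<notin> P"
    "\<And>x y. x \<in> A \<Longrightarrow> y \<in> A \<Longrightarrow> x \<otimes> y \<in> P \<Longrightarrow> x \<in> P \<or> y \<in> P"
    "\<And>x y. x \<in> P \<Longrightarrow> y \<in> A \<Longrightarrow> x \<otimes> y \<in> P" "\<And>x y. x \<in> A \<Longrightarrow> y \<in> P \<Longrightarrow> x \<otimes> y \<in> P"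
    "\<And>x y. x \<in> P \<Longrightarrow> y \<in> P \<Longrightarrow> x \<oplus> y \<in> P" "P \<noteq> A"
proof -
  interpret P: primeideal P "sub K A" by fact
  show "P \<subseteq> A" using P.Icarr by auto
  show "\<zero> \<in> P" using P.zero_closed by simp
  show "\<one> \<notin> P" using P.one_imp_carrier P.I_notcarr by auto
  then show "P \<noteq> A" by auto
  show "x \<in> P \<or> y \<in> P" if "x \<in> A" "y \<in> A" "x \<otimes> y \<in> P" for x y using P.I_prime[of x y] that by simp
  show "x \<otimes> y \<in> P" if "x \<in> P" "y \<in> A" for x y using P.I_r_closed[of x y] that by simp
  show "x \<otimes> y \<in> P" if "x \<in> A" "y \<in> P" for x y using P.I_l_closed[of y x] that by simp
  show "x \<oplus> y \<in> P" if "x \<in> P" "y \<in> P" for x y using P.a_closed[of x y] that by simp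
qed

lemma prime_pow_notin:
  assumes "primeideal P (sub K A)" "x \<in> A" "x \<notin> P" shows "x [^] (n::nat) \<notin> P"
  using assms primeD(3,4)[OF assms(1)] by (induction n) auto

subsection \<open>Complete integral closedness\<close>

text \<open>The \<open>A\<close>-module \<open>c (A + A x + \<dots> + A x\<^sup>n\<^sup>-\<^sup>1)\<close>, built so that its elements are visibly values at \<open>x\<close> of
  coefficient lists.\<close>

fun power_span :: "'a \<Rightarrow> 'a \<Rightarrow> nat \<Rightarrow> 'a set" where
  "power_span c x 0 = {\<zero>}"
| "power_span c x (Suc n) = {a \<otimes> (c \<otimes> x [^] n) \<oplus> y | a y. a \<in> A \<and> y \<in> power_span c x n}"

lemma power_span_eval:
  assumes "y \<in> power_span c x n" and c: "c \<in> carrier K" "x \<in> carrier K"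
  shows "\<exists>l. set l \<subseteq> A \<and> length l = n \<and> y = c \<otimes> eval l x"
  using assms(1)
proof (induction n arbitrary: y)
  case 0
  then show ?case using c by auto
next
  case (Suc n)
  then obtain a z where a: "a \<in> A" "z \<in> power_span c x n" "y = a \<otimes> (c \<otimes> x [^] n) \<oplus> z" by auto
  then obtain l where l: "set l \<subseteq> A" "length l = n" "z = c \<otimes> eval l x" using Suc.IH by blast
  have [simp]: "eval l x \<in> carrier K" using l(1) c by (intro eval_in_carrier) auto
  have "y = c \<otimes> eval (a # l) x" using a l c by (simp add: r_distr m_ac)
  then show ?case using a l by (intro exI[of _ "a # l"]) auto
qed

lemma ideal_power_span:
  assumes c: "x \<in> carrier K" and cx: "\<And>n. c \<otimes> x [^] (n::nat) \<in> A"
  shows "ideal (power_span c x n) (sub K A)"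
proof (induction n)
  case 0
  show ?case using A.zeroideal by simp
next
  case (Suc n)
  let ?J = "power_span c x n"
  interpret J: ideal ?J "sub K A" by fact
  have JA: "y \<in> A" if "y \<in> ?J" for y using J.Icarr[OF that] by simp
  have "ideal (power_span c x (Suc n)) (sub K A)"
  proof (rule A.idealI_closed; simp)
    show "{a \<otimes> (c \<otimes> x [^] n) \<oplus> y | a y. a \<in> A \<and> y \<in> ?J} \<subseteq> A" using cx JA by auto
    have "\<zero> = \<zero> \<otimes> (c \<otimes> x [^] n) \<oplus> \<zero>" using cx[of n] by simp
    moreover have "\<zero> \<in> ?J" using J.zero_closed by simp
    ultimately show "\<exists>a y. \<zero> = a \<otimes> (c \<otimes> x [^] n) \<oplus> y \<and> a \<in> A \<and> y \<in> ?J"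
      using A_closed(2) by blast
  next
    fix u v
    assume "\<exists>a y. u = a \<otimes> (c \<otimes> x [^] n) \<oplus> y \<and> a \<in> A \<and> y \<in> ?J"
      and "\<exists>a y. v = a \<otimes> (c \<otimes> x [^] n) \<oplus> y \<and> a \<in> A \<and> y \<in> ?J"
    then obtain a y b z where *: "u = a \<otimes> (c \<otimes> x [^] n) \<oplus> y" "a \<in> A" "y \<in> ?J"
      "v = b \<otimes> (c \<otimes> x [^] n) \<oplus> z" "b \<in> A" "z \<in> ?J" by blast
    have "u \<oplus> v = (a \<oplus> b) \<otimes> (c \<otimes> x [^] n) \<oplus> (y \<oplus> z)"
      using * JA[of y] JA[of z] cx[of n] by (simp add: l_distr a_ac)
    moreover have "y \<oplus> z \<in> ?J" using * J.a_closed[of y z] by simp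
    ultimately show "\<exists>a y. u \<oplus> v = a \<otimes> (c \<otimes> x [^] n) \<oplus> y \<and> a \<in> A \<and> y \<in> ?J"
      using * by blast
  next
    fix u b assume "\<exists>a y. u = a \<otimes> (c \<otimes> x [^] n) \<oplus> y \<and> a \<in> A \<and> y \<in> ?J" and b: "b \<in> A"
    then obtain a y where *: "u = a \<otimes> (c \<otimes> x [^] n) \<oplus> y" "a \<in> A" "y \<in> ?J" by blast
    have "b \<otimes> u = (b \<otimes> a) \<otimes> (c \<otimes> x [^] n) \<oplus> b \<otimes> y"
      using * JA[of y] b cx[of n] by (simp add: r_distr m_assoc)
    moreover have "b \<otimes> y \<in> ?J" using * b J.I_l_closed[of y b] by simp
    ultimately show "\<exists>a y. b \<otimes> u = a \<otimes> (c \<otimes> x [^] n) \<oplus> y \<and> a \<in> A \<and> y \<in> ?J"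
      using * b by blast
  qed
  then show ?case .
qed

text \<open>The ideals \<open>c (A + \<dots> + A x\<^sup>n)\<close> become stationary, and once \<open>c x\<^sup>n\<close> lies in the preceding one,
  cancelling \<open>c\<close> leaves a monic equation for \<open>x\<close>.\<close>

lemma completely_integrally_closed:
  assumes x: "x \<in> carrier K" and c: "c \<in> A" "c \<noteq> \<zero>" and cx: "\<And>n::nat. c \<otimes> x [^] n \<in> A"
  shows "x \<in> A"
proof -
  have "\<exists>I\<in>range (power_span c x). \<forall>J\<in>range (power_span c x). I \<subseteq> J \<longrightarrow> J = I"
    using ideal_power_span[OF x cx] by (intro noetherian_ring.exists_maximal_ideal_in[OF noeth]) auto
  then obtain N where N: "\<And>n. power_span c x N \<subseteq> power_span c x n \<Longrightarrow> power_span c x n = power_span c x N"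
    by auto
  have sub: "power_span c x N \<subseteq> A" using ideal.Icarr[OF ideal_power_span[OF x cx]] by auto
  have "power_span c x (Suc N) = power_span c x N"
  proof (rule N, rule subsetI)
    fix y assume y: "y \<in> power_span c x N"
    then have "y = \<zero> \<otimes> (c \<otimes> x [^] N) \<oplus> y" using sub cx[of N] by auto
    then show "y \<in> power_span c x (Suc N)" using y by auto
  qed
  moreover have "c \<otimes> x [^] N \<in> power_span c x (Suc N)"
  proof -
    have "\<zero> \<in> power_span c x N"
      using additive_subgroup.zero_closed[OF ideal.axioms(1)[OF ideal_power_span[OF x cx]]] by simp
    moreover have "c \<otimes> x [^] N = \<one> \<otimes> (c \<otimes> x [^] N) \<oplus> \<zero>" using cx[of N] by simp
    ultimately show ?thesis unfolding power_span.simps using A_closed(3) by blast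
  qed
  ultimately obtain l where l: "set l \<subseteq> A" "length l = N" "c \<otimes> x [^] N = c \<otimes> eval l x"
    using power_span_eval[of "c \<otimes> x [^] N" c x N] x c by auto
  have lc: "set l \<subseteq> carrier K" using l(1) by auto
  then have [simp]: "eval l x \<in> carrier K" using x by (intro eval_in_carrier) auto
  have e: "x [^] N = eval l x" using l(3) c x m_lcancel by auto
  have neg: "eval (map (\<lambda>a. \<ominus> a) l) x = \<ominus> eval l x" using lc
  proof (induction l)
    case (Cons a l)
    then have "eval l x \<in> carrier K" using x by (intro eval_in_carrier) auto
    then show ?case using Cons x by (simp add: l_minus minus_add)
  qed simp
  let ?f = "\<one> # map (\<lambda>a. \<ominus> a) l"
  have "polynomial\<^bsub>K\<^esub> A ?f" using l(1) by (intro polynomialI) auto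
  moreover have "eval ?f x = \<zero>" using x by (simp add: neg l(2) e r_neg)
  ultimately show ?thesis using normal x unfolding integrally_closed_def by (metis list.distinct(1) list.sel(1))
qed

subsection \<open>Denominator ideals and uniformizers\<close>

text \<open>For \<open>f = b / a\<close> this is the colon ideal \<open>(a) : b\<close>.\<close>

definition den :: "'a \<Rightarrow> 'a set" where "den f = {x \<in> A. x \<otimes> f \<in> A}"

lemma ideal_den: assumes "f \<in> carrier K" shows "ideal (den f) (sub K A)"
  by (rule A.idealI_closed) (use assms in \<open>auto simp: den_def l_distr m_assoc\<close>)

lemma den_nonzero: assumes "f \<in> carrier K" shows "\<exists>b\<in>den f. b \<noteq> \<zero>"
proof -
  obtain a b where ab: "a \<in> A" "b \<in> A" "b \<noteq> \<zero>" "f = a \<otimes> inv b" using assms by (rule fraction)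
  then have "b \<otimes> f = a" using m_lcomm[of b a "inv b"] by simp
  then show ?thesis using ab by (auto simp: den_def)
qed

text \<open>A maximal element among the denominator ideals of the multiples \<open>c f\<close> that avoid \<open>M\<close> is prime.
  With \<open>M = {1}\<close> this produces the primes along which \<open>f\<close> has a pole, with \<open>M\<close> the complement
  of a height-one prime it recovers that prime as a denominator ideal.\<close>

lemma exists_prime_den:
  assumes f: "f \<in> carrier K" and M: "M \<subseteq> A" "\<one> \<in> M" "\<And>x y. x \<in> M \<Longrightarrow> y \<in> M \<Longrightarrow> x \<otimes> y \<in> M"
    and avoid: "den f \<inter> M = {}"
  shows "\<exists>g\<in>carrier K. primeideal (den g) (sub K A) \<and> den f \<subseteq> den g \<and> den g \<inter> M = {}"
proof -
  let ?F = "{den (c \<otimes> f) | c. c \<in> A \<and> den (c \<otimes> f) \<inter> M = {}}"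
  have "\<exists>I\<in>?F. \<forall>J\<in>?F. I \<subseteq> J \<longrightarrow> J = I"
  proof (rule noetherian_ring.exists_maximal_ideal_in[OF noeth])
    have "den (\<one> \<otimes> f) \<in> ?F" using avoid f by (intro CollectI exI[of _ \<one>]) simp
    then show "?F \<noteq> {}" by blast
    show "ideal I (sub K A)" if "I \<in> ?F" for I using that f ideal_den by auto
  qed
  then obtain I where I: "I \<in> ?F" "\<forall>J\<in>?F. I \<subseteq> J \<longrightarrow> J = I" by (rule bexE)
  from I(1) obtain c where c: "c \<in> A" "den (c \<otimes> f) \<inter> M = {}" and Ic: "I = den (c \<otimes> f)" by fast
  have max: "den (d \<otimes> f) = den (c \<otimes> f)"
    if "d \<in> A" "den (d \<otimes> f) \<inter> M = {}" "den (c \<otimes> f) \<subseteq> den (d \<otimes> f)" for d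
  proof -
    have "den (d \<otimes> f) \<in> ?F" using that(1,2) by fast
    from bspec[OF I(2) this] show ?thesis using that(3) unfolding Ic by simp
  qed
  let ?g = "c \<otimes> f"
  have g: "?g \<in> carrier K" using c f by simp
  have mono: "den ?g \<subseteq> den ((u \<otimes> c) \<otimes> f)" if "u \<in> A" for u
  proof
    fix x assume x: "x \<in> den ?g"
    then have "u \<otimes> (x \<otimes> (c \<otimes> f)) \<in> A" using that by (auto simp: den_def)
    then show "x \<in> den ((u \<otimes> c) \<otimes> f)" using x that c f by (auto simp: den_def m_ac)
  qed
  have mult: "x \<in> den ((u \<otimes> c) \<otimes> f) \<longleftrightarrow> x \<otimes> u \<in> den ?g" if "x \<in> A" "u \<in> A" for x u
    using that c f by (simp add: den_def m_assoc)
  have "primeideal (den ?g) (sub K A)"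
  proof (rule primeidealI)
    show "ideal (den ?g) (sub K A)" by (rule ideal_den[OF g])
    show "cring (sub K A)" by (rule A.is_cring)
    show "carrier (sub K A) \<noteq> den ?g" using c(2) M by auto
    fix u v assume "u \<in> carrier (sub K A)" "v \<in> carrier (sub K A)" "u \<otimes>\<^bsub>sub K A\<^esub> v \<in> den ?g"
    then have uv: "u \<in> A" "v \<in> A" "u \<otimes> v \<in> den ?g" by simp_all
    show "u \<in> den ?g \<or> v \<in> den ?g"
    proof (rule ccontr)
      assume not: "\<not> (u \<in> den ?g \<or> v \<in> den ?g)"
      have v: "v \<in> den ((u \<otimes> c) \<otimes> f)" using uv mult[of v u] by (simp add: m_comm)
      have "den ((u \<otimes> c) \<otimes> f) \<inter> M \<noteq> {}" using max[of "u \<otimes> c"] mono[of u] uv c v not by auto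
      then obtain s where s: "s \<in> M" "s \<in> den ((u \<otimes> c) \<otimes> f)" by blast
      then have sA: "s \<in> A" using M by blast
      have "u \<in> den ((s \<otimes> c) \<otimes> f)" using s sA uv mult[of s u] mult[of u s] by (simp add: m_comm)
      moreover have "den ((s \<otimes> c) \<otimes> f) \<inter> M = {}"
      proof (rule ccontr)
        assume "den ((s \<otimes> c) \<otimes> f) \<inter> M \<noteq> {}"
        then obtain r where r: "r \<in> M" "r \<in> den ((s \<otimes> c) \<otimes> f)" by blast
        then have "r \<otimes> s \<in> den ?g" using mult[of r s] sA M by blast
        then show False using c(2) M(3)[OF r(1) s(1)] by blast
      qed
      ultimately show False using max[of "s \<otimes> c"] mono[of s] sA c not by auto
    qed
  qed
  moreover have "den f \<subseteq> den ?g"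
  proof
    fix x assume x: "x \<in> den f"
    then have "c \<otimes> (x \<otimes> f) \<in> A" using c by (auto simp: den_def)
    then show "x \<in> den ?g" using x c f by (auto simp: den_def m_ac)
  qed
  ultimately show ?thesis using c g by blast
qed

text \<open>As \<open>s\<close> is a unit at \<open>P\<close>, the inclusion \<open>s P \<subseteq> t A\<close> in the last conjunct says that \<open>t\<close> generates the
  maximal ideal of the localization at \<open>P\<close>.\<close>

definition uniformizer :: "'a set \<Rightarrow> 'a \<Rightarrow> 'a \<Rightarrow> bool" where
  "uniformizer P t s \<longleftrightarrow> t \<in> P \<and> t \<noteq> \<zero> \<and> s \<in> A \<and> s \<notin> P \<and> (\<forall>y\<in>P. y \<otimes> (s \<otimes> inv t) \<in> A)"

text \<open>If \<open>g\<close> mapped the ideal \<open>P = den g\<close> into itself, it would lie in \<open>A\<close> by complete integral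
  closedness. So \<open>s = g t\<close> is outside \<open>P\<close> for some \<open>t \<in> P\<close>, and \<open>y s = (y g) t\<close> for \<open>y \<in> P\<close>.\<close>

lemma exists_uniformizer_den:
  assumes g: "g \<in> carrier K" and P: "primeideal (den g) (sub K A)"
  shows "\<exists>t s. uniformizer (den g) t s"
proof -
  obtain b where b: "b \<in> den g" "b \<noteq> \<zero>" using den_nonzero[OF g] by blast
  have "\<exists>t\<in>den g. t \<otimes> g \<notin> den g"
  proof (rule ccontr)
    assume "\<not> (\<exists>t\<in>den g. t \<otimes> g \<notin> den g)"
    then have step: "t \<otimes> g \<in> den g" if "t \<in> den g" for t using that by blast
    have "b \<otimes> g [^] (n::nat) \<in> den g" for n
    proof (induction n)
      case (Suc n)
      have "b \<in> carrier K" using b by (auto simp: den_def)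
      then show ?case using step[OF Suc] g by (simp add: m_assoc)
    qed (use b in \<open>auto simp: den_def\<close>)
    then have "g \<in> A" using completely_integrally_closed[OF g _ b(2)] b(1) by (auto simp: den_def)
    then have "\<one> \<in> den g" by (simp add: den_def)
    then show False using primeD(3)[OF P] by blast
  qed
  then obtain t where t: "t \<in> den g" "t \<otimes> g \<notin> den g" by blast
  have tA: "t \<in> A" "t \<otimes> g \<in> A" using t by (auto simp: den_def)
  have t0: "t \<noteq> \<zero>" using t g by (auto simp: den_def)
  have "y \<otimes> (t \<otimes> g \<otimes> inv t) \<in> A" if "y \<in> den g" for y
  proof -
    have "t \<otimes> g \<otimes> inv t = g" using tA t0 g by (simp add: m_ac)
    then show ?thesis using that by (auto simp: den_def)
  qed
  then show ?thesis unfolding uniformizer_def using t tA t0 by blast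
qed

text \<open>A prime \<open>Q\<close> strictly below \<open>P\<close> misses \<open>t\<close>, so it is stable under multiplication by \<open>s / t\<close>. A nonzero
  \<open>y\<close> in \<open>Q\<close> would then force \<open>s / t \<in> A\<close>, that is, \<open>s \<in> P\<close>.\<close>

lemma uniformizer_imp_height_one:
  assumes P: "primeideal P (sub K A)" and ts: "uniformizer P t s"
  shows "P \<in> height_one K A"
proof -
  note PD = primeD[OF P]
  have ts': "t \<in> P" "t \<in> A" "t \<noteq> \<zero>" "s \<in> A" "s \<notin> P" using ts PD by (auto simp: uniformizer_def)
  let ?x = "s \<otimes> inv t"
  have x: "?x \<in> carrier K" using ts' by simp
  have xt: "?x \<otimes> t = s" using ts' by (simp add: m_assoc)
  have "Q = {\<zero>}" if Q: "primeideal Q (sub K A)" "Q \<subset> P" for Q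
  proof (rule ccontr)
    note QD = primeD[OF Q(1)]
    assume "Q \<noteq> {\<zero>}"
    then obtain y where y: "y \<in> Q" "y \<noteq> \<zero>" using QD by blast
    have step: "z \<otimes> ?x \<in> A \<and> (z \<otimes> ?x) \<otimes> t = z \<otimes> s" if "z \<in> P" for z
    proof -
      have "z \<in> carrier K" using that PD by auto
      then show ?thesis using ts that xt x ts' by (auto simp: uniformizer_def m_assoc)
    qed
    have tQ: "t \<notin> Q"
    proof
      assume "t \<in> Q"
      have "P \<subseteq> Q"
      proof
        fix z assume z: "z \<in> P"
        have "z \<otimes> s \<in> Q" using step[OF z] QD(6)[OF _ \<open>t \<in> Q\<close>] by metis
        then show "z \<in> Q" using QD(4)[of z s] z PD ts' Q by blast
      qed
      then show False using Q by blast
    qed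
    have stepQ: "z \<otimes> ?x \<in> Q" if z: "z \<in> Q" for z
    proof -
      have "z \<in> P" using z Q by blast
      then have "(z \<otimes> ?x) \<otimes> t \<in> Q" using step QD(5)[OF z ts'(4)] by metis
      then show ?thesis using QD(4)[of "z \<otimes> ?x" t] step[OF \<open>z \<in> P\<close>] tQ ts' by blast
    qed
    have "y \<otimes> ?x [^] (n::nat) \<in> Q" for n
    proof (induction n)
      case (Suc n)
      have "y \<in> carrier K" using y QD by auto
      then show ?case using stepQ[OF Suc] x by (simp add: m_assoc)
    qed (use y QD in auto)
    then have "?x \<in> A" using completely_integrally_closed[OF x _ y(2)] y QD by blast
    then have "s \<in> P" using xt PD(6)[of ?x t] ts' by auto
    then show False using ts' by blast
  qed
  then show ?thesis using P ts' unfolding height_one_def spec_def by blast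
qed

lemma height_one_prime: "P \<in> height_one K A \<Longrightarrow> primeideal P (sub K A)"
  by (simp add: height_one_def spec_def)

text \<open>A nonzero \<open>a \<in> P\<close> gives the denominator ideal \<open>a A\<close> of \<open>1 / a\<close>; a prime denominator ideal between
  \<open>a A\<close> and \<open>P\<close> equals \<open>P\<close> by minimality.\<close>

lemma height_one_uniformizer:
  assumes P: "P \<in> height_one K A"
  obtains t s where "uniformizer P t s"
proof -
  note PD = primeD[OF height_one_prime[OF P]]
  obtain a where a: "a \<in> P" "a \<noteq> \<zero>" using P PD by (auto simp: height_one_def)
  have aA: "a \<in> A" using a PD by blast
  have aden: "a \<in> den (inv a)" using aA a by (simp add: den_def)
  have "den (inv a) \<inter> (A - P) = {}"
  proof -
    have "x \<in> P" if x: "x \<in> den (inv a)" for x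
    proof -
      have "x = (x \<otimes> inv a) \<otimes> a" using x aA a by (simp add: den_def m_assoc)
      moreover have "(x \<otimes> inv a) \<otimes> a \<in> P" using x a PD(6) by (auto simp: den_def)
      ultimately show ?thesis by simp
    qed
    then show ?thesis by blast
  qed
  then have "\<exists>g\<in>carrier K. primeideal (den g) (sub K A) \<and> den (inv a) \<subseteq> den g \<and> den g \<inter> (A - P) = {}"
    using aA a PD by (intro exists_prime_den) auto
  then obtain g where g: "g \<in> carrier K" "primeideal (den g) (sub K A)" "den (inv a) \<subseteq> den g"
    "den g \<inter> (A - P) = {}" by blast
  have "den g \<subseteq> P" using g(4) by (auto simp: den_def)
  moreover have "den g \<noteq> {\<zero>}" using g(3) aden a by blast
  ultimately have "den g = P" using P g(2) unfolding height_one_def spec_def by blast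
  then show ?thesis using exists_uniformizer_den[OF g(1,2)] that by blast
qed

text \<open>A prime denominator ideal above \<open>den f\<close> has height one, and \<open>f\<close> is not in the localization there.\<close>

lemma mem_A_if_locally:
  assumes f: "f \<in> carrier K" and loc: "\<And>P. P \<in> height_one K A \<Longrightarrow> f \<in> loc_in K A P"
  shows "f \<in> A"
proof (rule ccontr)
  assume "f \<notin> A"
  then have "den f \<inter> {\<one>} = {}" using f by (auto simp: den_def)
  then have "\<exists>g\<in>carrier K. primeideal (den g) (sub K A) \<and> den f \<subseteq> den g \<and> den g \<inter> {\<one>} = {}"
    using f by (intro exists_prime_den) auto
  then obtain g where g: "g \<in> carrier K" "primeideal (den g) (sub K A)" "den f \<subseteq> den g" by blast
  then have "den g \<in> height_one K A"
    using exists_uniformizer_den uniformizer_imp_height_one by blast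
  then obtain a s where a: "f = a \<otimes> inv s" "a \<in> A" "s \<in> A" "s \<notin> den g"
    using loc unfolding loc_in_def by blast
  then have "s \<noteq> \<zero>" using primeD(2)[OF g(2)] by blast
  then have "s \<otimes> f = a" using a by (simp add: m_lcomm)
  then show False using a g(3) by (auto simp: den_def)
qed

text \<open>Noetherian induction: an ideal \<open>I\<close> maximal among the nonzero ideals below infinitely many height-one
  primes is not prime, and a product \<open>x y \<in> I\<close> distributes these primes over \<open>I + (x)\<close> and \<open>I + (y)\<close>.\<close>

lemma finite_height_one_over:
  assumes "a \<in> A" "a \<noteq> \<zero>"
  shows "finite {P \<in> height_one K A. a \<in> P}"
proof (rule ccontr)
  let ?V = "\<lambda>I. {P \<in> height_one K A. I \<subseteq> P}"
  let ?F = "{I. ideal I (sub K A) \<and> I \<noteq> {\<zero>} \<and> infinite (?V I)}"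
  interpret N: noetherian_ring "sub K A" by (rule noeth)
  assume inf: "infinite {P \<in> height_one K A. a \<in> P}"
  have gen: "Idl\<^bsub>sub K A\<^esub> B \<subseteq> P \<longleftrightarrow> B \<subseteq> P" if "B \<subseteq> A" "P \<in> height_one K A" for B P
    using A.Idl_subset_ideal[of P B] that primeideal.axioms(1)[OF height_one_prime] by auto
  have "Idl\<^bsub>sub K A\<^esub> {a} \<in> ?F"
  proof -
    have "?V (Idl\<^bsub>sub K A\<^esub> {a}) = {P \<in> height_one K A. a \<in> P}" using gen[of "{a}"] assms by auto
    then show ?thesis using inf A.genideal_ideal[of "{a}"] A.genideal_self[of "{a}"] assms by auto
  qed
  then have "\<exists>I\<in>?F. \<forall>J\<in>?F. I \<subseteq> J \<longrightarrow> J = I" by (intro N.exists_maximal_ideal_in) auto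
  then obtain I where I: "ideal I (sub K A)" "I \<noteq> {\<zero>}" "infinite (?V I)"
    and max: "\<And>J. ideal J (sub K A) \<Longrightarrow> J \<noteq> {\<zero>} \<Longrightarrow> infinite (?V J) \<Longrightarrow> I \<subseteq> J \<Longrightarrow> J = I" by auto
  interpret I: ideal I "sub K A" by fact
  have IA: "I \<subseteq> A" using I.Icarr by auto
  have "\<not> primeideal I (sub K A)"
  proof
    assume "primeideal I (sub K A)"
    then have "?V I \<subseteq> {I}" using I(2) unfolding height_one_def spec_def by blast
    then show False using I(3) finite_subset by blast
  qed
  moreover have "A \<noteq> I"
  proof
    assume "A = I"
    then have "?V I = {}" using primeD(1,8) height_one_prime by blast
    then have "finite (?V I)" by (metis finite.emptyI)
    then show False using I(3) by blast
  qed
  ultimately obtain x y where xy: "x \<in> A" "y \<in> A" "x \<otimes> y \<in> I" "x \<notin> I" "y \<notin> I"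
    using primeidealI[OF I(1) A.is_cring] by auto
  have fin: "finite (?V (insert z I))" if z: "z \<in> A" "z \<notin> I" for z
  proof (rule ccontr)
    assume inf: "infinite (?V (insert z I))"
    let ?J = "Idl\<^bsub>sub K A\<^esub> (insert z I)"
    have sub: "insert z I \<subseteq> ?J" using A.genideal_self[of "insert z I"] z IA by auto
    have "?V ?J = ?V (insert z I)" using gen[of "insert z I"] z IA by blast
    moreover have "ideal ?J (sub K A)" using A.genideal_ideal[of "insert z I"] z IA by auto
    moreover have "?J \<noteq> {\<zero>}" using sub I(2) I.zero_closed by auto
    ultimately have "?J = I" using max[of ?J] inf sub by auto
    then show False using sub z by blast
  qed
  have "?V I \<subseteq> ?V (insert x I) \<union> ?V (insert y I)"
    using xy primeD(4) height_one_prime by blast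
  then show False using fin xy I(3) finite_subset by blast
qed

subsection \<open>Valuations\<close>

text \<open>The units and the maximal ideal of the localization at \<open>P\<close>, as subsets of \<open>K\<close>.\<close>

definition local_units :: "'a set \<Rightarrow> 'a set" where
  "local_units P = {a \<otimes> inv b | a b. a \<in> A - P \<and> b \<in> A - P}"

definition local_max :: "'a set \<Rightarrow> 'a set" where
  "local_max P = {a \<otimes> inv b | a b. a \<in> P \<and> b \<in> A - P}"

lemma inv_mult:
  assumes "x \<in> carrier K" "y \<in> carrier K" "x \<noteq> \<zero>" "y \<noteq> \<zero>"
  shows "inv (x \<otimes> y) = inv x \<otimes> inv y"
proof -
  have "(x \<otimes> y) \<otimes> (inv x \<otimes> inv y) = (x \<otimes> inv x) \<otimes> (y \<otimes> inv y)"
    using assms by (simp add: m_ac del: inv_r inv_l)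
  then show ?thesis using assms by (intro comm_inv_char) simp_all
qed

lemma inv_inv_K: "x \<in> carrier K \<Longrightarrow> x \<noteq> \<zero> \<Longrightarrow> inv (inv x) = x"
  by (rule comm_inv_char) auto

lemma nonzero_mult: "x \<in> carrier K \<Longrightarrow> y \<in> carrier K \<Longrightarrow> x \<noteq> \<zero> \<Longrightarrow> y \<noteq> \<zero> \<Longrightarrow> x \<otimes> y \<noteq> \<zero>"
  using integral by blast

lemma frac_mult:
  assumes "a \<in> carrier K" "b \<in> carrier K" "c \<in> carrier K" "d \<in> carrier K" "b \<noteq> \<zero>" "d \<noteq> \<zero>"
  shows "(a \<otimes> inv b) \<otimes> (c \<otimes> inv d) = (a \<otimes> c) \<otimes> inv (b \<otimes> d)"
  using assms by (simp add: inv_mult m_ac)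

lemma frac_eq_cross:
  assumes "a \<in> carrier K" "b \<in> carrier K" "c \<in> carrier K" "d \<in> carrier K" "b \<noteq> \<zero>" "d \<noteq> \<zero>"
    and "a \<otimes> inv b = c \<otimes> inv d"
  shows "a \<otimes> d = c \<otimes> b"
proof -
  have "(a \<otimes> inv b) \<otimes> (b \<otimes> d) = (b \<otimes> inv b) \<otimes> (a \<otimes> d)"
    and "(c \<otimes> inv d) \<otimes> (b \<otimes> d) = (d \<otimes> inv d) \<otimes> (c \<otimes> b)"
    using assms(1-6) by (simp_all add: m_ac del: inv_r inv_l)
  then show ?thesis using assms by simp
qed

declare units_of_mult [simp] units_of_one [simp]

lemma carrier_units_of_K [simp]: "carrier (units_of K) = carrier K - {\<zero>}"
  by (simp add: units_of_carrier field_Units)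

lemma inv_units_of_K [simp]: "x \<in> carrier K \<Longrightarrow> x \<noteq> \<zero> \<Longrightarrow> inv\<^bsub>units_of K\<^esub> x = inv x"
  using units_of_inv[of x] by (simp add: field_Units)

lemma nat_pow_units_of_K:
  "x \<in> carrier K \<Longrightarrow> x \<noteq> \<zero> \<Longrightarrow> x [^]\<^bsub>units_of K\<^esub> (n::nat) = x [^] n"
  using units_of_pow[of x n] by (simp add: field_Units)

lemma int_pow_units_of_K:
  assumes "x \<in> carrier K" "x \<noteq> \<zero>"
  shows "x [^]\<^bsub>units_of K\<^esub> (n::int) = x [^] n"
proof -
  interpret G: group "units_of K" by (rule units_group)
  have "x [^]\<^bsub>units_of K\<^esub> (k::nat) \<in> carrier (units_of K)" for k
    using assms by (intro G.nat_pow_closed) simp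
  then have inv_pow: "inv\<^bsub>units_of K\<^esub> (x [^] k) = inv (x [^] k)" for k :: nat
    using assms by (intro inv_units_of_K) (auto simp: nat_pow_units_of_K)
  show ?thesis unfolding int_pow_def2 nat_pow_units_of_K[OF assms] inv_pow ..
qed

lemma subgroup_local_units:
  assumes "primeideal P (sub K A)" shows "subgroup (local_units P) (units_of K)"
proof -
  interpret G: group "units_of K" by (rule units_group)
  note PD = primeD[OF assms]
  have nz: "x \<in> carrier K \<and> x \<noteq> \<zero>" if "x \<in> A - P" for x using that PD(1-3) by auto
  have "local_units P \<subseteq> carrier (units_of K)"
    using nz by (auto simp: local_units_def integral_iff)
  moreover have "\<one> = \<one> \<otimes> inv \<one>" by simp
  then have "\<one> \<in> local_units P" unfolding local_units_def using PD(3) by blast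
  moreover have "inv\<^bsub>units_of K\<^esub> x \<in> local_units P" if x: "x \<in> local_units P" for x
  proof -
    obtain a b where ab: "a \<in> A - P" "b \<in> A - P" "x = a \<otimes> inv b" using x by (auto simp: local_units_def)
    then have "inv\<^bsub>units_of K\<^esub> x = b \<otimes> inv a"
      using nz[OF ab(1)] nz[OF ab(2)] by (simp add: inv_mult inv_inv_K nonzero_mult m_comm)
    then show ?thesis using ab unfolding local_units_def by blast
  qed
  moreover have "x \<otimes>\<^bsub>units_of K\<^esub> y \<in> local_units P" if xy: "x \<in> local_units P" "y \<in> local_units P" for x y
  proof -
    obtain a b c d where ab: "a \<in> A - P" "b \<in> A - P" "x = a \<otimes> inv b" "c \<in> A - P" "d \<in> A - P" "y = c \<otimes> inv d"
      using xy by (auto simp: local_units_def)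
    then have "x \<otimes> y = (a \<otimes> c) \<otimes> inv (b \<otimes> d)" using nz by (simp add: frac_mult)
    moreover have "a \<otimes> c \<in> A - P" "b \<otimes> d \<in> A - P" using ab PD(4) by blast+
    ultimately show ?thesis unfolding local_units_def by auto
  qed
  ultimately show ?thesis by (intro G.subgroupI) auto
qed

lemma local_units_closed:
  assumes "primeideal P (sub K A)" "x \<in> local_units P"
  shows "x \<in> carrier K" "x \<noteq> \<zero>" "inv x \<in> local_units P"
    "y \<in> local_units P \<Longrightarrow> x \<otimes> y \<in> local_units P"
proof -
  interpret U: subgroup "local_units P" "units_of K" by (rule subgroup_local_units[OF assms(1)])
  show x: "x \<in> carrier K" "x \<noteq> \<zero>" using U.mem_carrier[OF assms(2)] by auto
  show "inv x \<in> local_units P" using U.m_inv_closed[OF assms(2)] x by simp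
  show "y \<in> local_units P \<Longrightarrow> x \<otimes> y \<in> local_units P" using U.m_closed[OF assms(2)] by simp
qed

lemma local_units_A:
  assumes "primeideal P (sub K A)" "x \<in> A" "x \<notin> P" shows "x \<in> local_units P"
proof -
  have "x = x \<otimes> inv \<one>" using assms by simp
  then show ?thesis using assms primeD(3)[OF assms(1)] unfolding local_units_def by blast
qed

lemma local_units_max_disjoint:
  assumes P: "primeideal P (sub K A)" shows "local_units P \<inter> local_max P = {}"
proof -
  note PD = primeD[OF P]
  have False if x: "x \<in> local_units P" "x \<in> local_max P" for x
  proof -
    obtain a b c d where ab: "a \<in> A - P" "b \<in> A - P" "x = a \<otimes> inv b" "c \<in> P" "d \<in> A - P" "x = c \<otimes> inv d"
      using x by (auto simp: local_units_def local_max_def)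
    have "a \<in> carrier K" "b \<in> carrier K" "c \<in> carrier K" "d \<in> carrier K" "b \<noteq> \<zero>" "d \<noteq> \<zero>"
      using ab(1,2,4,5) PD(1,2) by auto
    then have "a \<otimes> d = c \<otimes> b" by (rule frac_eq_cross) (use ab(3,6) in simp)
    moreover have "c \<otimes> b \<in> P" using ab PD(5) by blast
    moreover have "a \<otimes> d \<notin> P" using ab PD(4) by blast
    ultimately show False by simp
  qed
  then show ?thesis by blast
qed

lemma loc_inI: "a \<in> A \<Longrightarrow> b \<in> A \<Longrightarrow> b \<notin> P \<Longrightarrow> a \<otimes> inv b \<in> loc_in K A P"
  unfolding loc_in_def by blast

lemma A_subset_loc_in:
  assumes "primeideal P (sub K A)" "x \<in> A" shows "x \<in> loc_in K A P"
  using loc_inI[OF assms(2) A_closed(3) primeD(3)[OF assms(1)]] assms(2) by simp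

lemma loc_in_decomp:
  "loc_in K A P = local_units P \<union> local_max P" if "P \<subseteq> A"
  using that unfolding loc_in_def local_units_def local_max_def by blast

lemma subring_loc_in:
  assumes P: "primeideal P (sub K A)" shows "subring (loc_in K A P) K"
proof -
  note PD = primeD[OF P]
  have nz: "x \<in> carrier K \<and> x \<noteq> \<zero>" if "x \<in> A - P" for x using that PD(1-3) by auto
  show ?thesis
  proof (rule subringI)
    show "loc_in K A P \<subseteq> carrier K" using nz by (auto simp: loc_in_def)
    have "\<one> = \<one> \<otimes> inv \<one>" by simp
    then show "\<one> \<in> loc_in K A P" unfolding loc_in_def using PD(3) by blast
  next
    fix x assume "x \<in> loc_in K A P"
    then obtain a b where ab: "a \<in> A" "b \<in> A - P" "x = a \<otimes> inv b" by (auto simp: loc_in_def)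
    then have "\<ominus> x = (\<ominus> a) \<otimes> inv b" using nz[OF ab(2)] by (simp add: l_minus)
    then show "\<ominus> x \<in> loc_in K A P" using ab unfolding loc_in_def by blast
  next
    fix x y assume "x \<in> loc_in K A P" "y \<in> loc_in K A P"
    then obtain a b c d where ab: "a \<in> A" "b \<in> A - P" "x = a \<otimes> inv b" "c \<in> A" "d \<in> A - P" "y = c \<otimes> inv d"
      by (auto simp: loc_in_def)
    have bd: "b \<otimes> d \<in> A - P" using ab PD(4) by blast
    have "x \<otimes> y = (a \<otimes> c) \<otimes> inv (b \<otimes> d)" using nz ab by (simp add: frac_mult)
    then show "x \<otimes> y \<in> loc_in K A P" using ab bd unfolding loc_in_def by blast
    have "(a \<otimes> d \<oplus> c \<otimes> b) \<otimes> inv (b \<otimes> d) = (a \<otimes> inv b) \<otimes> (d \<otimes> inv d) \<oplus> (c \<otimes> inv d) \<otimes> (b \<otimes> inv b)"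
      using nz[OF ab(2)] nz[OF ab(5)] ab(1,4) by (simp add: inv_mult l_distr r_distr m_ac del: inv_r inv_l)
    then have eq: "(a \<otimes> d \<oplus> c \<otimes> b) \<otimes> inv (b \<otimes> d) = x \<oplus> y"
      using nz[OF ab(2)] nz[OF ab(5)] ab by simp
    have "a \<otimes> d \<oplus> c \<otimes> b \<in> A" using ab(1,2,4,5) by auto
    then have "(a \<otimes> d \<oplus> c \<otimes> b) \<otimes> inv (b \<otimes> d) \<in> loc_in K A P"
      using bd unfolding loc_in_def by blast
    then show "x \<oplus> y \<in> loc_in K A P" unfolding eq .
  qed
qed

lemma Units_loc_in:
  assumes P: "primeideal P (sub K A)"
  shows "Units (sub K (loc_in K A P)) = local_units P"
proof -
  note PD = primeD[OF P]
  have "x \<in> local_units P" if x: "x \<in> Units (sub K (loc_in K A P))" for x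
  proof -
    obtain y where y: "x \<in> loc_in K A P" "y \<in> loc_in K A P" "y \<otimes> x = \<one>"
      using x by (auto simp: Units_def)
    obtain a b c d where ab: "a \<in> A" "b \<in> A - P" "x = a \<otimes> inv b" "c \<in> A" "d \<in> A - P" "y = c \<otimes> inv d"
      using y by (auto simp: loc_in_def)
    have nz: "b \<in> carrier K" "b \<noteq> \<zero>" "d \<in> carrier K" "d \<noteq> \<zero>" using ab PD(1-3) by auto
    have "(c \<otimes> a) \<otimes> inv (d \<otimes> b) = \<one> \<otimes> inv \<one>" using y ab nz by (simp add: frac_mult)
    then have "c \<otimes> a = d \<otimes> b" using frac_eq_cross[of "c \<otimes> a" "d \<otimes> b" \<one> \<one>] ab nz nonzero_mult[of d b] by simp
    then have "a \<notin> P" using ab PD(4)[of d b] PD(6)[of c a] by auto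
    then show ?thesis using ab unfolding local_units_def by blast
  qed
  moreover have "x \<in> Units (sub K (loc_in K A P))" if x: "x \<in> local_units P" for x
  proof -
    have "x \<in> loc_in K A P" "inv x \<in> loc_in K A P"
      using x local_units_closed(3)[OF P x] loc_in_decomp[OF PD(1)] by auto
    then show ?thesis using local_units_closed(1,2)[OF P x]
      by (auto simp: Units_def intro!: bexI[of _ "inv x"])
  qed
  ultimately show ?thesis by blast
qed

lemma uniformizer_generates:
  assumes P: "primeideal P (sub K A)" and ts: "uniformizer P t s"
  shows "PIdl\<^bsub>sub K (loc_in K A P)\<^esub> t = local_max P"
proof -
  note PD = primeD[OF P]
  have ts': "t \<in> P" "t \<in> A" "t \<noteq> \<zero>" "s \<in> A" "s \<notin> P" "s \<noteq> \<zero>" using ts PD(1-3) by (auto simp: uniformizer_def)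
  show ?thesis
  proof (intro equalityI subsetI)
    fix x assume "x \<in> PIdl\<^bsub>sub K (loc_in K A P)\<^esub> t"
    then obtain a b where ab: "a \<in> A" "b \<in> A - P" "x = (a \<otimes> inv b) \<otimes> t"
      by (auto simp: cgenideal_def loc_in_def)
    moreover have "b \<noteq> \<zero>" using ab PD(1-3) by auto
    ultimately have "x = (a \<otimes> t) \<otimes> inv b" using ts' by (simp add: m_ac)
    moreover have "a \<otimes> t \<in> P" using ab ts' PD(6) by blast
    ultimately show "x \<in> local_max P" using ab unfolding local_max_def by blast
  next
    fix x assume "x \<in> local_max P"
    then obtain a b where ab: "a \<in> P" "b \<in> A - P" "x = a \<otimes> inv b" by (auto simp: local_max_def)
    have b: "b \<in> carrier K" "b \<noteq> \<zero>" "a \<in> carrier K" using ab PD(1-3) by auto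
    let ?z = "a \<otimes> (s \<otimes> inv t)"
    have z: "?z \<in> A" using ts ab by (auto simp: uniformizer_def)
    have "s \<otimes> b \<in> A - P" using PD(4)[of s b] ab ts' by auto
    then have "?z \<otimes> inv (s \<otimes> b) \<in> loc_in K A P" using z unfolding loc_in_def by blast
    moreover have "x = (?z \<otimes> inv (s \<otimes> b)) \<otimes> t"
    proof -
      have "(?z \<otimes> inv (s \<otimes> b)) \<otimes> t = (s \<otimes> inv s) \<otimes> (t \<otimes> inv t) \<otimes> (a \<otimes> inv b)"
        using ts' b by (simp add: inv_mult m_ac del: inv_r inv_l)
      then show ?thesis using ts' b ab by simp
    qed
    ultimately show "x \<in> PIdl\<^bsub>sub K (loc_in K A P)\<^esub> t" by (auto simp: cgenideal_def)
  qed
qed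

lemma maximalideal_local_max:
  assumes P: "primeideal P (sub K A)" and ts: "uniformizer P t s"
  shows "maximalideal (local_max P) (sub K (loc_in K A P))"
proof -
  note PD = primeD[OF P]
  let ?O = "loc_in K A P"
  interpret O: domain "sub K ?O" using subring_is_domain[OF subring_loc_in[OF P]] .
  have t: "t \<in> ?O"
  proof -
    have "t = t \<otimes> inv \<one>" using ts PD(1-3) by (auto simp: uniformizer_def)
    then show ?thesis using ts PD unfolding loc_in_def uniformizer_def by blast
  qed
  have one: "\<one> \<in> local_units P" using local_units_A[OF P] PD(3) by simp
  show ?thesis
  proof (rule maximalidealI)
    show "ideal (local_max P) (sub K ?O)"
      using O.cgenideal_ideal[of t] t uniformizer_generates[OF P ts] by simp
    show "carrier (sub K ?O) \<noteq> local_max P"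
      using one local_units_max_disjoint[OF P] loc_in_decomp[OF PD(1)] by auto
    fix J assume J: "ideal J (sub K ?O)" "local_max P \<subseteq> J" "J \<subseteq> carrier (sub K ?O)"
    show "J = local_max P \<or> J = carrier (sub K ?O)"
    proof (cases "J \<subseteq> local_max P")
      case False
      then obtain u where u: "u \<in> J" "u \<in> local_units P" using J(3) loc_in_decomp[OF PD(1)] by auto
      have "inv u \<in> ?O" using local_units_closed(3)[OF P u(2)] loc_in_decomp[OF PD(1)] by blast
      then have "inv u \<otimes> u \<in> J" using ideal.I_l_closed[OF J(1) u(1)] by simp
      then have "\<one> \<in> J" using local_units_closed(1,2)[OF P u(2)] by simp
      then show ?thesis using ideal.one_imp_carrier[OF J(1)] by simp
    qed (use J in blast)
  qed
qed

text \<open>A principal maximal ideal contains no unit, hence equals \<open>local_max P\<close>, which \<open>t\<close> generates too.\<close>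

lemma generator_eq_unit_mult:
  assumes P: "primeideal P (sub K A)" and ts: "uniformizer P t s"
    and t': "t' \<in> loc_in K A P" "maximalideal (PIdl\<^bsub>sub K (loc_in K A P)\<^esub> t') (sub K (loc_in K A P))"
  shows "\<exists>u\<in>local_units P. t' = u \<otimes> t"
proof -
  note PD = primeD[OF P]
  let ?O = "loc_in K A P"
  interpret O: domain "sub K ?O" using subring_is_domain[OF subring_loc_in[OF P]] .
  interpret M: maximalideal "PIdl\<^bsub>sub K ?O\<^esub> t'" "sub K ?O" by (rule t'(2))
  interpret L: maximalideal "local_max P" "sub K ?O" by (rule maximalideal_local_max[OF P ts])
  have Oc: "x \<in> carrier K" if "x \<in> ?O" for x using subringE(1)[OF subring_loc_in[OF P]] that by blast
  have "PIdl\<^bsub>sub K ?O\<^esub> t' \<subseteq> local_max P"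
  proof
    fix x assume x: "x \<in> PIdl\<^bsub>sub K ?O\<^esub> t'"
    then have xO: "x \<in> ?O" using M.Icarr by simp
    show "x \<in> local_max P"
    proof (rule ccontr)
      assume "x \<notin> local_max P"
      then have u: "x \<in> local_units P" using xO loc_in_decomp[OF PD(1)] by blast
      have "inv x \<in> ?O" using local_units_closed(3)[OF P u] loc_in_decomp[OF PD(1)] by blast
      then have "inv x \<otimes> x \<in> PIdl\<^bsub>sub K ?O\<^esub> t'" using M.I_l_closed[OF x] by simp
      then have "\<one> \<in> PIdl\<^bsub>sub K ?O\<^esub> t'" using local_units_closed(1,2)[OF P u] by simp
      then show False using M.one_imp_carrier M.I_notcarr by simp
    qed
  qed
  then have eq: "local_max P = PIdl\<^bsub>sub K ?O\<^esub> t'"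
    using M.I_maximal[OF L.is_ideal] L.I_notcarr L.a_subset by auto
  have "t' \<in> local_max P" using eq O.cgenideal_self[of t'] t' by simp
  then obtain u where u: "u \<in> ?O" "t' = u \<otimes> t"
    using uniformizer_generates[OF P ts] by (auto simp: cgenideal_def)
  have t: "t \<in> P" "t \<noteq> \<zero>" "t \<in> carrier K" using ts PD(1-3) by (auto simp: uniformizer_def)
  have "t = t \<otimes> inv \<one>" using t by simp
  then have "t \<in> local_max P" using t PD(3) unfolding local_max_def by blast
  then obtain v where v: "v \<in> ?O" "t = v \<otimes> t'" using eq by (auto simp: cgenideal_def)
  have "(v \<otimes> u) \<otimes> t = \<one> \<otimes> t" using u v Oc t by (simp add: m_assoc)
  then have "v \<otimes> u = \<one>" using m_rcancel[of t "v \<otimes> u" \<one>] t Oc[OF u(1)] Oc[OF v(1)] by auto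
  then have "u \<in> Units (sub K ?O)"
    using u(1) v(1) Oc[OF u(1)] Oc[OF v(1)] m_comm[of u v]
    by (auto simp: Units_def intro!: bexI[of _ v])
  then show ?thesis using u Units_loc_in[OF P] by blast
qed

text \<open>The exponent is the largest \<open>n\<close> with \<open>x (s / t)\<^sup>n \<in> A\<close>. It exists because \<open>s / t\<close> is not in \<open>A\<close>, so
  not all these elements can lie in \<open>A\<close>.\<close>

lemma exists_decomp_A:
  assumes P: "primeideal P (sub K A)" and ts: "uniformizer P t s" and x: "x \<in> A" "x \<noteq> \<zero>"
  shows "\<exists>n::nat. \<exists>u\<in>local_units P. x = u \<otimes> t [^] n"
proof -
  note PD = primeD[OF P]
  have ts': "t \<in> P" "t \<in> A" "t \<noteq> \<zero>" "s \<in> A" "s \<notin> P" "s \<noteq> \<zero>" using ts PD(1-3) by (auto simp: uniformizer_def)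
  let ?y = "s \<otimes> inv t"
  have y: "?y \<in> carrier K" using ts' by simp
  have "\<exists>n. x \<otimes> ?y [^] n \<in> A \<and> x \<otimes> ?y [^] Suc n \<notin> A"
  proof (rule ccontr)
    assume neg: "\<nexists>n. x \<otimes> ?y [^] n \<in> A \<and> x \<otimes> ?y [^] Suc n \<notin> A"
    have "x \<otimes> ?y [^] (n::nat) \<in> A" for n
    proof (induction n)
      case (Suc n) then show ?case using neg by blast
    qed (use x in simp)
    then have "?y \<in> A" using completely_integrally_closed[OF y x] by blast
    moreover have "?y \<otimes> t = s" using ts' by (simp add: m_assoc)
    ultimately show False using PD(6)[of ?y t] ts' by auto
  qed
  then obtain n where n: "x \<otimes> ?y [^] n \<in> A" "x \<otimes> ?y [^] Suc n \<notin> A" by blast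
  let ?w = "x \<otimes> ?y [^] n"
  have "?w \<notin> P"
  proof
    assume "?w \<in> P"
    then have "?w \<otimes> ?y \<in> A" using ts by (auto simp: uniformizer_def)
    then show False using n(2) x y by (simp add: m_assoc)
  qed
  then have u: "?w \<otimes> inv (s [^] n) \<in> local_units P"
    using n(1) prime_pow_notin[OF P ts'(4,5)] ts' unfolding local_units_def by blast
  have pow0: "s [^] n \<noteq> \<zero>" "s [^] n \<in> carrier K" "t [^] n \<in> carrier K"
    using prime_pow_notin[OF P ts'(4,5), of n] PD(2) ts' by auto
  have "?y [^] n \<otimes> t [^] n = s [^] n"
    using ts' y nat_pow_distrib[of ?y t n] by (simp add: m_assoc)
  moreover have "(?w \<otimes> inv (s [^] n)) \<otimes> t [^] n = x \<otimes> ((?y [^] n \<otimes> t [^] n) \<otimes> inv (s [^] n))"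
    using x y pow0 by (simp add: m_ac del: inv_r inv_l)
  ultimately have "(?w \<otimes> inv (s [^] n)) \<otimes> t [^] n = x \<otimes> (s [^] n \<otimes> inv (s [^] n))" by simp
  then have "x = (?w \<otimes> inv (s [^] n)) \<otimes> t [^] n" using x pow0 by simp
  then show ?thesis using u by blast
qed

lemma exists_decomp:
  assumes P: "primeideal P (sub K A)" and ts: "uniformizer P t s" and x: "x \<in> carrier K" "x \<noteq> \<zero>"
  shows "\<exists>n::int. \<exists>u\<in>local_units P. x = u \<otimes> t [^]\<^bsub>units_of K\<^esub> n"
proof -
  interpret G: group "units_of K" by (rule units_group)
  note PD = primeD[OF P]
  have t: "t \<in> carrier (units_of K)" using ts PD(1-3) by (auto simp: uniformizer_def)
  obtain a b where ab: "a \<in> A" "b \<in> A" "b \<noteq> \<zero>" "x = a \<otimes> inv b" using x(1) by (rule fraction)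
  then have "a \<noteq> \<zero>" using x by auto
  then obtain n u m v where *: "u \<in> local_units P" "a = u \<otimes> t [^] (n::nat)"
    "v \<in> local_units P" "b = v \<otimes> t [^] (m::nat)"
    using exists_decomp_A[OF P ts] ab by metis
  have uv: "u \<in> carrier K" "u \<noteq> \<zero>" "v \<in> carrier K" "v \<noteq> \<zero>"
    using local_units_closed(1,2)[OF P] * by auto
  let ?tn = "t [^]\<^bsub>units_of K\<^esub> n" and ?tm = "t [^]\<^bsub>units_of K\<^esub> m"
  have tc: "?tn \<in> carrier (units_of K)" "?tm \<in> carrier (units_of K)"
    using G.nat_pow_closed[OF t] by blast+
  have "t [^]\<^bsub>units_of K\<^esub> (int n - int m) = ?tn \<otimes> inv ?tm"
    using t tc G.int_pow_diff[of t "int n" "int m"] by (simp add: int_pow_int)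
  moreover have "x = (u \<otimes> inv v) \<otimes> (?tn \<otimes> inv ?tm)"
  proof -
    have "x = (u \<otimes> ?tn) \<otimes> inv (v \<otimes> ?tm)"
      using ab(4) *(2,4) t nat_pow_units_of_K[of t] by simp
    then show ?thesis using uv tc by (simp add: inv_mult m_ac del: inv_r inv_l)
  qed
  moreover have "u \<otimes> inv v \<in> local_units P" using * local_units_closed(3,4)[OF P] by blast
  ultimately show ?thesis by metis
qed

lemma uniformizer_pow_unit:
  assumes P: "primeideal P (sub K A)" and ts: "uniformizer P t s"
    and "t [^]\<^bsub>units_of K\<^esub> (n::int) \<in> local_units P"
  shows "n = 0"
proof (rule ccontr)
  interpret G: group "units_of K" by (rule units_group)
  note PD = primeD[OF P]
  have t: "t \<in> carrier (units_of K)" "t \<in> P" using ts PD(1-3) by (auto simp: uniformizer_def)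
  have no: "t [^]\<^bsub>units_of K\<^esub> int (Suc k) \<notin> local_units P" for k
  proof -
    have "t [^] k \<otimes> t \<in> P" using t PD(1-3) by (intro PD(6)) auto
    moreover have "t [^] k \<otimes> t = (t [^] k \<otimes> t) \<otimes> inv \<one>" using t by auto
    ultimately have "t [^] Suc k \<in> local_max P"
      using PD(3) A_closed(3) unfolding local_max_def nat_pow_Suc by blast
    then show ?thesis
      using local_units_max_disjoint[OF P] t by (auto simp: int_pow_int nat_pow_units_of_K simp del: of_nat_Suc)
  qed
  assume "n \<noteq> 0"
  then consider k where "n = int (Suc k)" | k where "n = - int (Suc k)"
    by (metis int_cases neq0_conv not0_implies_Suc of_nat_0 negative_zless)
  then show False
  proof cases
    case 1 then show False using no assms by auto
  next
    case 2
    then have "inv (t [^]\<^bsub>units_of K\<^esub> n) = t [^]\<^bsub>units_of K\<^esub> int (Suc k)"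
      using G.int_pow_neg[OF t(1), of n] G.int_pow_closed[OF t(1), of n]
      by (simp add: Groups.add_ac)
    then show False using no local_units_closed(3)[OF P assms(3)] by metis
  qed
qed

lemma valuation_eqI:
  assumes P: "primeideal P (sub K A)" and ts: "uniformizer P t s"
    and u: "u \<in> local_units P" and x: "x = u \<otimes> t [^]\<^bsub>units_of K\<^esub> (n::int)"
  shows "valuation K A P x = n"
  unfolding valuation_def
proof (rule the_equality)
  interpret G: comm_group "units_of K"
    by (rule units_comm_group)
  interpret U: subgroup "local_units P" "units_of K" by (rule subgroup_local_units[OF P])
  note PD = primeD[OF P]
  let ?O = "loc_in K A P"
  have t: "t \<in> carrier (units_of K)" "t \<in> P" using ts PD(1-3) by (auto simp: uniformizer_def)
  have "t = t \<otimes> inv \<one>" using t by simp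
  then have tO: "t \<in> ?O" using t PD(1,3) A_closed(3) unfolding loc_in_def by blast
  show "\<exists>t u. maximalideal (PIdl\<^bsub>sub K ?O\<^esub> t) (sub K ?O) \<and> t \<in> ?O \<and> u \<in> Units (sub K ?O) \<and> x = u \<otimes> t [^] n"
    using maximalideal_local_max[OF P ts] uniformizer_generates[OF P ts] tO u x Units_loc_in[OF P]
      int_pow_units_of_K[of t n] t by (intro exI[of _ t] exI[of _ u]) auto
  fix m :: int
  assume "\<exists>t u. maximalideal (PIdl\<^bsub>sub K ?O\<^esub> t) (sub K ?O) \<and> t \<in> ?O \<and> u \<in> Units (sub K ?O) \<and> x = u \<otimes> t [^] m"
  then obtain t' u' where t': "maximalideal (PIdl\<^bsub>sub K ?O\<^esub> t') (sub K ?O)" "t' \<in> ?O"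
    "u' \<in> local_units P" "x = u' \<otimes> t' [^] m" using Units_loc_in[OF P] by auto
  then obtain v where v: "v \<in> local_units P" "t' = v \<otimes> t" using generator_eq_unit_mult[OF P ts] by blast
  note uv = U.mem_carrier[OF u] U.mem_carrier[OF v(1)] U.mem_carrier[OF t'(3)]
  have t'c: "t' \<in> carrier (units_of K)" using G.m_closed[OF uv(2) t(1)] v(2) by simp
  have vm: "v [^]\<^bsub>units_of K\<^esub> m \<in> local_units P"
    using group.int_pow_closed[OF U.subgroup_is_group[OF G.is_group], of v m] v(1)
      G.int_pow_consistent[OF subgroup_local_units[OF P] v(1), of m] by simp
  have "x = u' \<otimes>\<^bsub>units_of K\<^esub> t' [^]\<^bsub>units_of K\<^esub> m"
    using t' t'c int_pow_units_of_K[of t' m] by simp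
  also have "t' [^]\<^bsub>units_of K\<^esub> m = v [^]\<^bsub>units_of K\<^esub> m \<otimes>\<^bsub>units_of K\<^esub> t [^]\<^bsub>units_of K\<^esub> m"
    using G.int_pow_distrib[OF uv(2) t(1), of m] v(2) by simp
  finally have "u \<otimes>\<^bsub>units_of K\<^esub> t [^]\<^bsub>units_of K\<^esub> n
      = (u' \<otimes>\<^bsub>units_of K\<^esub> v [^]\<^bsub>units_of K\<^esub> m) \<otimes>\<^bsub>units_of K\<^esub> t [^]\<^bsub>units_of K\<^esub> m" (is "_ = ?w \<otimes>\<^bsub>units_of K\<^esub> _")
    using x uv t vm U.mem_carrier[OF vm] G.int_pow_closed[OF t(1), of m] by (simp add: m_assoc)
  moreover have w: "?w \<in> local_units P" using U.m_closed[OF t'(3) vm] .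
  ultimately have "t [^]\<^bsub>units_of K\<^esub> n \<otimes>\<^bsub>units_of K\<^esub> inv\<^bsub>units_of K\<^esub> (t [^]\<^bsub>units_of K\<^esub> m)
      = inv\<^bsub>units_of K\<^esub> u \<otimes>\<^bsub>units_of K\<^esub> ?w"
    using U.mem_carrier[OF w] uv(1) G.int_pow_closed[OF t(1)]
    by (metis G.inv_solve_left G.inv_solve_right G.m_assoc G.m_closed G.inv_closed)
  then have "t [^]\<^bsub>units_of K\<^esub> (n - m) \<in> local_units P"
    using G.int_pow_diff[OF t(1)] U.m_closed[OF U.m_inv_closed[OF u] w] by simp
  then show "m = n" using uniformizer_pow_unit[OF P ts] by fastforce
qed

lemma valuation_unit:
  assumes P: "P \<in> height_one K A" and u: "u \<in> local_units P"
  shows "valuation K A P u = 0"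
proof -
  note pP = height_one_prime[OF P]
  obtain t s where ts: "uniformizer P t s" by (rule height_one_uniformizer[OF P])
  have "u = u \<otimes> t [^]\<^bsub>units_of K\<^esub> (0::int)" using local_units_closed(1)[OF pP u] by simp
  then show ?thesis by (rule valuation_eqI[OF pP ts u])
qed

lemma valuation_mult:
  assumes P: "P \<in> height_one K A" and x: "x \<in> carrier K" "x \<noteq> \<zero>" and y: "y \<in> carrier K" "y \<noteq> \<zero>"
  shows "valuation K A P (x \<otimes> y) = valuation K A P x + valuation K A P y"
proof -
  interpret G: group "units_of K" by (rule units_group)
  note pP = height_one_prime[OF P]
  obtain t s where ts: "uniformizer P t s" by (rule height_one_uniformizer[OF P])
  have t: "t \<in> carrier (units_of K)" using ts primeD(1)[OF pP] by (auto simp: uniformizer_def)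
  obtain n u where nu: "u \<in> local_units P" "x = u \<otimes> t [^]\<^bsub>units_of K\<^esub> (n::int)"
    using exists_decomp[OF pP ts x] by blast
  obtain m w where mw: "w \<in> local_units P" "y = w \<otimes> t [^]\<^bsub>units_of K\<^esub> (m::int)"
    using exists_decomp[OF pP ts y] by blast
  have c: "u \<in> carrier K" "w \<in> carrier K" "t [^]\<^bsub>units_of K\<^esub> n \<in> carrier K" "t [^]\<^bsub>units_of K\<^esub> m \<in> carrier K"
    using local_units_closed(1)[OF pP] nu(1) mw(1) G.int_pow_closed[OF t] by auto
  have "t [^]\<^bsub>units_of K\<^esub> (n + m) = t [^]\<^bsub>units_of K\<^esub> n \<otimes> t [^]\<^bsub>units_of K\<^esub> m"
    using G.int_pow_mult[OF t, of n m] by simp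
  then have "x \<otimes> y = (u \<otimes> w) \<otimes> t [^]\<^bsub>units_of K\<^esub> (n + m)"
    unfolding nu(2) mw(2) using c by (simp add: m_ac)
  then have "valuation K A P (x \<otimes> y) = n + m"
    by (rule valuation_eqI[OF pP ts local_units_closed(4)[OF pP nu(1) mw(1)]])
  then show ?thesis
    using valuation_eqI[OF pP ts nu] valuation_eqI[OF pP ts mw] by simp
qed

text \<open>A negative exponent is excluded for a fraction \<open>a / b\<close> with \<open>b \<notin> P\<close> because \<open>b\<close> is a local unit and
  \<open>a\<close> has a natural number as exponent.\<close>

lemma valuation_nonneg_iff:
  assumes P: "P \<in> height_one K A" and x: "x \<in> carrier K" "x \<noteq> \<zero>"
  shows "0 \<le> valuation K A P x \<longleftrightarrow> x \<in> loc_in K A P"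
proof
  interpret G: group "units_of K" by (rule units_group)
  note pP = height_one_prime[OF P]
  obtain t s where ts: "uniformizer P t s" by (rule height_one_uniformizer[OF P])
  have t: "t \<in> carrier (units_of K)" "t \<in> A" using ts primeD(1)[OF pP] by (auto simp: uniformizer_def)
  show "x \<in> loc_in K A P" if nonneg: "0 \<le> valuation K A P x"
  proof -
    obtain n u where nu: "u \<in> local_units P" "x = u \<otimes> t [^]\<^bsub>units_of K\<^esub> (n::int)"
      using exists_decomp[OF pP ts x] by blast
    have "n = valuation K A P x" using valuation_eqI[OF pP ts nu] by simp
    then obtain k where k: "n = int k" using nonneg by (metis nonneg_int_cases)
    have xk: "x = u \<otimes> t [^] k" using nu(2) t unfolding k by (simp add: int_pow_int nat_pow_units_of_K)
    have "t [^] k \<in> loc_in K A P" using A_subset_loc_in[OF pP] t by blast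
    moreover have "u \<in> loc_in K A P" using nu(1) loc_in_decomp[OF primeD(1)[OF pP]] by blast
    ultimately show ?thesis using subringE(6)[OF subring_loc_in[OF pP]] xk by simp
  qed
  show "0 \<le> valuation K A P x" if xl: "x \<in> loc_in K A P"
  proof -
    obtain a b where ab: "a \<in> A" "b \<in> A" "b \<notin> P" "x = a \<otimes> inv b" using xl by (auto simp: loc_in_def)
    have b: "b \<in> local_units P" using local_units_A[OF pP ab(2,3)] .
    have a0: "a \<noteq> \<zero>" using ab x local_units_closed(1,2)[OF pP b] by auto
    obtain n u where nu: "u \<in> local_units P" "a = u \<otimes> t [^] (n::nat)"
      using exists_decomp_A[OF pP ts ab(1) a0] by blast
    have "a = u \<otimes> t [^]\<^bsub>units_of K\<^esub> int n"
      using nu(2) t by (simp add: int_pow_int nat_pow_units_of_K)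
    then have "valuation K A P a = int n" by (rule valuation_eqI[OF pP ts nu(1)])
    moreover have "valuation K A P (inv b) = 0"
      by (rule valuation_unit[OF P local_units_closed(3)[OF pP b]])
    ultimately show ?thesis
      using valuation_mult[OF P, of a "inv b"] ab a0 local_units_closed(1,2)[OF pP b] by simp
  qed
qed

lemma finite_valuation_support:
  assumes x: "x \<in> carrier K" "x \<noteq> \<zero>"
  shows "finite {P \<in> height_one K A. valuation K A P x \<noteq> 0}"
proof -
  obtain a b where ab: "a \<in> A" "b \<in> A" "b \<noteq> \<zero>" "x = a \<otimes> inv b" using x(1) by (rule fraction)
  then have a0: "a \<noteq> \<zero>" using x by auto
  have "valuation K A P x = 0" if P: "P \<in> height_one K A" "a \<notin> P" "b \<notin> P" for P
  proof (rule valuation_unit[OF P(1)])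
    show "x \<in> local_units P" using ab P unfolding local_units_def by blast
  qed
  then have "{P \<in> height_one K A. valuation K A P x \<noteq> 0}
      \<subseteq> {P \<in> height_one K A. a \<in> P} \<union> {P \<in> height_one K A. b \<in> P}" by blast
  then show ?thesis using finite_height_one_over ab a0 by (meson finite_UnI finite_subset)
qed

text \<open>\<^const>\<open>Abs_poly_mapping\<close> is only meaningful on functions of finite support.\<close>

lemma lookup_div_of:
  assumes "x \<in> carrier K" "x \<noteq> \<zero>"
  shows "poly_mapping.lookup (div_of K A x) P = (if P \<in> height_one K A then valuation K A P x else 0)"
proof -
  have "{P. (if P \<in> height_one K A then valuation K A P x else 0) \<noteq> 0}
      = {P \<in> height_one K A. valuation K A P x \<noteq> 0}" by auto
  then show ?thesis unfolding div_of_def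
    using finite_valuation_support[OF assms] by (subst Abs_poly_mapping_inverse) auto
qed

lemma div_of_mult:
  assumes "x \<in> carrier K" "x \<noteq> \<zero>" "y \<in> carrier K" "y \<noteq> \<zero>"
  shows "div_of K A (x \<otimes> y) = div_of K A x + div_of K A y"
  by (rule poly_mapping_eqI) (use assms in \<open>simp add: lookup_div_of lookup_add valuation_mult nonzero_mult\<close>)

lemma div_of_nonneg_iff:
  assumes "x \<in> carrier K" "x \<noteq> \<zero>"
  shows "(\<forall>P. 0 \<le> poly_mapping.lookup (div_of K A x) P) \<longleftrightarrow> x \<in> A"
proof
  assume nonneg: "\<forall>P. 0 \<le> poly_mapping.lookup (div_of K A x) P"
  have "x \<in> loc_in K A P" if "P \<in> height_one K A" for P
    using valuation_nonneg_iff[OF that assms] lookup_div_of[OF assms, of P] that nonneg[rule_format, of P]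
    by simp
  then show "x \<in> A" by (rule mem_A_if_locally[OF assms(1)])
next
  assume xA: "x \<in> A"
  have "0 \<le> valuation K A P x" if P: "P \<in> height_one K A" for P
  proof -
    have "x \<in> loc_in K A P" using A_subset_loc_in[OF height_one_prime[OF P] xA] .
    then show ?thesis using valuation_nonneg_iff[OF P assms] by blast
  qed
  then show "\<forall>P. 0 \<le> poly_mapping.lookup (div_of K A x) P" by (simp add: lookup_div_of[OF assms])
qed

lemma div_of_unit:
  assumes xy: "x \<in> A" "y \<in> A" "x \<otimes> y = \<one>" shows "div_of K A x = 0"
proof (rule poly_mapping_eqI)
  fix P
  have nz: "x \<noteq> \<zero>" "x \<in> carrier K" using xy by auto
  have "valuation K A P x = 0" if P: "P \<in> height_one K A"
  proof -
    note pP = height_one_prime[OF P]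
    have "x \<notin> P" using primeD(3,5)[OF pP] xy by metis
    then show ?thesis by (intro valuation_unit[OF P] local_units_A[OF pP] xy)
  qed
  then show "poly_mapping.lookup (div_of K A x) P = poly_mapping.lookup 0 P"
    by (simp add: lookup_div_of nz)
qed

lemma mem_sections_iff:
  "f \<in> sections K A D \<longleftrightarrow> f = \<zero> \<or>
    (f \<in> carrier K \<and> f \<noteq> \<zero> \<and> (\<forall>P. 0 \<le> poly_mapping.lookup (div_of K A f + D) P))"
  by (auto simp: sections_def)

lemma sections_zero: "sections K A 0 = A"
proof (rule Set.set_eqI)
  fix f
  show "f \<in> sections K A 0 \<longleftrightarrow> f \<in> A"
    using div_of_nonneg_iff[of f] unfolding mem_sections_iff add_0_right by (metis A_closed(1,2))
qed

lemma sections_carrier: "f \<in> sections K A D \<Longrightarrow> f \<in> carrier K"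
  by (auto simp: sections_def)

text \<open>Both \<open>div f + D\<close> and \<open>div g + D'\<close> are effective, and their sum is the divisor of the unit \<open>c f g\<close>,
  so they vanish and \<open>D\<close> is the divisor of \<open>1 / f\<close>.\<close>

lemma principal_if_product_unit:
  assumes fg: "f \<in> sections K A D" "g \<in> sections K A D'" and c: "c \<in> carrier K" "c \<noteq> \<zero>"
    and div: "div_of K A c = D + D'" and "c \<otimes> (f \<otimes> g) \<in> A" "y \<in> A" "c \<otimes> (f \<otimes> g) \<otimes> y = \<one>"
  shows "\<exists>h\<in>carrier K - {\<zero>}. D = div_of K A h"
proof -
  have K: "f \<in> carrier K" "g \<in> carrier K" using fg sections_carrier by auto
  have nz: "f \<noteq> \<zero>" "g \<noteq> \<zero>" using assms(8) K c A_closed(1)[OF assms(7)] by auto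
  have "div_of K A (c \<otimes> (f \<otimes> g)) = 0" by (rule div_of_unit[OF assms(6-8)])
  then have sum: "(div_of K A f + D) + (div_of K A g + D') = 0"
    using K nz c by (simp add: div_of_mult nonzero_mult div ac_simps)
  have "div_of K A f + D = 0"
  proof (rule poly_mapping_eqI)
    fix P
    have "0 \<le> poly_mapping.lookup (div_of K A f + D) P" "0 \<le> poly_mapping.lookup (div_of K A g + D') P"
      using fg nz by (auto simp: mem_sections_iff)
    moreover have "poly_mapping.lookup (div_of K A f + D) P + poly_mapping.lookup (div_of K A g + D') P = 0"
      using sum by (metis lookup_add lookup_zero)
    ultimately show "poly_mapping.lookup (div_of K A f + D) P = poly_mapping.lookup 0 P" by simp
  qed
  moreover have "div_of K A f + div_of K A (inv f) = 0"
    using div_of_mult[of f "inv f"] div_of_unit[of \<one> \<one>] K nz by simp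
  ultimately have "D = div_of K A (inv f)" by (metis add_left_cancel)
  then show ?thesis using K nz by (intro bexI[of _ "inv f"]) auto
qed

lemma divisor_class_eq_if_principal:
  assumes h: "h \<in> carrier K" "h \<noteq> \<zero>"
  shows "divisor_class K A (div_of K A h) = divisor_class K A 0"
proof -
  have "divisor_class K A E = {div_of K A f + E | f. f \<in> carrier K \<and> f \<noteq> \<zero>}" for E
    unfolding divisor_class_def principal_divisors_def r_coset_def by auto
  moreover have "{div_of K A f + div_of K A h | f. f \<in> carrier K \<and> f \<noteq> \<zero>}
      = {div_of K A f + 0 | f. f \<in> carrier K \<and> f \<noteq> \<zero>}"
  proof (intro equalityI subsetI)
    fix d assume "d \<in> {div_of K A f + div_of K A h | f. f \<in> carrier K \<and> f \<noteq> \<zero>}"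
    then obtain f where f: "d = div_of K A f + div_of K A h" "f \<in> carrier K" "f \<noteq> \<zero>" by blast
    then have "d = div_of K A (f \<otimes> h) + 0" using h by (simp add: div_of_mult)
    then show "d \<in> {div_of K A f + 0 | f. f \<in> carrier K \<and> f \<noteq> \<zero>}" using f h nonzero_mult by blast
  next
    fix d assume "d \<in> {div_of K A f + 0 | f. f \<in> carrier K \<and> f \<noteq> \<zero>}"
    then obtain f where f: "d = div_of K A f" "f \<in> carrier K" "f \<noteq> \<zero>" by auto
    have "f = (f \<otimes> inv h) \<otimes> h" using f h by (simp add: m_assoc)
    then have "d = div_of K A (f \<otimes> inv h) + div_of K A h"
      using f h by (metis div_of_mult inv_closed inv_nonzero m_closed nonzero_mult)
    moreover have "f \<otimes> inv h \<in> carrier K" "f \<otimes> inv h \<noteq> \<zero>" using f h nonzero_mult by auto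
    ultimately show "d \<in> {div_of K A f + div_of K A h | f. f \<in> carrier K \<and> f \<noteq> \<zero>}" by blast
  qed
  ultimately show ?thesis by simp
qed

end

section \<open>Graded algebras and the trace onto degree zero\<close>

text \<open>The grading is recorded by the projections \<open>pr \<gamma>\<close> onto the homogeneous parts, the degree-one part
  being identified with \<open>R\<close> by \<open>\<theta>\<close> and \<open>T\<close>. Of the integrality of a divisorial algebra only the absence
  of nilpotent homogeneous elements is kept.\<close>

locale graded_algebra = cring S + R: cring R + G: comm_group \<Gamma>
  for S (structure) and R :: "('a, 'm) ring_scheme" and \<Gamma> :: "('g, 'n) monoid_scheme" +
  fixes \<theta> :: "'a \<Rightarrow> 'b" and T :: "'b \<Rightarrow> 'a" and pr :: "'g \<Rightarrow> 'b \<Rightarrow> 'b"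
  assumes fin [simp]: "finite (carrier \<Gamma>)"
    and \<theta>_hom: "\<theta> \<in> ring_hom R S"
    and T_closed [simp]: "s \<in> carrier S \<Longrightarrow> T s \<in> carrier R"
    and T_add: "s \<in> carrier S \<Longrightarrow> t \<in> carrier S \<Longrightarrow> T (s \<oplus> t) = T s \<oplus>\<^bsub>R\<^esub> T t"
    and T_linear: "r \<in> carrier R \<Longrightarrow> s \<in> carrier S \<Longrightarrow> T (\<theta> r \<otimes> s) = r \<otimes>\<^bsub>R\<^esub> T s"
    and T_\<theta> [simp]: "r \<in> carrier R \<Longrightarrow> T (\<theta> r) = r"
    and pr_closed [simp]: "\<gamma> \<in> carrier \<Gamma> \<Longrightarrow> s \<in> carrier S \<Longrightarrow> pr \<gamma> s \<in> carrier S"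
    and pr_add: "\<gamma> \<in> carrier \<Gamma> \<Longrightarrow> s \<in> carrier S \<Longrightarrow> t \<in> carrier S \<Longrightarrow> pr \<gamma> (s \<oplus> t) = pr \<gamma> s \<oplus> pr \<gamma> t"
    and pr_sum: "s \<in> carrier S \<Longrightarrow> (\<Oplus>\<gamma>\<in>carrier \<Gamma>. pr \<gamma> s) = s"
    and pr_pr: "\<gamma> \<in> carrier \<Gamma> \<Longrightarrow> \<delta> \<in> carrier \<Gamma> \<Longrightarrow> s \<in> carrier S \<Longrightarrow>
      pr \<gamma> (pr \<delta> s) = (if \<gamma> = \<delta> then pr \<delta> s else \<zero>)"
    and pr_mult: "\<gamma> \<in> carrier \<Gamma> \<Longrightarrow> \<delta> \<in> carrier \<Gamma> \<Longrightarrow> s \<in> carrier S \<Longrightarrow> t \<in> carrier S \<Longrightarrow>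
      pr (\<gamma> \<otimes>\<^bsub>\<Gamma>\<^esub> \<delta>) (pr \<gamma> s \<otimes> pr \<delta> t) = pr \<gamma> s \<otimes> pr \<delta> t"
    and pr_one: "s \<in> carrier S \<Longrightarrow> pr \<one>\<^bsub>\<Gamma>\<^esub> s = \<theta> (T s)"
    and homogeneous_reduced: "\<gamma> \<in> carrier \<Gamma> \<Longrightarrow> s \<in> carrier S \<Longrightarrow> pr \<gamma> s [^] (n::nat) = \<zero> \<Longrightarrow> pr \<gamma> s = \<zero>"
begin

sublocale \<theta>: ring_hom_ring R S \<theta>
  by (rule ring_hom_ringI2[OF R.ring_axioms ring_axioms \<theta>_hom])

lemma \<theta>_mult: "a \<in> carrier R \<Longrightarrow> b \<in> carrier R \<Longrightarrow> \<theta> (a \<otimes>\<^bsub>R\<^esub> b) = \<theta> a \<otimes> \<theta> b"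
  by simp

lemma T_zero [simp]: "T \<zero> = \<zero>\<^bsub>R\<^esub>"
  using T_\<theta>[of "\<zero>\<^bsub>R\<^esub>"] by simp

lemma T_one [simp]: "T \<one> = \<one>\<^bsub>R\<^esub>"
  using T_\<theta>[of "\<one>\<^bsub>R\<^esub>"] by simp

lemma T_finsum:
  assumes "\<And>i. i \<in> I \<Longrightarrow> f i \<in> carrier S"
  shows "T (finsum S f I) = (\<Oplus>\<^bsub>R\<^esub>i\<in>I. T (f i))"
  using assms
proof (induction I rule: infinite_finite_induct)
  case (insert i I)
  then have "f \<in> I \<rightarrow> carrier S" "(\<lambda>i. T (f i)) \<in> I \<rightarrow> carrier R" by auto
  then show ?case using insert by (simp add: T_add finsum_closed)
qed auto

definition homogeneous :: "'g \<Rightarrow> 'b \<Rightarrow> bool" where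
  "homogeneous \<gamma> s \<longleftrightarrow> \<gamma> \<in> carrier \<Gamma> \<and> s \<in> carrier S \<and> pr \<gamma> s = s"

lemma homogeneous_pr [simp]: "\<gamma> \<in> carrier \<Gamma> \<Longrightarrow> s \<in> carrier S \<Longrightarrow> homogeneous \<gamma> (pr \<gamma> s)"
  by (simp add: homogeneous_def pr_pr)

lemma homogeneousD: "homogeneous \<gamma> s \<Longrightarrow> \<gamma> \<in> carrier \<Gamma>" "homogeneous \<gamma> s \<Longrightarrow> s \<in> carrier S"
  by (auto simp: homogeneous_def)

lemma homogeneous_mult:
  "homogeneous \<gamma> s \<Longrightarrow> homogeneous \<delta> t \<Longrightarrow> homogeneous (\<gamma> \<otimes>\<^bsub>\<Gamma>\<^esub> \<delta>) (s \<otimes> t)"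
  using pr_mult[of \<gamma> \<delta> s t] by (auto simp: homogeneous_def)

lemma pr_homogeneous: "homogeneous \<gamma> s \<Longrightarrow> \<delta> \<in> carrier \<Gamma> \<Longrightarrow> pr \<delta> s = (if \<delta> = \<gamma> then s else \<zero>)"
  using pr_pr[of \<delta> \<gamma> s] by (auto simp: homogeneous_def)

lemma homogeneous_\<theta>: "r \<in> carrier R \<Longrightarrow> homogeneous \<one>\<^bsub>\<Gamma>\<^esub> (\<theta> r)"
  by (simp add: homogeneous_def pr_one)

lemma homogeneous_one_degree: "homogeneous \<one>\<^bsub>\<Gamma>\<^esub> s \<Longrightarrow> \<theta> (T s) = s"
  using pr_one[of s] by (simp add: homogeneous_def)

lemma homogeneous_pow: "homogeneous \<gamma> s \<Longrightarrow> homogeneous (\<gamma> [^]\<^bsub>\<Gamma>\<^esub> (n::nat)) (s [^] n)"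
proof (induction n)
  case 0
  then show ?case using homogeneous_\<theta>[of "\<one>\<^bsub>R\<^esub>"] by simp
qed (simp add: homogeneous_mult)

lemma T_homogeneous:
  assumes "homogeneous \<gamma> s" "\<gamma> \<noteq> \<one>\<^bsub>\<Gamma>\<^esub>" shows "T s = \<zero>\<^bsub>R\<^esub>"
proof -
  have "\<theta> (T s) = \<zero>" using pr_homogeneous[OF assms(1), of "\<one>\<^bsub>\<Gamma>\<^esub>"] assms pr_one[of s] homogeneousD by auto
  then show ?thesis using T_\<theta>[of "T s"] homogeneousD(2)[OF assms(1)] by simp
qed

lemma pr_zero [simp]: "\<gamma> \<in> carrier \<Gamma> \<Longrightarrow> pr \<gamma> \<zero> = \<zero>"
  using pr_add[of \<gamma> \<zero> \<zero>] by (simp add: add.l_cancel_one)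

lemma pr_finsum:
  assumes "\<gamma> \<in> carrier \<Gamma>" "\<And>i. i \<in> I \<Longrightarrow> f i \<in> carrier S"
  shows "pr \<gamma> (finsum S f I) = (\<Oplus>i\<in>I. pr \<gamma> (f i))"
  using assms(2)
proof (induction I rule: infinite_finite_induct)
  case (insert i I)
  then have "f \<in> I \<rightarrow> carrier S" "(\<lambda>i. pr \<gamma> (f i)) \<in> I \<rightarrow> carrier S" using assms by auto
  then show ?case using insert assms(1) by (simp add: pr_add finsum_closed)
qed (use assms in auto)

lemma inverse_pow_order_minus_one:
  assumes "\<gamma> \<in> carrier \<Gamma>"
  shows "\<gamma> [^]\<^bsub>\<Gamma>\<^esub> (order \<Gamma> - 1) = inv\<^bsub>\<Gamma>\<^esub> \<gamma>" and "\<gamma> [^]\<^bsub>\<Gamma>\<^esub> order \<Gamma> = \<one>\<^bsub>\<Gamma>\<^esub>" and "1 \<le> order \<Gamma>"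
proof -
  show o: "1 \<le> order \<Gamma>" using G.order_gt_0_iff_finite by simp
  show p: "\<gamma> [^]\<^bsub>\<Gamma>\<^esub> order \<Gamma> = \<one>\<^bsub>\<Gamma>\<^esub>" using G.pow_order_eq_1[OF assms] .
  have "\<gamma> [^]\<^bsub>\<Gamma>\<^esub> (order \<Gamma> - 1) \<otimes>\<^bsub>\<Gamma>\<^esub> \<gamma> = \<one>\<^bsub>\<Gamma>\<^esub>"
    using p o G.nat_pow_Suc[of \<gamma> "order \<Gamma> - 1"] by simp
  then show "\<gamma> [^]\<^bsub>\<Gamma>\<^esub> (order \<Gamma> - 1) = inv\<^bsub>\<Gamma>\<^esub> \<gamma>" using assms by (intro G.inv_equality[symmetric]) auto
qed

text \<open>Only the component of \<open>t\<close> in the inverse degree contributes to degree one.\<close>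

lemma T_mult_homogeneous:
  assumes x: "homogeneous \<gamma> x" and t: "t \<in> carrier S"
  shows "T (x \<otimes> t) = T (x \<otimes> pr (inv\<^bsub>\<Gamma>\<^esub> \<gamma>) t)"
proof -
  note g = homogeneousD[OF x]
  have "T (x \<otimes> t) = T (x \<otimes> (\<Oplus>\<delta>\<in>carrier \<Gamma>. pr \<delta> t))" using t by (simp add: pr_sum)
  also have "x \<otimes> (\<Oplus>\<delta>\<in>carrier \<Gamma>. pr \<delta> t) = (\<Oplus>\<delta>\<in>carrier \<Gamma>. x \<otimes> pr \<delta> t)"
    using g t by (intro finsum_rdistr) auto
  also have "T \<dots> = (\<Oplus>\<^bsub>R\<^esub>\<delta>\<in>carrier \<Gamma>. T (x \<otimes> pr \<delta> t))" using g t by (intro T_finsum) auto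
  also have "\<dots> = (\<Oplus>\<^bsub>R\<^esub>\<delta>\<in>{inv\<^bsub>\<Gamma>\<^esub> \<gamma>}. T (x \<otimes> pr \<delta> t))"
  proof (rule R.add.finprod_mono_neutral_cong_right)
    show "T (x \<otimes> pr \<delta> t) = \<zero>\<^bsub>R\<^esub>" if "\<delta> \<in> carrier \<Gamma> - {inv\<^bsub>\<Gamma>\<^esub> \<gamma>}" for \<delta>
    proof (rule T_homogeneous)
      show "homogeneous (\<gamma> \<otimes>\<^bsub>\<Gamma>\<^esub> \<delta>) (x \<otimes> pr \<delta> t)" using that x t by (intro homogeneous_mult) auto
      show "\<gamma> \<otimes>\<^bsub>\<Gamma>\<^esub> \<delta> \<noteq> \<one>\<^bsub>\<Gamma>\<^esub>" using that g G.inv_unique'[of \<gamma> \<delta>] G.m_comm[of \<gamma> \<delta>] by auto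
    qed
  qed (use g t in auto)
  also have "\<dots> = T (x \<otimes> pr (inv\<^bsub>\<Gamma>\<^esub> \<gamma>) t)" using g t by simp
  finally show ?thesis .
qed

subsection \<open>Trace ideals\<close>

lemma mem_trace_ideal_iff:
  "s \<in> trace_ideal S T P \<longleftrightarrow> s \<in> carrier S \<and> (\<forall>t\<in>carrier S. T (t \<otimes> s) \<in> P)"
  by (auto simp: trace_ideal_def cgenideal_def)

lemma ideal_trace_ideal:
  assumes "ideal P R" shows "ideal (trace_ideal S T P) S"
proof -
  interpret P: ideal P R by fact
  show ?thesis
  proof (rule idealI_closed)
    fix x a assume x: "x \<in> trace_ideal S T P" and a: "a \<in> carrier S"
    have "T (t \<otimes> (a \<otimes> x)) \<in> P" if "t \<in> carrier S" for t
    proof -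
      have "T ((t \<otimes> a) \<otimes> x) \<in> P" using x a that by (simp add: mem_trace_ideal_iff)
      then show ?thesis using x a that by (simp add: mem_trace_ideal_iff m_assoc)
    qed
    then show "a \<otimes> x \<in> trace_ideal S T P" using x a by (simp add: mem_trace_ideal_iff)
  qed (auto simp: mem_trace_ideal_iff r_distr T_add)
qed

lemma pr_mem_trace_ideal:
  assumes s: "s \<in> trace_ideal S T P" and g: "\<gamma> \<in> carrier \<Gamma>"
  shows "pr \<gamma> s \<in> trace_ideal S T P"
  unfolding mem_trace_ideal_iff
proof (intro conjI ballI)
  have sS: "s \<in> carrier S" using s by (simp add: mem_trace_ideal_iff)
  then show "pr \<gamma> s \<in> carrier S" using g by simp
  fix t assume t: "t \<in> carrier S"
  let ?t = "pr (inv\<^bsub>\<Gamma>\<^esub> \<gamma>) t"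
  have "T (t \<otimes> pr \<gamma> s) = T (pr \<gamma> s \<otimes> t)" using sS g t by (simp add: m_comm)
  also have "\<dots> = T (pr \<gamma> s \<otimes> ?t)" using sS g t by (intro T_mult_homogeneous) auto
  also have "\<dots> = T (?t \<otimes> pr \<gamma> s)" using sS g t by (simp add: m_comm)
  also have "\<dots> = T (?t \<otimes> s)" using T_mult_homogeneous[of "inv\<^bsub>\<Gamma>\<^esub> \<gamma>" ?t s] sS g t by simp
  also have "\<dots> \<in> P" using s g t by (simp add: mem_trace_ideal_iff)
  finally show "T (t \<otimes> pr \<gamma> s) \<in> P" .
qed

lemma \<theta>_mem_trace_ideal:
  assumes "ideal P R" "r \<in> P" shows "\<theta> r \<in> trace_ideal S T P"
proof -
  interpret P: ideal P R by fact
  have r: "r \<in> carrier R" using P.Icarr assms by blast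
  have "T (t \<otimes> \<theta> r) \<in> P" if "t \<in> carrier S" for t
    using T_linear[OF r that] P.I_r_closed[OF assms(2), of "T t"] r that by (simp add: m_comm)
  then show ?thesis using r by (simp add: mem_trace_ideal_iff)
qed

lemma extension_subset_trace_ideal:
  assumes "ideal P R" shows "Idl (\<theta> ` P) \<subseteq> trace_ideal S T P"
  by (rule genideal_minimal[OF ideal_trace_ideal[OF assms]]) (use assms \<theta>_mem_trace_ideal in blast)

lemma T_mem_if_mem_trace_ideal: "s \<in> trace_ideal S T P \<Longrightarrow> T s \<in> P"
  using mem_trace_ideal_iff[of s P] by (metis l_one one_closed)

text \<open>For homogeneous \<open>x\<close> the power \<open>x\<^sup>N\<close>, with \<open>N\<close> the order of \<open>\<Gamma>\<close>, has degree one and therefore equals its own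
  trace \<open>T(x\<^sup>N\<^sup>-\<^sup>1 x)\<close>, which is in \<open>P\<close> if \<open>x\<close> is in the trace ideal.\<close>

lemma trace_ideal_subset_radical:
  assumes P: "ideal P R" shows "trace_ideal S T P \<subseteq> radical S (Idl (\<theta> ` P))"
proof
  fix s assume s: "s \<in> trace_ideal S T P"
  then have sS: "s \<in> carrier S" by (simp add: mem_trace_ideal_iff)
  have PR: "P \<subseteq> carrier R" using ideal.Icarr[OF P] by blast
  then have sub: "\<theta> ` P \<subseteq> carrier S" by auto
  have I: "ideal (Idl (\<theta> ` P)) S" by (rule genideal_ideal[OF sub])
  have "pr \<gamma> s \<in> radical S (Idl (\<theta> ` P))" if g: "\<gamma> \<in> carrier \<Gamma>" for \<gamma>
  proof -
    let ?x = "pr \<gamma> s"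
    have x: "?x \<in> carrier S" "homogeneous \<gamma> ?x" using sS g by auto
    have e: "?x [^] order \<Gamma> = ?x [^] (order \<Gamma> - 1) \<otimes> ?x"
      using inverse_pow_order_minus_one(3)[OF g] x nat_pow_Suc[of ?x "order \<Gamma> - 1"] by simp
    have "T (?x [^] order \<Gamma>) \<in> P"
      using pr_mem_trace_ideal[OF s g] x unfolding e by (simp add: mem_trace_ideal_iff)
    moreover have "\<theta> (T (?x [^] order \<Gamma>)) = ?x [^] order \<Gamma>"
      using homogeneous_pow[OF x(2), of "order \<Gamma>"] inverse_pow_order_minus_one(2)[OF g]
      by (intro homogeneous_one_degree) simp
    ultimately have "?x [^] order \<Gamma> \<in> Idl (\<theta> ` P)" using genideal_self[OF sub] by force
    then show ?thesis using x by (auto simp: radical_def)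
  qed
  then have "(\<Oplus>\<gamma>\<in>carrier \<Gamma>. pr \<gamma> s) \<in> radical S (Idl (\<theta> ` P))" by (intro radical_finsum[OF I]) auto
  then show "s \<in> radical S (Idl (\<theta> ` P))" using sS by (simp add: pr_sum)
qed

lemma trace_ideal_subset_prime:
  assumes P: "ideal P R" and Q: "primeideal Q S" "\<theta> ` P \<subseteq> Q"
  shows "trace_ideal S T P \<subseteq> Q"
proof
  fix s assume "s \<in> trace_ideal S T P"
  then obtain n where n: "s \<in> carrier S" "s [^] (n::nat) \<in> Idl (\<theta> ` P)"
    using trace_ideal_subset_radical[OF P] by (auto simp: radical_def)
  have "Idl (\<theta> ` P) \<subseteq> Q" by (rule genideal_minimal[OF primeideal.axioms(1)[OF Q(1)] Q(2)])
  then show "s \<in> Q" using primeideal.pow_mem_imp_mem[OF Q(1) n(1)] n(2) by blast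
qed

lemma primes_over_iff:
  "Q \<in> primes_over R S \<theta> P \<longleftrightarrow> primeideal Q S \<and> {r \<in> carrier R. \<theta> r \<in> Q} = P"
  by (simp add: primes_over_def spec_def contraction_def)

lemma primeideal_contraction:
  assumes "primeideal Q S" shows "primeideal (contraction R \<theta> Q) R"
proof -
  interpret Q: primeideal Q S by fact
  show ?thesis
  proof (rule primeidealI)
    show "ideal (contraction R \<theta> Q) R"
      using \<theta>.ideal_vimage[OF Q.is_ideal] by (simp add: contraction_def)
    show "carrier R \<noteq> contraction R \<theta> Q"
      using Q.one_imp_carrier Q.I_notcarr R.one_closed unfolding contraction_def by force
    show "a \<in> contraction R \<theta> Q \<or> b \<in> contraction R \<theta> Q"
      if "a \<in> carrier R" "b \<in> carrier R" "a \<otimes>\<^bsub>R\<^esub> b \<in> contraction R \<theta> Q" for a b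
      using that Q.I_prime[of "\<theta> a" "\<theta> b"] by (auto simp: contraction_def)
  qed (rule R.is_cring)
qed

text \<open>As \<open>T\<close> is a retraction of \<open>\<theta>\<close>, the trace ideal of \<open>P\<close> meets \<open>R\<close> in \<open>P\<close> only, and a prime containing it
  and avoiding \<open>R - P\<close> contracts to \<open>P\<close>.\<close>

lemma primes_over_nonempty:
  assumes P: "primeideal P R" shows "primes_over R S \<theta> P \<noteq> {}"
proof -
  interpret P: primeideal P R by fact
  let ?M = "\<theta> ` (carrier R - P)"
  have disj: "trace_ideal S T P \<inter> ?M = {}"
  proof -
    have "r \<in> P" if "r \<in> carrier R" "\<theta> r \<in> trace_ideal S T P" for r
      using T_mem_if_mem_trace_ideal[OF that(2)] that(1) by simp
    then show ?thesis by blast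
  qed
  have "\<one>\<^bsub>R\<^esub> \<in> carrier R - P" using P.one_imp_carrier P.I_notcarr by auto
  then have one: "\<one> \<in> ?M" using \<theta>.hom_one by (metis image_eqI)
  have mult: "x \<otimes> y \<in> ?M" if xy: "x \<in> ?M" "y \<in> ?M" for x y
  proof -
    obtain a b where ab: "x = \<theta> a" "a \<in> carrier R - P" "y = \<theta> b" "b \<in> carrier R - P" using xy by blast
    then have "a \<otimes>\<^bsub>R\<^esub> b \<in> carrier R - P" using P.I_prime by auto
    then have "\<theta> (a \<otimes>\<^bsub>R\<^esub> b) \<in> ?M" by blast
    then show ?thesis using ab by simp
  qed
  have "?M \<subseteq> carrier S" by auto
  then obtain Q where Q: "primeideal Q S" "trace_ideal S T P \<subseteq> Q" "Q \<inter> ?M = {}"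
    using exists_prime_avoiding[OF ideal_trace_ideal[OF P.is_ideal] one _ mult disj] by blast
  have "{r \<in> carrier R. \<theta> r \<in> Q} = P"
  proof (intro equalityI subsetI)
    fix r assume "r \<in> P"
    then show "r \<in> {r \<in> carrier R. \<theta> r \<in> Q}"
      using \<theta>_mem_trace_ideal[OF P.is_ideal] Q(2) P.Icarr by blast
  qed (use Q(3) in blast)
  then show ?thesis using Q(1) primes_over_iff by blast
qed

text \<open>One functional \<open>T(t\<^sub>\<gamma> w)\<close> for each degree suffices to detect the trace ideal of a prime. If some
  \<open>s\<close> of degree \<open>\<gamma>\<close> has \<open>T(s t\<^sub>\<gamma>) \<notin> P\<close>, then \<open>(w z) (s t\<^sub>\<gamma>) = (w t\<^sub>\<gamma>) (s z)\<close> in degree one shows that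
  \<open>T(w t\<^sub>\<gamma>) \<in> P\<close> forces \<open>T(w z) \<in> P\<close> for every \<open>z\<close> of the inverse degree; if there is no such \<open>s\<close> for
  any choice of \<open>t\<^sub>\<gamma>\<close>, all of degree \<open>\<gamma>\<close> is in the trace ideal.\<close>

lemma exists_functionals:
  assumes P: "primeideal P R"
  shows "\<exists>t. (\<forall>\<gamma>\<in>carrier \<Gamma>. t \<gamma> \<in> carrier S) \<and>
    (\<forall>w\<in>carrier S. (\<forall>\<gamma>\<in>carrier \<Gamma>. T (t \<gamma> \<otimes> w) \<in> P) \<longrightarrow> w \<in> trace_ideal S T P)"
proof -
  interpret P: primeideal P R by fact
  interpret I: ideal "trace_ideal S T P" S by (rule ideal_trace_ideal[OF P.is_ideal])
  let ?good = "\<lambda>\<gamma> t. homogeneous (inv\<^bsub>\<Gamma>\<^esub> \<gamma>) t \<and> (\<exists>s. homogeneous \<gamma> s \<and> T (s \<otimes> t) \<notin> P)"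
  \<comment> \<open>the default \<open>0\<close> is taken in degrees that lie entirely in the trace ideal\<close>
  define t where "t \<gamma> = (if \<exists>t. ?good \<gamma> t then SOME t. ?good \<gamma> t else \<zero>)" for \<gamma>
  have good: "?good \<gamma> (t \<gamma>)" if "\<exists>t. ?good \<gamma> t" for \<gamma>
    using someI_ex[OF that] that by (simp add: t_def)
  have t: "t \<gamma> \<in> carrier S" for \<gamma>
    using good[of \<gamma>] by (cases "\<exists>t. ?good \<gamma> t") (auto simp: homogeneous_def t_def)
  have "w \<in> trace_ideal S T P" if w: "w \<in> carrier S" "\<forall>\<gamma>\<in>carrier \<Gamma>. T (t \<gamma> \<otimes> w) \<in> P" for w
  proof -
    have "pr \<gamma> w \<in> trace_ideal S T P" if g: "\<gamma> \<in> carrier \<Gamma>" for \<gamma>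
      unfolding mem_trace_ideal_iff
    proof (intro conjI ballI)
      show wS: "pr \<gamma> w \<in> carrier S" using w g by simp
      fix z assume z: "z \<in> carrier S"
      let ?z = "pr (inv\<^bsub>\<Gamma>\<^esub> \<gamma>) z"
      have zS: "?z \<in> carrier S" "homogeneous (inv\<^bsub>\<Gamma>\<^esub> \<gamma>) ?z" "homogeneous \<gamma> (pr \<gamma> w)"
        using g z w by auto
      have zw: "T (z \<otimes> pr \<gamma> w) = T (pr \<gamma> w \<otimes> ?z)"
        using T_mult_homogeneous[of \<gamma> "pr \<gamma> w" z] g z w by (simp add: m_comm)
      show "T (z \<otimes> pr \<gamma> w) \<in> P"
      proof (rule ccontr)
        assume neg: "T (z \<otimes> pr \<gamma> w) \<notin> P"
        then have "\<exists>t. ?good \<gamma> t" using zw zS by auto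
        then obtain s where s: "homogeneous \<gamma> s" "T (s \<otimes> t \<gamma>) \<notin> P" "homogeneous (inv\<^bsub>\<Gamma>\<^esub> \<gamma>) (t \<gamma>)"
          using good by blast
        have sS: "s \<in> carrier S" using s homogeneousD by blast
        have d1: "\<theta> (T (a \<otimes> b)) = a \<otimes> b" if "homogeneous \<gamma> a" "homogeneous (inv\<^bsub>\<Gamma>\<^esub> \<gamma>) b" for a b
          using homogeneous_mult[OF that] g by (intro homogeneous_one_degree) simp
        have c: "T (pr \<gamma> w \<otimes> ?z) \<in> carrier R" "T (s \<otimes> t \<gamma>) \<in> carrier R" "T (s \<otimes> ?z) \<in> carrier R"
          "T (pr \<gamma> w \<otimes> t \<gamma>) \<in> carrier R"
          using wS zS sS t by auto
        have "\<theta> (T (pr \<gamma> w \<otimes> ?z) \<otimes>\<^bsub>R\<^esub> T (s \<otimes> t \<gamma>)) = (pr \<gamma> w \<otimes> ?z) \<otimes> (s \<otimes> t \<gamma>)"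
          using d1[OF zS(3,2)] d1[OF s(1,3)] c by simp
        also have "\<dots> = (pr \<gamma> w \<otimes> t \<gamma>) \<otimes> (s \<otimes> ?z)" using wS zS sS t[of \<gamma>] by (simp add: m_ac)
        also have "\<dots> = \<theta> (T (pr \<gamma> w \<otimes> t \<gamma>) \<otimes>\<^bsub>R\<^esub> T (s \<otimes> ?z))"
          using d1[OF zS(3) s(3)] d1[OF s(1) zS(2)] c by simp
        finally have eq: "T (pr \<gamma> w \<otimes> ?z) \<otimes>\<^bsub>R\<^esub> T (s \<otimes> t \<gamma>) = T (pr \<gamma> w \<otimes> t \<gamma>) \<otimes>\<^bsub>R\<^esub> T (s \<otimes> ?z)"
          using c T_\<theta> R.m_closed by metis
        have "T (pr \<gamma> w \<otimes> t \<gamma>) = T (t \<gamma> \<otimes> w)"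
          using T_mult_homogeneous[OF s(3) w(1)] g t[of \<gamma>] w(1) by (simp add: m_comm)
        then have "T (pr \<gamma> w \<otimes> t \<gamma>) \<in> P" using w g by simp
        then have "T (pr \<gamma> w \<otimes> ?z) \<otimes>\<^bsub>R\<^esub> T (s \<otimes> t \<gamma>) \<in> P" unfolding eq using c P.I_r_closed by blast
        then show False using P.I_prime[OF c(1,2)] s(2) neg zw by auto
      qed
    qed
    then have "(\<Oplus>\<gamma>\<in>carrier \<Gamma>. pr \<gamma> w) \<in> trace_ideal S T P" by (rule I.finsum_in_ideal)
    then show ?thesis using w by (simp add: pr_sum)
  qed
  then show ?thesis using t by blast
qed

text \<open>Of the powers of \<open>y\<close>, the first \<open>N + 1\<close> (\<open>N\<close> the order of \<open>\<Gamma>\<close>) are linearly dependent modulo the trace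
  ideal, as \<open>N\<close> functionals detect it. Drop the initial terms of the relation whose coefficients are
  in \<open>P\<close> and split off a power of \<open>y\<close>: the remaining factor \<open>x\<close> has a constant term outside \<open>P\<close>, hence
  is not in \<open>Q\<close>.\<close>

lemma exists_annihilator_mod_trace_ideal:
  assumes P: "primeideal P R" and Q: "Q \<in> primes_over R S \<theta> P" and y: "y \<in> Q"
    and rad: "\<And>x n. x \<in> carrier S \<Longrightarrow> x [^] (n::nat) \<in> trace_ideal S T P \<Longrightarrow> x \<in> trace_ideal S T P"
  shows "\<exists>x\<in>carrier S. x \<notin> Q \<and> x \<otimes> y \<in> trace_ideal S T P"
proof -
  interpret P: primeideal P R by fact
  interpret I: ideal "trace_ideal S T P" S by (rule ideal_trace_ideal[OF P.is_ideal])
  interpret Q: primeideal Q S using Q primes_over_iff by blast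
  have yS [simp]: "y \<in> carrier S" using y Q.Icarr by blast
  obtain t where t: "\<And>\<gamma>. \<gamma> \<in> carrier \<Gamma> \<Longrightarrow> t \<gamma> \<in> carrier S"
    and detect: "\<And>w. w \<in> carrier S \<Longrightarrow> (\<And>\<gamma>. \<gamma> \<in> carrier \<Gamma> \<Longrightarrow> T (t \<gamma> \<otimes> w) \<in> P) \<Longrightarrow> w \<in> trace_ideal S T P"
    using exists_functionals[OF P] by blast
  let ?N = "card (carrier \<Gamma>)"
  have "\<exists>c. (\<forall>j\<in>{..?N}. c j \<in> carrier R) \<and> (\<exists>j\<in>{..?N}. c j \<notin> P) \<and>
      (\<forall>\<gamma>\<in>carrier \<Gamma>. (\<Oplus>\<^bsub>R\<^esub>j\<in>{..?N}. c j \<otimes>\<^bsub>R\<^esub> T (t \<gamma> \<otimes> y [^] j)) \<in> P)"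
    by (rule P.exists_linear_dependence) (use t in auto)
  then obtain c where c: "\<And>j. j \<in> {..?N} \<Longrightarrow> c j \<in> carrier R" and nz: "\<exists>j. j \<in> {..?N} \<and> c j \<notin> P"
    and rel: "\<And>\<gamma>. \<gamma> \<in> carrier \<Gamma> \<Longrightarrow> (\<Oplus>\<^bsub>R\<^esub>j\<in>{..?N}. c j \<otimes>\<^bsub>R\<^esub> T (t \<gamma> \<otimes> y [^] j)) \<in> P" by blast
  define m where "m = (LEAST j. j \<in> {..?N} \<and> c j \<notin> P)"
  have m: "m \<in> {..?N}" "c m \<notin> P" using LeastI_ex[OF nz] by (auto simp: m_def)
  have below: "c j \<in> P" if "j < m" for j
    using not_less_Least[of j "\<lambda>j. j \<in> {..?N} \<and> c j \<notin> P"] that m(1) by (auto simp: m_def)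
  let ?term = "\<lambda>j. \<theta> (c j) \<otimes> y [^] j"
  have sc [simp]: "?term j \<in> carrier S" if "j \<le> ?N" for j using c that by simp
  let ?w = "\<Oplus>j\<in>{..?N}. ?term j"
  have w: "?w \<in> trace_ideal S T P"
  proof (rule detect)
    show "?w \<in> carrier S" by (rule finsum_closed) auto
    fix \<gamma> assume g: "\<gamma> \<in> carrier \<Gamma>"
    have "t \<gamma> \<otimes> ?w = (\<Oplus>j\<in>{..?N}. t \<gamma> \<otimes> ?term j)" using t[OF g] by (intro finsum_rdistr) auto
    moreover have "T (\<Oplus>j\<in>{..?N}. t \<gamma> \<otimes> ?term j) = (\<Oplus>\<^bsub>R\<^esub>j\<in>{..?N}. T (t \<gamma> \<otimes> ?term j))"
      by (rule T_finsum) (use t[OF g] c in auto)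
    ultimately have "T (t \<gamma> \<otimes> ?w) = (\<Oplus>\<^bsub>R\<^esub>j\<in>{..?N}. T (t \<gamma> \<otimes> ?term j))" by simp
    also have "\<dots> = (\<Oplus>\<^bsub>R\<^esub>j\<in>{..?N}. c j \<otimes>\<^bsub>R\<^esub> T (t \<gamma> \<otimes> y [^] j))"
    proof (rule R.add.finprod_cong')
      fix j assume j: "j \<in> {..?N}"
      have "t \<gamma> \<otimes> ?term j = \<theta> (c j) \<otimes> (t \<gamma> \<otimes> y [^] j)" using t[OF g] c[OF j] by (simp add: m_ac)
      then show "T (t \<gamma> \<otimes> ?term j) = c j \<otimes>\<^bsub>R\<^esub> T (t \<gamma> \<otimes> y [^] j)"
        using t[OF g] c[OF j] by (simp add: T_linear)
    qed (use c t g in auto)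
    finally show "T (t \<gamma> \<otimes> ?w) \<in> P" using rel[OF g] by simp
  qed
  let ?hi = "\<Oplus>j\<in>{m..?N}. ?term j" and ?lo = "\<Oplus>j\<in>{..<m}. ?term j"
  have split: "{..?N} = {..<m} \<union> {m..?N}" using m(1) by auto
  have cl: "?lo \<in> carrier S" "?hi \<in> carrier S" using m(1) by (auto intro!: finsum_closed)
  have "?w = ?lo \<oplus> ?hi" unfolding split using m(1) by (intro finsum_Un_disjoint) auto
  moreover have lo: "?lo \<in> trace_ideal S T P"
  proof (rule I.finsum_in_ideal)
    fix j assume "j \<in> {..<m}"
    then show "?term j \<in> trace_ideal S T P"
      using below \<theta>_mem_trace_ideal[OF P.is_ideal] I.I_r_closed by auto
  qed
  ultimately have "(\<ominus> ?lo) \<oplus> (?lo \<oplus> ?hi) \<in> trace_ideal S T P"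
    using w I.a_inv_closed I.a_closed by metis
  then have hi: "?hi \<in> trace_ideal S T P" using cl by (simp add: r_neg1)
  define x where "x = (\<Oplus>j\<in>{m..?N}. \<theta> (c j) \<otimes> y [^] (j - m))"
  define x' where "x' = (\<Oplus>j\<in>{Suc m..?N}. \<theta> (c j) \<otimes> y [^] (j - Suc m))"
  have xS: "x \<in> carrier S" "x' \<in> carrier S" using c by (auto simp: x_def x'_def intro!: finsum_closed)
  have hi_eq: "?hi = y [^] m \<otimes> x"
  proof -
    have "y [^] m \<otimes> x = (\<Oplus>j\<in>{m..?N}. y [^] m \<otimes> (\<theta> (c j) \<otimes> y [^] (j - m)))"
      unfolding x_def using c by (intro finsum_rdistr) auto
    also have "\<dots> = ?hi"
    proof (rule add.finprod_cong')
      fix j assume j: "j \<in> {m..?N}"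
      have "y [^] j = y [^] m \<otimes> y [^] (j - m)" using j by (simp add: nat_pow_mult)
      then show "y [^] m \<otimes> (\<theta> (c j) \<otimes> y [^] (j - m)) = ?term j" using c j by (simp add: m_ac)
    qed (use c in auto)
    finally show ?thesis by simp
  qed
  have x_eq: "x = \<theta> (c m) \<oplus> y \<otimes> x'"
  proof -
    have ins: "{m..?N} = insert m {Suc m..?N}" using m(1) by auto
    have "x = \<theta> (c m) \<oplus> (\<Oplus>j\<in>{Suc m..?N}. \<theta> (c j) \<otimes> y [^] (j - m))"
      unfolding x_def ins using c m(1) by (subst finsum_insert) auto
    also have "(\<Oplus>j\<in>{Suc m..?N}. \<theta> (c j) \<otimes> y [^] (j - m)) = (\<Oplus>j\<in>{Suc m..?N}. y \<otimes> (\<theta> (c j) \<otimes> y [^] (j - Suc m)))"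
    proof (rule add.finprod_cong')
      fix j assume j: "j \<in> {Suc m..?N}"
      then have "y [^] (j - m) = y [^] (j - Suc m) \<otimes> y"
        using nat_pow_Suc[of y "j - Suc m"] by (simp add: Suc_diff_Suc)
      then show "\<theta> (c j) \<otimes> y [^] (j - m) = y \<otimes> (\<theta> (c j) \<otimes> y [^] (j - Suc m))"
        using c j by (simp add: m_ac)
    qed (use c in auto)
    also have "\<dots> = y \<otimes> x'" unfolding x'_def using c by (intro finsum_rdistr[symmetric]) auto
    finally show ?thesis .
  qed
  have "x \<notin> Q"
  proof
    assume xQ: "x \<in> Q"
    have yx: "y \<otimes> x' \<in> Q" using y xS Q.I_r_closed by blast
    have "\<theta> (c m) = x \<ominus> y \<otimes> x'" using xS c m(1) by (simp add: x_eq minus_eq a_assoc r_neg)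
    then have "\<theta> (c m) \<in> Q" using xQ yx unfolding minus_eq by simp
    then have "c m \<in> P" using Q c m(1) by (auto simp: primes_over_iff)
    then show False using m(2) by blast
  qed
  moreover have "x \<otimes> y \<in> trace_ideal S T P"
  proof (rule rad)
    have "(x \<otimes> y) [^] Suc m = (x [^] m \<otimes> y) \<otimes> ?hi"
      unfolding hi_eq using xS by (simp add: nat_pow_distrib m_ac)
    then show "(x \<otimes> y) [^] Suc m \<in> trace_ideal S T P" using hi xS I.I_l_closed by simp
  qed (use xS in simp)
  ultimately show ?thesis using xS by blast
qed

subsection \<open>Transposition and degrees\<close>

lemma frob_linearD:
  assumes "frob_linear S k f"
  shows "s \<in> carrier S \<Longrightarrow> f s \<in> carrier S"
    and "s \<in> carrier S \<Longrightarrow> t \<in> carrier S \<Longrightarrow> f (s \<oplus> t) = f s \<oplus> f t"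
    and "s \<in> carrier S \<Longrightarrow> t \<in> carrier S \<Longrightarrow> f (t [^] k \<otimes> s) = t \<otimes> f s"
    and "f \<zero> = \<zero>"
proof -
  show c: "f s \<in> carrier S" if "s \<in> carrier S" for s using assms that by (auto simp: frob_linear_def)
  show a: "f (s \<oplus> t) = f s \<oplus> f t" if "s \<in> carrier S" "t \<in> carrier S" for s t
    using assms that by (auto simp: frob_linear_def)
  show "f (t [^] k \<otimes> s) = t \<otimes> f s" if "s \<in> carrier S" "t \<in> carrier S" for s t
    using assms that by (auto simp: frob_linear_def)
  show "f \<zero> = \<zero>" using a[of \<zero> \<zero>] c[of \<zero>] by (simp add: add.l_cancel_one)
qed

lemma frob_linear_finsum:
  assumes f: "frob_linear S k f" and "\<And>i. i \<in> I \<Longrightarrow> g i \<in> carrier S"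
  shows "f (finsum S g I) = (\<Oplus>i\<in>I. f (g i))"
  using assms(2)
proof (induction I rule: infinite_finite_induct)
  case (insert i I)
  then have "g \<in> I \<rightarrow> carrier S" "(\<lambda>i. f (g i)) \<in> I \<rightarrow> carrier S" using frob_linearD(1)[OF f] by auto
  then show ?case using insert frob_linearD[OF f] by (simp add: finsum_closed)
qed (use frob_linearD(4)[OF f] in auto)

text \<open>A component \<open>x\<close> of \<open>f (pr \<gamma> s)\<close> in a degree \<open>\<epsilon>\<close> with \<open>\<epsilon>\<^sup>k \<noteq> \<gamma>\<close> vanishes: pairing it with \<open>x\<^sup>N\<^sup>-\<^sup>1\<close>,
  which has degree inverse to \<open>\<epsilon>\<close>, expresses \<open>T(x\<^sup>N)\<close> as \<open>g\<close> of the trace of an element of degree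
  \<open>\<epsilon>\<^sup>-\<^sup>k \<gamma> \<noteq> 1\<close>, so \<open>x\<^sup>N = 0\<close>.\<close>

lemma pr_transpose:
  assumes f: "frob_linear S k f" and tr: "\<And>s. s \<in> carrier S \<Longrightarrow> T (f s) = g (T s)"
    and e: "\<epsilon> \<in> carrier \<Gamma>" and s: "s \<in> carrier S"
  shows "pr \<epsilon> (f s) = pr \<epsilon> (f (pr (\<epsilon> [^]\<^bsub>\<Gamma>\<^esub> k) s))"
proof -
  note fD = frob_linearD[OF f]
  have g0: "g \<zero>\<^bsub>R\<^esub> = \<zero>\<^bsub>R\<^esub>" using tr[of \<zero>] fD(4) by simp
  have z: "pr \<epsilon> (f (pr \<gamma> s)) = \<zero>" if g: "\<gamma> \<in> carrier \<Gamma>" "\<gamma> \<noteq> \<epsilon> [^]\<^bsub>\<Gamma>\<^esub> k" for \<gamma>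
  proof -
    let ?x = "pr \<epsilon> (f (pr \<gamma> s))" and ?N = "order \<Gamma>"
    have x: "?x \<in> carrier S" "homogeneous \<epsilon> ?x" using fD s g e by auto
    let ?y = "?x [^] (?N - 1)"
    have y: "?y \<in> carrier S" "homogeneous (inv\<^bsub>\<Gamma>\<^esub> \<epsilon>) ?y"
      using x homogeneous_pow[OF x(2), of "?N - 1"] inverse_pow_order_minus_one(1)[OF e] by auto
    have "?x [^] ?N = ?y \<otimes> ?x"
      using inverse_pow_order_minus_one(3)[OF e] x nat_pow_Suc[of ?x "?N - 1"] by simp
    then have "T (?x [^] ?N) = T (?y \<otimes> f (pr \<gamma> s))"
      using T_mult_homogeneous[OF y(2), of "f (pr \<gamma> s)"] fD(1) s g(1) e by simp
    also have "?y \<otimes> f (pr \<gamma> s) = f (?y [^] k \<otimes> pr \<gamma> s)" using fD(3) y s g(1) by simp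
    also have "T \<dots> = g (T (?y [^] k \<otimes> pr \<gamma> s))" using y s g(1) by (intro tr) simp
    also have "T (?y [^] k \<otimes> pr \<gamma> s) = \<zero>\<^bsub>R\<^esub>"
    proof (rule T_homogeneous)
      show "homogeneous ((inv\<^bsub>\<Gamma>\<^esub> \<epsilon>) [^]\<^bsub>\<Gamma>\<^esub> k \<otimes>\<^bsub>\<Gamma>\<^esub> \<gamma>) (?y [^] k \<otimes> pr \<gamma> s)"
        using y s g(1) by (intro homogeneous_mult homogeneous_pow) auto
      show "(inv\<^bsub>\<Gamma>\<^esub> \<epsilon>) [^]\<^bsub>\<Gamma>\<^esub> k \<otimes>\<^bsub>\<Gamma>\<^esub> \<gamma> \<noteq> \<one>\<^bsub>\<Gamma>\<^esub>"
      proof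
        assume "(inv\<^bsub>\<Gamma>\<^esub> \<epsilon>) [^]\<^bsub>\<Gamma>\<^esub> k \<otimes>\<^bsub>\<Gamma>\<^esub> \<gamma> = \<one>\<^bsub>\<Gamma>\<^esub>"
        then have "inv\<^bsub>\<Gamma>\<^esub> (\<epsilon> [^]\<^bsub>\<Gamma>\<^esub> k) \<otimes>\<^bsub>\<Gamma>\<^esub> \<gamma> = \<one>\<^bsub>\<Gamma>\<^esub>" using e by (simp add: G.nat_pow_inv)
        then have "\<gamma> = \<epsilon> [^]\<^bsub>\<Gamma>\<^esub> k"
          using G.inv_unique'[of "inv\<^bsub>\<Gamma>\<^esub> (\<epsilon> [^]\<^bsub>\<Gamma>\<^esub> k)" \<gamma>] e g(1) G.m_comm[of \<gamma>] by simp
        then show False using g(2) by blast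
      qed
    qed
    finally have "T (?x [^] ?N) = \<zero>\<^bsub>R\<^esub>" using g0 by simp
    moreover have "\<theta> (T (?x [^] ?N)) = ?x [^] ?N"
      using homogeneous_pow[OF x(2), of ?N] inverse_pow_order_minus_one(2)[OF e]
      by (intro homogeneous_one_degree) simp
    ultimately have "?x [^] ?N = \<zero>" by simp
    then show ?thesis using homogeneous_reduced[of \<epsilon> "f (pr \<gamma> s)" ?N] e fD(1) s g(1) by simp
  qed
  have "pr \<epsilon> (f s) = pr \<epsilon> (f (\<Oplus>\<gamma>\<in>carrier \<Gamma>. pr \<gamma> s))" using s by (simp add: pr_sum)
  also have "f (\<Oplus>\<gamma>\<in>carrier \<Gamma>. pr \<gamma> s) = (\<Oplus>\<gamma>\<in>carrier \<Gamma>. f (pr \<gamma> s))"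
    using s by (intro frob_linear_finsum[OF f]) auto
  also have "pr \<epsilon> \<dots> = (\<Oplus>\<gamma>\<in>carrier \<Gamma>. pr \<epsilon> (f (pr \<gamma> s)))" using s fD(1) e by (intro pr_finsum) auto
  also have "\<dots> = (\<Oplus>\<gamma>\<in>{\<epsilon> [^]\<^bsub>\<Gamma>\<^esub> k}. pr \<epsilon> (f (pr \<gamma> s)))"
    using z e s fD(1) by (intro add.finprod_mono_neutral_cong_right) auto
  also have "\<dots> = pr \<epsilon> (f (pr (\<epsilon> [^]\<^bsub>\<Gamma>\<^esub> k) s))" using e s fD(1) by simp
  finally show ?thesis .
qed

text \<open>The projection onto the degrees in \<open>H\<close>, written \<open>\<pi>\<^sub>H\<close> in comments.\<close>

definition prs :: "'g set \<Rightarrow> 'b \<Rightarrow> 'b" where "prs H s = (\<Oplus>\<gamma>\<in>H. pr \<gamma> s)"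

lemma prs_closed [simp]: "H \<subseteq> carrier \<Gamma> \<Longrightarrow> s \<in> carrier S \<Longrightarrow> prs H s \<in> carrier S"
  unfolding prs_def by (rule finsum_closed) auto

lemma pr_prs:
  assumes "H \<subseteq> carrier \<Gamma>" "s \<in> carrier S" "\<epsilon> \<in> carrier \<Gamma>"
  shows "pr \<epsilon> (prs H s) = (if \<epsilon> \<in> H then pr \<epsilon> s else \<zero>)"
proof -
  have fH: "finite H" using assms fin finite_subset by blast
  have "pr \<epsilon> (prs H s) = (\<Oplus>\<gamma>\<in>H. pr \<epsilon> (pr \<gamma> s))"
    unfolding prs_def using assms by (intro pr_finsum) auto
  also have "\<dots> = (\<Oplus>\<gamma>\<in>H. if \<epsilon> = \<gamma> then pr \<gamma> s else \<zero>)"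
    using assms by (intro add.finprod_cong') (auto simp: pr_pr subset_iff)
  also have "\<dots> = (if \<epsilon> \<in> H then pr \<epsilon> s else \<zero>)"
  proof (cases "\<epsilon> \<in> H")
    case True
    have "(\<lambda>\<gamma>. pr \<gamma> s) \<in> H \<rightarrow> carrier S" using assms by (auto simp: subset_iff)
    then show ?thesis using add.finprod_singleton[OF True fH] True by simp
  next
    case False
    have "(\<Oplus>\<gamma>\<in>H. if \<epsilon> = \<gamma> then pr \<gamma> s else \<zero>) = (\<Oplus>\<gamma>\<in>H. \<zero>)"
      using False by (intro add.finprod_cong') auto
    then show ?thesis using False by simp
  qed
  finally show ?thesis .
qed

lemma eq_if_pr_eq:
  assumes "s \<in> carrier S" "t \<in> carrier S" "\<And>\<gamma>. \<gamma> \<in> carrier \<Gamma> \<Longrightarrow> pr \<gamma> s = pr \<gamma> t"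
  shows "s = t"
proof -
  have "(\<Oplus>\<gamma>\<in>carrier \<Gamma>. pr \<gamma> s) = (\<Oplus>\<gamma>\<in>carrier \<Gamma>. pr \<gamma> t)"
    using assms by (intro add.finprod_cong') auto
  then show ?thesis using assms by (simp add: pr_sum)
qed

text \<open>The projection onto the subring \<open>S\<^sub>H\<close> of a subgroup \<open>H\<close> is \<open>S\<^sub>H\<close>-linear: components outside \<open>H\<close> stay outside
  when multiplied by elements of \<open>S\<^sub>H\<close>.\<close>

lemma pr_mult_prs:
  assumes H: "subgroup H \<Gamma>" and s: "s \<in> carrier S" "t \<in> carrier S" and e: "\<epsilon> \<in> H"
  shows "pr \<epsilon> (s \<otimes> prs H t) = pr \<epsilon> (prs H s \<otimes> prs H t)"
    and "pr \<epsilon> (prs H s \<otimes> t) = pr \<epsilon> (prs H s \<otimes> prs H t)"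
proof -
  interpret H: subgroup H \<Gamma> by fact
  have HG: "H \<subseteq> carrier \<Gamma>" by (rule H.subset)
  have eG: "\<epsilon> \<in> carrier \<Gamma>" using e HG by blast
  have fH: "finite H" using HG fin finite_subset by blast
  have main: "pr \<epsilon> (a \<otimes> prs H b) = pr \<epsilon> (prs H a \<otimes> prs H b)"
    if a: "a \<in> carrier S" "b \<in> carrier S" for a b
  proof -
    have vanish: "pr \<epsilon> (pr \<gamma> a \<otimes> prs H b) = \<zero>" if g: "\<gamma> \<in> carrier \<Gamma> - H" for \<gamma>
    proof -
      have "pr \<gamma> a \<otimes> prs H b = (\<Oplus>\<delta>\<in>H. pr \<gamma> a \<otimes> pr \<delta> b)"
        unfolding prs_def using a g HG fH by (intro finsum_rdistr) auto
      then have "pr \<epsilon> (pr \<gamma> a \<otimes> prs H b) = (\<Oplus>\<delta>\<in>H. pr \<epsilon> (pr \<gamma> a \<otimes> pr \<delta> b))"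
        using a g eG HG by (simp add: pr_finsum subset_iff)
      also have "\<dots> = (\<Oplus>\<delta>\<in>H. \<zero>)"
      proof (rule add.finprod_cong')
        fix \<delta> assume d: "\<delta> \<in> H"
        then have dG: "\<delta> \<in> carrier \<Gamma>" using HG by blast
        have "\<epsilon> \<noteq> \<gamma> \<otimes>\<^bsub>\<Gamma>\<^esub> \<delta>"
        proof
          assume "\<epsilon> = \<gamma> \<otimes>\<^bsub>\<Gamma>\<^esub> \<delta>"
          then have "\<gamma> = \<epsilon> \<otimes>\<^bsub>\<Gamma>\<^esub> inv\<^bsub>\<Gamma>\<^esub> \<delta>" using g dG by (simp add: G.m_assoc)
          then have "\<gamma> \<in> H" using e d by simp
          then show False using g by blast
        qed
        then show "pr \<epsilon> (pr \<gamma> a \<otimes> pr \<delta> b) = \<zero>"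
          using pr_homogeneous[OF homogeneous_mult[of \<gamma> "pr \<gamma> a" \<delta> "pr \<delta> b"] eG] a g dG by simp
      qed auto
      finally show ?thesis by simp
    qed
    have "a \<otimes> prs H b = (\<Oplus>\<gamma>\<in>carrier \<Gamma>. pr \<gamma> a) \<otimes> prs H b" using a by (simp add: pr_sum)
    also have "\<dots> = (\<Oplus>\<gamma>\<in>carrier \<Gamma>. pr \<gamma> a \<otimes> prs H b)" using a HG by (intro finsum_ldistr) auto
    finally have "pr \<epsilon> (a \<otimes> prs H b) = (\<Oplus>\<gamma>\<in>carrier \<Gamma>. pr \<epsilon> (pr \<gamma> a \<otimes> prs H b))"
      using a HG eG by (simp add: pr_finsum)
    also have "\<dots> = (\<Oplus>\<gamma>\<in>H. pr \<epsilon> (pr \<gamma> a \<otimes> prs H b))"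
      using vanish a HG eG by (intro add.finprod_mono_neutral_cong_right) auto
    also have "\<dots> = pr \<epsilon> (\<Oplus>\<gamma>\<in>H. pr \<gamma> a \<otimes> prs H b)"
      using a HG eG by (intro pr_finsum[symmetric]) auto
    also have "(\<Oplus>\<gamma>\<in>H. pr \<gamma> a \<otimes> prs H b) = prs H a \<otimes> prs H b"
      unfolding prs_def[of H a] using a HG fH by (intro finsum_ldistr[symmetric]) auto
    finally show ?thesis .
  qed
  show "pr \<epsilon> (s \<otimes> prs H t) = pr \<epsilon> (prs H s \<otimes> prs H t)" by (rule main[OF s])
  show "pr \<epsilon> (prs H s \<otimes> t) = pr \<epsilon> (prs H s \<otimes> prs H t)"
    using main[OF s(2,1)] s HG by (simp add: m_comm)
qed

text \<open>A transpose \<open>f\<close> only sees the components in the subgroup \<open>H\<close> of \<open>k\<close>-th powers, so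
  \<open>f(\<pi>\<^sub>H(x) s) = f(x \<pi>\<^sub>H(s))\<close> lies in \<open>Q\<close> for every \<open>s\<close>. Taking \<open>s = \<pi>\<^sub>H(x)\<^sup>k\<^sup>-\<^sup>1 c\<close> gives \<open>\<pi>\<^sub>H(x)\<close> itself.\<close>

lemma prs_pow_image_mem_prime:
  assumes f: "frob_linear S k f" and k: "1 \<le> k" and tr: "\<And>s. s \<in> carrier S \<Longrightarrow> T (f s) = g (T s)"
    and c: "c \<in> carrier S" "f c = \<one>" and Q: "primeideal Q S" "f ` Q \<subseteq> Q"
    and H: "H = (\<lambda>\<gamma>. \<gamma> [^]\<^bsub>\<Gamma>\<^esub> k) ` carrier \<Gamma>" and x: "x \<in> Q"
  shows "prs H x \<in> Q"
proof -
  interpret Q: primeideal Q S by fact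
  have xS: "x \<in> carrier S" using x Q.Icarr by blast
  have "(\<lambda>\<gamma>. \<gamma> [^]\<^bsub>\<Gamma>\<^esub> k) \<in> hom \<Gamma> \<Gamma>" by (rule homI) (auto simp: G.pow_mult_distrib G.m_comm)
  then have sub: "subgroup H \<Gamma>" unfolding H
    using group_hom.img_is_subgroup[of \<Gamma> \<Gamma>] by (simp add: group_hom_def group_hom_axioms_def G.is_group)
  then have HG: "H \<subseteq> carrier \<Gamma>" by (rule subgroup.subset)
  have eq: "f a = f b" if ab: "a \<in> carrier S" "b \<in> carrier S" "\<And>\<epsilon>. \<epsilon> \<in> H \<Longrightarrow> pr \<epsilon> a = pr \<epsilon> b" for a b
  proof (rule eq_if_pr_eq)
    fix \<epsilon> assume e: "\<epsilon> \<in> carrier \<Gamma>"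
    then have "pr (\<epsilon> [^]\<^bsub>\<Gamma>\<^esub> k) a = pr (\<epsilon> [^]\<^bsub>\<Gamma>\<^esub> k) b" using ab(3) H by blast
    then show "pr \<epsilon> (f a) = pr \<epsilon> (f b)" using pr_transpose[OF f tr e] ab by metis
  qed (use ab frob_linearD(1)[OF f] in auto)
  have "f (prs H x \<otimes> s) \<in> Q" if s: "s \<in> carrier S" for s
  proof -
    have "f (prs H x \<otimes> s) = f (x \<otimes> prs H s)"
      using pr_mult_prs[OF sub xS s] xS s HG by (intro eq) auto
    moreover have "x \<otimes> prs H s \<in> Q" using x s HG Q.I_r_closed by simp
    ultimately show ?thesis using Q(2) by auto
  qed
  moreover have "f (prs H x \<otimes> (prs H x [^] (k - 1) \<otimes> c)) = prs H x"
  proof -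
    have "prs H x \<otimes> (prs H x [^] (k - 1) \<otimes> c) = prs H x [^] k \<otimes> c"
      using xS HG c k nat_pow_Suc2[of "prs H x" "k - 1"] by (simp add: m_assoc)
    then show ?thesis using frob_linearD(3)[OF f c(1), of "prs H x"] xS HG c by simp
  qed
  ultimately show ?thesis using xS HG c by (metis m_closed nat_pow_closed prs_closed)
qed

end

section \<open>The transpose of a surjective Frobenius-linear map\<close>

lemma openin_schpec_space:
  "openin (schpec_space A q f) U \<longleftrightarrow> (\<exists>E\<subseteq>carrier A. U = {P \<in> Schpec A q f. \<not> E \<subseteq> P})"
proof -
  have sub: "Schpec A q f \<subseteq> spec A" by (auto simp: Schpec_def CSpec_def)
  have o: "openin (zariski A) V \<longleftrightarrow> (\<exists>E\<subseteq>carrier A. V = {P \<in> spec A. \<not> E \<subseteq> P})" for V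
    unfolding zariski_def topology_inverse'[OF istopology_zariski] ..
  have "{P \<in> spec A. \<not> E \<subseteq> P} \<inter> Schpec A q f = {P \<in> Schpec A q f. \<not> E \<subseteq> P}" for E using sub by blast
  then show ?thesis unfolding schpec_space_def openin_subtopology o by metis
qed

lemma topspace_schpec_space:
  assumes "cring A" shows "topspace (schpec_space A q f) = Schpec A q f"
proof
  show "topspace (schpec_space A q f) \<subseteq> Schpec A q f"
    using openin_topspace[of "schpec_space A q f"] unfolding openin_schpec_space by blast
  have "\<not> carrier A \<subseteq> P" if "P \<in> Schpec A q f" for P
  proof -
    interpret primeideal P A using that by (simp add: Schpec_def CSpec_def spec_def)
    show ?thesis using I_notcarr a_subset by blast
  qed
  then have "openin (schpec_space A q f) (Schpec A q f)" unfolding openin_schpec_space by blast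
  then show "Schpec A q f \<subseteq> topspace (schpec_space A q f)" by (rule openin_subset)
qed

text \<open>The element \<open>c\<close> witnesses that \<open>\<phi>\<close> is surjective. The last assumption is the form in which nontrivial
  degrees are known to be non-principal.\<close>

locale graded_transposition = graded_algebra +
  fixes p e :: nat and \<phi> :: "'c \<Rightarrow> 'c" and \<psi> :: "'a \<Rightarrow> 'a" and c :: 'c and \<mm> :: "'c set"
  assumes prime_p: "Factorial_Ring.prime p" and char_R: "[p] \<cdot>\<^bsub>R\<^esub> \<one>\<^bsub>R\<^esub> = \<zero>\<^bsub>R\<^esub>" and e: "1 \<le> e"
    and \<phi>: "frob_linear R (p ^ e) \<phi>" and \<psi>: "frob_linear S (p ^ e) \<psi>"
    and transpose: "s \<in> carrier S \<Longrightarrow> T (\<psi> s) = \<phi> (T s)"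
    and c: "c \<in> carrier R" "\<phi> c = \<one>\<^bsub>R\<^esub>"
    and \<mm>: "ideal \<mm> R" "\<one>\<^bsub>R\<^esub> \<notin> \<mm>" and Units_R: "r \<in> carrier R \<Longrightarrow> r \<notin> \<mm> \<Longrightarrow> r \<in> Units R"
    and T_mult_mem_\<mm>: "homogeneous \<gamma> s \<Longrightarrow> homogeneous (inv\<^bsub>\<Gamma>\<^esub> \<gamma>) t \<Longrightarrow> \<gamma> \<noteq> \<one>\<^bsub>\<Gamma>\<^esub> \<Longrightarrow> T (s \<otimes> t) \<in> \<mm>"
begin

lemma q_bounds: "1 < p ^ e" "1 \<le> p ^ e" "1 \<le> p ^ e - 1"
proof -
  have "1 < p" using prime_p by (rule prime_gt_1_nat)
  then show "1 < p ^ e" using e one_less_power[of p e] by simp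
  then show "1 \<le> p ^ e" "1 \<le> p ^ e - 1" by linarith+
qed

lemmas \<psi>_closed = frob_linearD(1)[OF \<psi>] and \<psi>_add = frob_linearD(2)[OF \<psi>]
  and \<psi>_linear = frob_linearD(3)[OF \<psi>]

lemma \<phi>_closed: "r \<in> carrier R \<Longrightarrow> \<phi> r \<in> carrier R"
  using \<phi> by (auto simp: frob_linear_def)

lemma char_S: "[p] \<cdot> \<one> = \<zero>"
proof -
  have "\<theta> ([n] \<cdot>\<^bsub>R\<^esub> \<one>\<^bsub>R\<^esub>) = [n] \<cdot> \<one>" for n :: nat
    by (induction n) (simp_all add: R.add.nat_pow_Suc)
  from this[of p] show ?thesis by (simp add: char_R)
qed

lemma zero_pow_q: "\<zero> [^] (p ^ e) = \<zero>"
  by (rule nat_pow_zero) (use q_bounds(1) in linarith)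

lemma pow_q_Suc:
  "x \<in> carrier S \<Longrightarrow> x [^] (p ^ e) = x [^] (p ^ e - 1) \<otimes> x"
  "\<gamma> \<in> carrier \<Gamma> \<Longrightarrow> \<gamma> [^]\<^bsub>\<Gamma>\<^esub> (p ^ e) = \<gamma> [^]\<^bsub>\<Gamma>\<^esub> (p ^ e - 1) \<otimes>\<^bsub>\<Gamma>\<^esub> \<gamma>"
proof -
  obtain k where "p ^ e = Suc k" using q_bounds(1) by (cases "p ^ e") auto
  then show "x \<in> carrier S \<Longrightarrow> x [^] (p ^ e) = x [^] (p ^ e - 1) \<otimes> x"
    "\<gamma> \<in> carrier \<Gamma> \<Longrightarrow> \<gamma> [^]\<^bsub>\<Gamma>\<^esub> (p ^ e) = \<gamma> [^]\<^bsub>\<Gamma>\<^esub> (p ^ e - 1) \<otimes>\<^bsub>\<Gamma>\<^esub> \<gamma>" by simp_all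
qed

lemma frobenius_finsum:
  assumes "finite I" "\<And>i. i \<in> I \<Longrightarrow> f i \<in> carrier S"
  shows "finsum S f I [^] (p ^ e) = (\<Oplus>i\<in>I. f i [^] (p ^ e))"
  using assms
proof (induction I rule: finite_induct)
  case empty
  then show ?case using zero_pow_q by simp
next
  case (insert i I)
  then have "f \<in> I \<rightarrow> carrier S" "(\<lambda>i. f i [^] (p ^ e)) \<in> I \<rightarrow> carrier S" by auto
  then show ?case
    using insert frobenius_power_add[OF prime_p char_S] by (simp add: finsum_closed)
qed

text \<open>The element \<open>\<psi>(c)\<close> has trace \<open>\<phi>(c) = 1\<close> and lives in degrees killed by \<open>q\<close>. By additivity of
  Frobenius its \<open>q\<close>-th power is in \<open>R\<close>, and it is congruent to \<open>1\<close> modulo \<open>\<mm>\<close> because the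
  nontrivial degrees contribute elements of \<open>\<mm>\<close>.\<close>

lemma \<psi>_unit: "\<psi> (\<theta> c) \<in> Units S"
proof -
  interpret m: ideal \<mm> R by (rule \<mm>(1))
  let ?u = "\<psi> (\<theta> c)" and ?q = "p ^ e"
  have u: "?u \<in> carrier S" using \<psi>_closed c by simp
  have Tu: "T ?u = \<one>\<^bsub>R\<^esub>" using transpose c by simp
  have comp: "(pr \<epsilon> ?u) [^] ?q = \<theta> (T ((pr \<epsilon> ?u) [^] ?q)) \<and>
      (\<epsilon> \<noteq> \<one>\<^bsub>\<Gamma>\<^esub> \<longrightarrow> T ((pr \<epsilon> ?u) [^] ?q) \<in> \<mm>)" if eps: "\<epsilon> \<in> carrier \<Gamma>" for \<epsilon>
  proof (cases "\<epsilon> [^]\<^bsub>\<Gamma>\<^esub> ?q = \<one>\<^bsub>\<Gamma>\<^esub>")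
    case True
    let ?x = "pr \<epsilon> ?u"
    have x: "homogeneous \<epsilon> ?x" "?x \<in> carrier S" using u eps by auto
    have 1: "\<theta> (T (?x [^] ?q)) = ?x [^] ?q"
      using homogeneous_pow[OF x(1), of ?q] True by (intro homogeneous_one_degree) simp
    have split: "?x [^] ?q = ?x \<otimes> ?x [^] (?q - 1)"
      using pow_q_Suc(1)[OF x(2)] x(2) m_comm[of ?x "?x [^] (?q - 1)"] by simp
    have "\<epsilon> [^]\<^bsub>\<Gamma>\<^esub> (?q - 1) \<otimes>\<^bsub>\<Gamma>\<^esub> \<epsilon> = \<one>\<^bsub>\<Gamma>\<^esub>"
      using True pow_q_Suc(2)[OF eps] by simp
    then have "\<epsilon> [^]\<^bsub>\<Gamma>\<^esub> (?q - 1) = inv\<^bsub>\<Gamma>\<^esub> \<epsilon>" using eps by (intro G.inv_equality[symmetric]) auto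
    then have "homogeneous (inv\<^bsub>\<Gamma>\<^esub> \<epsilon>) (?x [^] (?q - 1))" using homogeneous_pow[OF x(1), of "?q - 1"] by simp
    then have "T (?x [^] ?q) \<in> \<mm>" if "\<epsilon> \<noteq> \<one>\<^bsub>\<Gamma>\<^esub>" unfolding split using T_mult_mem_\<mm> x that by blast
    then show ?thesis using 1 by simp
  next
    case False
    have "pr (\<epsilon> [^]\<^bsub>\<Gamma>\<^esub> ?q) (\<theta> c) = \<zero>"
      using pr_homogeneous[OF homogeneous_\<theta>[OF c(1)], of "\<epsilon> [^]\<^bsub>\<Gamma>\<^esub> ?q"] False eps by simp
    then have "pr \<epsilon> ?u = \<zero>"
      using pr_transpose[OF \<psi> transpose eps, of "\<theta> c"] c eps frob_linearD(4)[OF \<psi>] by simp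
    then show ?thesis using zero_pow_q by simp
  qed
  define w where "w = (\<Oplus>\<^bsub>R\<^esub>\<epsilon>\<in>carrier \<Gamma> - {\<one>\<^bsub>\<Gamma>\<^esub>}. T ((pr \<epsilon> ?u) [^] ?q))"
  have w: "w \<in> \<mm>" unfolding w_def using comp by (intro m.finsum_in_ideal) auto
  then have wR: "w \<in> carrier R" by (rule m.Icarr)
  have Tuq: "T (?u [^] ?q) = \<one>\<^bsub>R\<^esub> \<oplus>\<^bsub>R\<^esub> w" and \<theta>T: "\<theta> (T (?u [^] ?q)) = ?u [^] ?q"
  proof -
    have sum: "?u [^] ?q = (\<Oplus>\<epsilon>\<in>carrier \<Gamma>. (pr \<epsilon> ?u) [^] ?q)"
      using frobenius_finsum[of "carrier \<Gamma>" "\<lambda>\<epsilon>. pr \<epsilon> ?u"] u by (simp add: pr_sum)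
    have T: "T (?u [^] ?q) = (\<Oplus>\<^bsub>R\<^esub>\<epsilon>\<in>carrier \<Gamma>. T ((pr \<epsilon> ?u) [^] ?q))"
      unfolding sum using u by (intro T_finsum) auto
    have ins: "carrier \<Gamma> = insert \<one>\<^bsub>\<Gamma>\<^esub> (carrier \<Gamma> - {\<one>\<^bsub>\<Gamma>\<^esub>})" using G.one_closed by blast
    have "(\<Oplus>\<^bsub>R\<^esub>\<epsilon>\<in>carrier \<Gamma>. T ((pr \<epsilon> ?u) [^] ?q)) = T ((pr \<one>\<^bsub>\<Gamma>\<^esub> ?u) [^] ?q) \<oplus>\<^bsub>R\<^esub> w"
      unfolding w_def by (subst ins, subst R.finsum_insert) (use u in auto)
    moreover have "pr \<one>\<^bsub>\<Gamma>\<^esub> ?u = \<one>" using pr_one[OF u] Tu by simp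
    ultimately show "T (?u [^] ?q) = \<one>\<^bsub>R\<^esub> \<oplus>\<^bsub>R\<^esub> w" using T by simp
    have comps: "pr \<epsilon> (?u [^] ?q) = pr \<epsilon> (\<theta> (T (?u [^] ?q)))" if eps: "\<epsilon> \<in> carrier \<Gamma>" for \<epsilon>
    proof -
      have hom1: "homogeneous \<one>\<^bsub>\<Gamma>\<^esub> ((pr \<delta> ?u) [^] ?q)" if "\<delta> \<in> carrier \<Gamma>" for \<delta>
        using comp[OF that] homogeneous_\<theta>[of "T ((pr \<delta> ?u) [^] ?q)"] u that by simp
      then have "pr \<epsilon> (?u [^] ?q) = (if \<epsilon> = \<one>\<^bsub>\<Gamma>\<^esub> then ?u [^] ?q else \<zero>)"
        unfolding sum using eps u
        by (subst pr_finsum)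
          (auto simp: pr_homogeneous[OF hom1] intro!: add.finprod_cong' add.finprod_one_eqI)
      moreover have "pr \<epsilon> (\<theta> (T (?u [^] ?q))) = (if \<epsilon> = \<one>\<^bsub>\<Gamma>\<^esub> then \<theta> (T (?u [^] ?q)) else \<zero>)"
        using u by (intro pr_homogeneous[OF homogeneous_\<theta> eps]) simp
      moreover have "pr \<one>\<^bsub>\<Gamma>\<^esub> (?u [^] ?q) = \<theta> (T (?u [^] ?q))" using u by (intro pr_one) simp
      ultimately show ?thesis by (cases "\<epsilon> = \<one>\<^bsub>\<Gamma>\<^esub>") metis+
    qed
    have "?u [^] ?q = \<theta> (T (?u [^] ?q))" by (rule eq_if_pr_eq[OF _ _ comps]) (use u in auto)
    then show "\<theta> (T (?u [^] ?q)) = ?u [^] ?q" by (rule sym)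
  qed
  have "\<one>\<^bsub>R\<^esub> \<oplus>\<^bsub>R\<^esub> w \<notin> \<mm>"
  proof
    assume "\<one>\<^bsub>R\<^esub> \<oplus>\<^bsub>R\<^esub> w \<in> \<mm>"
    then have "(\<one>\<^bsub>R\<^esub> \<oplus>\<^bsub>R\<^esub> w) \<oplus>\<^bsub>R\<^esub> (\<ominus>\<^bsub>R\<^esub> w) \<in> \<mm>"
      using m.a_closed m.a_inv_closed[OF w] by blast
    then show False using \<mm>(2) wR by (simp add: R.a_assoc R.r_neg)
  qed
  then have "\<one>\<^bsub>R\<^esub> \<oplus>\<^bsub>R\<^esub> w \<in> Units R" using wR by (intro Units_R) auto
  then obtain v where v: "v \<in> carrier R" "v \<otimes>\<^bsub>R\<^esub> (\<one>\<^bsub>R\<^esub> \<oplus>\<^bsub>R\<^esub> w) = \<one>\<^bsub>R\<^esub>" by (auto simp: Units_def)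
  have "\<theta> v \<otimes> \<theta> (\<one>\<^bsub>R\<^esub> \<oplus>\<^bsub>R\<^esub> w) = \<one>"
    using \<theta>_mult[OF v(1), of "\<one>\<^bsub>R\<^esub> \<oplus>\<^bsub>R\<^esub> w"] v(2) wR by simp
  then have "\<theta> v \<otimes> ?u [^] ?q = \<one>" using \<theta>T unfolding Tuq by simp
  moreover have "?u [^] ?q = ?u [^] (?q - 1) \<otimes> ?u" by (rule pow_q_Suc(1)[OF u])
  ultimately have "(\<theta> v \<otimes> ?u [^] (?q - 1)) \<otimes> ?u = \<one>" using u v by (simp add: m_assoc)
  then show ?thesis using u v m_comm[of ?u "\<theta> v \<otimes> ?u [^] (?q - 1)"]
    unfolding Units_def by (auto intro!: bexI[of _ "\<theta> v \<otimes> ?u [^] (?q - 1)"])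
qed

lemma \<psi>_takes_one: "\<exists>d\<in>carrier S. \<psi> d = \<one>"
proof -
  obtain v where v: "v \<in> carrier S" "v \<otimes> \<psi> (\<theta> c) = \<one>" using \<psi>_unit by (auto simp: Units_def)
  then have "\<psi> (v [^] (p ^ e) \<otimes> \<theta> c) = \<one>" using \<psi>_linear c by simp
  then show ?thesis using v c by (intro bexI[of _ "v [^] (p ^ e) \<otimes> \<theta> c"]) auto
qed

lemma Schpec_R: "Schpec R (p ^ e) \<phi> = CSpec R \<phi>"
  by (rule Schpec_eq_CSpec[OF R.is_cring \<phi> q_bounds(2) c])

lemma Schpec_S: "Schpec S (p ^ e) \<psi> = CSpec S \<psi>"
  using \<psi>_takes_one Schpec_eq_CSpec[OF is_cring \<psi> q_bounds(2)] by blast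

lemma CSpec_R_D:
  assumes "P \<in> CSpec R \<phi>" shows "primeideal P R" "ideal P R" "\<And>r. r \<in> P \<Longrightarrow> \<phi> r \<in> P"
  using assms primeideal.axioms(1) by (auto simp: CSpec_def spec_def)

text \<open>\<open>T(t \<psi>(s)) = T(\<psi>(t\<^sup>q s)) = \<phi>(T(t\<^sup>q s))\<close>.\<close>

lemma \<psi>_trace_ideal:
  assumes P: "P \<in> CSpec R \<phi>" shows "\<psi> ` trace_ideal S T P \<subseteq> trace_ideal S T P"
proof clarify
  fix s assume s: "s \<in> trace_ideal S T P"
  then have sS: "s \<in> carrier S" by (simp add: mem_trace_ideal_iff)
  have "T (t \<otimes> \<psi> s) \<in> P" if t: "t \<in> carrier S" for t
  proof -
    have "T (t \<otimes> \<psi> s) = \<phi> (T (t [^] (p ^ e) \<otimes> s))"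
      using \<psi>_linear[OF sS t] transpose[of "t [^] (p ^ e) \<otimes> s"] sS t by simp
    moreover have "T (t [^] (p ^ e) \<otimes> s) \<in> P" using s t by (simp add: mem_trace_ideal_iff)
    ultimately show ?thesis using CSpec_R_D(3)[OF P] by simp
  qed
  then show "\<psi> s \<in> trace_ideal S T P" using \<psi>_closed sS by (simp add: mem_trace_ideal_iff)
qed

text \<open>If \<open>\<psi>(d) = 1\<close> then \<open>y = \<psi>(y\<^sup>q d)\<close>, so compatibility recovers \<open>y\<close> from \<open>y\<^sup>q\<close>.\<close>

lemma trace_ideal_radical:
  assumes P: "P \<in> CSpec R \<phi>" and x: "x \<in> carrier S" "x [^] (n::nat) \<in> trace_ideal S T P"
  shows "x \<in> trace_ideal S T P"
proof -
  interpret I: ideal "trace_ideal S T P" S by (rule ideal_trace_ideal[OF CSpec_R_D(2)[OF P]])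
  obtain d where d: "d \<in> carrier S" "\<psi> d = \<one>" using \<psi>_takes_one by blast
  have step: "y \<in> trace_ideal S T P" if y: "y \<in> carrier S" "y [^] (p ^ e) \<in> trace_ideal S T P" for y
  proof -
    have "\<psi> (y [^] (p ^ e) \<otimes> d) \<in> trace_ideal S T P"
      using \<psi>_trace_ideal[OF P] I.I_r_closed[OF y(2) d(1)] by blast
    then show ?thesis using \<psi>_linear d y by simp
  qed
  have *: "x [^] ((p ^ e) ^ m) \<in> trace_ideal S T P \<Longrightarrow> x \<in> trace_ideal S T P" for m
  proof (induction m)
    case 0
    then show ?case using x by simp
  next
    case (Suc m)
    then show ?case using step[of "x [^] ((p ^ e) ^ m)"] x by (simp add: nat_pow_pow mult.commute)
  qed
  have "n \<le> (p ^ e) ^ n" using q_bounds(1) power_gt_expt[of "p ^ e" n] by simp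
  then have "x [^] ((p ^ e) ^ n) = x [^] n \<otimes> x [^] ((p ^ e) ^ n - n)" using x by (simp add: nat_pow_mult)
  moreover have "x [^] n \<otimes> x [^] ((p ^ e) ^ n - n) \<in> trace_ideal S T P"
    using x by (intro I.I_r_closed) auto
  ultimately show ?thesis using *[of n] by simp
qed

lemma trace_ideal_eq_radical:
  assumes P: "P \<in> CSpec R \<phi>" shows "trace_ideal S T P = radical S (Idl (\<theta> ` P))"
proof
  show "trace_ideal S T P \<subseteq> radical S (Idl (\<theta> ` P))"
    by (rule trace_ideal_subset_radical[OF CSpec_R_D(2)[OF P]])
  show "radical S (Idl (\<theta> ` P)) \<subseteq> trace_ideal S T P"
    using extension_subset_trace_ideal[OF CSpec_R_D(2)[OF P]] trace_ideal_radical[OF P]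
    by (auto simp: radical_def)
qed

subsection \<open>Compatible primes of \<open>R\<close> and \<open>S\<close>\<close>

lemma iterate_transpose:
  "frob_linear S ((p ^ e) ^ n) (\<psi> ^^ n)"
  "s \<in> carrier S \<Longrightarrow> T ((\<psi> ^^ n) s) = (\<phi> ^^ n) (T s)"
  "\<exists>d\<in>carrier S. (\<psi> ^^ n) d = \<one>"
proof -
  have cl: "(\<psi> ^^ n) s \<in> carrier S" if "s \<in> carrier S" for s n
    using that by (induction n) (auto simp: \<psi>_closed)
  have add: "(\<psi> ^^ n) (s \<oplus> t) = (\<psi> ^^ n) s \<oplus> (\<psi> ^^ n) t" if "s \<in> carrier S" "t \<in> carrier S" for s t n
    using that by (induction n) (auto simp: \<psi>_add cl)
  have lin: "(\<psi> ^^ n) (a [^] ((p ^ e) ^ n) \<otimes> s) = a \<otimes> (\<psi> ^^ n) s"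
    if "s \<in> carrier S" "a \<in> carrier S" for s a n
    using that
  proof (induction n arbitrary: a)
    case (Suc n)
    have "a [^] ((p ^ e) ^ Suc n) = (a [^] (p ^ e)) [^] ((p ^ e) ^ n)" using Suc by (simp add: nat_pow_pow)
    then show ?case using Suc.IH[of "a [^] (p ^ e)"] Suc.prems \<psi>_linear cl by simp
  qed simp
  show "frob_linear S ((p ^ e) ^ n) (\<psi> ^^ n)" using cl add lin by (auto simp: frob_linear_def)
  show "T ((\<psi> ^^ n) s) = (\<phi> ^^ n) (T s)" if "s \<in> carrier S"
    using that by (induction n) (auto simp: transpose cl)
  show "\<exists>d\<in>carrier S. (\<psi> ^^ n) d = \<one>"
  proof (induction n)
    case (Suc n)
    then obtain d where d: "d \<in> carrier S" "(\<psi> ^^ n) d = \<one>" by blast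
    obtain d1 where d1: "d1 \<in> carrier S" "\<psi> d1 = \<one>" using \<psi>_takes_one by blast
    have "(\<psi> ^^ n) (d1 [^] ((p ^ e) ^ n) \<otimes> d) = d1" using lin[OF d(1) d1(1), of n] d d1 by simp
    then show ?case using d d1 by (intro bexI[of _ "d1 [^] ((p ^ e) ^ n) \<otimes> d"]) auto
  qed auto
qed

lemma prs_iterate_mem:
  assumes Q: "Q \<in> CSpec S \<psi>" and x: "x \<in> Q"
  shows "prs ((\<lambda>\<gamma>. \<gamma> [^]\<^bsub>\<Gamma>\<^esub> ((p ^ e) ^ n)) ` carrier \<Gamma>) x \<in> Q"
proof -
  have Q': "primeideal Q S" "\<psi> ` Q \<subseteq> Q" using Q by (auto simp: CSpec_def spec_def)
  obtain d where d: "d \<in> carrier S" "(\<psi> ^^ n) d = \<one>" using iterate_transpose(3) by blast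
  have "(\<psi> ^^ n) ` Q \<subseteq> Q" using Q'(2) by (induction n) auto
  moreover have "1 \<le> (p ^ e) ^ n" using q_bounds by simp
  ultimately show ?thesis
    using prs_pow_image_mem_prime[OF iterate_transpose(1) _ iterate_transpose(2) d Q'(1) _ refl x] by blast
qed

text \<open>An element \<open>\<epsilon> = \<delta>\<^bsup>q^N\<^esup>\<close> killed by \<open>q\<close> comes from some \<open>\<delta>\<close> of \<open>p\<close>-power order, and such an order, being at
  most the order \<open>N\<close> of \<open>\<Gamma>\<close>, already divides \<open>q\<^sup>N\<close>.\<close>

lemma pow_image_no_p_torsion:
  assumes eps: "\<epsilon> \<in> (\<lambda>\<gamma>. \<gamma> [^]\<^bsub>\<Gamma>\<^esub> ((p ^ e) ^ order \<Gamma>)) ` carrier \<Gamma>" and "\<epsilon> [^]\<^bsub>\<Gamma>\<^esub> (p ^ e) = \<one>\<^bsub>\<Gamma>\<^esub>"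
  shows "\<epsilon> = \<one>\<^bsub>\<Gamma>\<^esub>"
proof -
  let ?N = "order \<Gamma>"
  obtain \<delta> where d: "\<delta> \<in> carrier \<Gamma>" "\<epsilon> = \<delta> [^]\<^bsub>\<Gamma>\<^esub> ((p ^ e) ^ ?N)" using eps by blast
  then have "\<delta> [^]\<^bsub>\<Gamma>\<^esub> (p ^ (e * ?N + e)) = \<one>\<^bsub>\<Gamma>\<^esub>"
    using assms(2) by (simp add: G.nat_pow_pow power_add power_mult)
  then have "G.ord \<delta> dvd p ^ (e * ?N + e)" using G.pow_eq_id[OF d(1)] by simp
  then obtain i where i: "G.ord \<delta> = p ^ i" using prime_p divides_primepow_nat by blast
  have "p ^ i \<le> ?N" using G.ord_le_group_order[OF _ d(1)] i by simp
  moreover have "i < p ^ i" using prime_gt_1_nat[OF prime_p] power_gt_expt[of p i] by simp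
  ultimately have "i \<le> e * ?N" using e by (metis le_trans less_imp_le_nat mult_le_mono1 mult_1)
  then have "G.ord \<delta> dvd (p ^ e) ^ ?N" unfolding i by (simp add: le_imp_power_dvd flip: power_mult)
  then show ?thesis using d G.pow_eq_id[OF d(1)] by simp
qed

text \<open>For \<open>r\<close> in the contraction, \<open>\<psi>(r)\<close> is in \<open>Q\<close> and has components only in degrees killed by \<open>q\<close>. Projecting
  onto the degrees in the image of a large power of \<open>q\<close>, which has no \<open>p\<close>-torsion, stays in \<open>Q\<close> and leaves
  just \<open>\<phi>(r)\<close>.\<close>

lemma CSpec_contraction:
  assumes Q: "Q \<in> CSpec S \<psi>" shows "contraction R \<theta> Q \<in> CSpec R \<phi>"
proof -
  let ?H = "(\<lambda>\<gamma>. \<gamma> [^]\<^bsub>\<Gamma>\<^esub> ((p ^ e) ^ order \<Gamma>)) ` carrier \<Gamma>"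
  have Q': "primeideal Q S" "\<psi> ` Q \<subseteq> Q" using Q by (auto simp: CSpec_def spec_def)
  have H: "?H \<subseteq> carrier \<Gamma>" by auto
  have "\<one>\<^bsub>\<Gamma>\<^esub> \<in> ?H" using G.one_closed by (metis G.nat_pow_one image_eqI)
  have "\<phi> r \<in> contraction R \<theta> Q" if r: "r \<in> contraction R \<theta> Q" for r
  proof -
    have rR: "r \<in> carrier R" "\<theta> r \<in> Q" using r by (auto simp: contraction_def)
    have u: "\<psi> (\<theta> r) \<in> carrier S" "\<psi> (\<theta> r) \<in> Q" using rR Q' \<psi>_closed by auto
    have "prs ?H (\<psi> (\<theta> r)) = \<theta> (\<phi> r)"
    proof (rule eq_if_pr_eq)
      fix \<epsilon> assume eps: "\<epsilon> \<in> carrier \<Gamma>"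
      have one: "pr \<one>\<^bsub>\<Gamma>\<^esub> (\<psi> (\<theta> r)) = \<theta> (\<phi> r)" using pr_one[OF u(1)] transpose rR by simp
      have "pr \<epsilon> (\<psi> (\<theta> r)) = \<zero>" if "\<epsilon> \<in> ?H" "\<epsilon> \<noteq> \<one>\<^bsub>\<Gamma>\<^esub>"
      proof -
        have "\<epsilon> [^]\<^bsub>\<Gamma>\<^esub> (p ^ e) \<noteq> \<one>\<^bsub>\<Gamma>\<^esub>" using pow_image_no_p_torsion that by blast
        then have "pr (\<epsilon> [^]\<^bsub>\<Gamma>\<^esub> (p ^ e)) (\<theta> r) = \<zero>"
          using pr_homogeneous[OF homogeneous_\<theta>[OF rR(1)], of "\<epsilon> [^]\<^bsub>\<Gamma>\<^esub> (p ^ e)"] eps by simp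
        then show ?thesis
          using pr_transpose[OF \<psi> transpose eps, of "\<theta> r"] rR eps frob_linearD(4)[OF \<psi>] by simp
      qed
      then show "pr \<epsilon> (prs ?H (\<psi> (\<theta> r))) = pr \<epsilon> (\<theta> (\<phi> r))"
        using pr_prs[OF H u(1) eps] one \<open>\<one>\<^bsub>\<Gamma>\<^esub> \<in> ?H\<close>
          pr_homogeneous[OF homogeneous_\<theta>[OF \<phi>_closed[OF rR(1)]] eps] by auto
    qed (use H u \<phi>_closed rR in auto)
    then have "\<theta> (\<phi> r) \<in> Q" using prs_iterate_mem[OF Q u(2), of "order \<Gamma>"] by simp
    then show ?thesis using \<phi>_closed rR by (simp add: contraction_def)
  qed
  then show ?thesis using primeideal_contraction[OF Q'(1)] by (auto simp: CSpec_def spec_def)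
qed

text \<open>Near \<open>Q\<close> the prime \<open>Q\<close> agrees with the compatible ideal \<open>P\<^sup>T\<close>: with \<open>x \<notin> Q\<close> and \<open>x y \<in> P\<^sup>T\<close> one gets
  \<open>x \<psi>(y) = \<psi>(x\<^sup>q y) \<in> P\<^sup>T \<subseteq> Q\<close>.\<close>

lemma CSpec_over:
  assumes P: "P \<in> CSpec R \<phi>" and Q: "Q \<in> primes_over R S \<theta> P" shows "Q \<in> CSpec S \<psi>"
proof -
  note PD = CSpec_R_D[OF P]
  interpret Q: primeideal Q S using Q primes_over_iff by blast
  interpret I: ideal "trace_ideal S T P" S by (rule ideal_trace_ideal[OF PD(2)])
  have sub: "trace_ideal S T P \<subseteq> Q"
    using Q by (intro trace_ideal_subset_prime[OF PD(2) Q.primeideal]) (auto simp: primes_over_iff)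
  have "\<psi> y \<in> Q" if y: "y \<in> Q" for y
  proof -
    have yS: "y \<in> carrier S" using y Q.Icarr by blast
    have "\<exists>x\<in>carrier S. x \<notin> Q \<and> x \<otimes> y \<in> trace_ideal S T P"
      by (rule exists_annihilator_mod_trace_ideal[OF PD(1) Q y]) (rule trace_ideal_radical[OF P])
    then obtain x where x: "x \<in> carrier S" "x \<notin> Q" "x \<otimes> y \<in> trace_ideal S T P" by blast
    have "x [^] (p ^ e) \<otimes> y = x [^] (p ^ e - 1) \<otimes> (x \<otimes> y)"
      using x yS pow_q_Suc(1)[OF x(1)] by (simp add: m_assoc)
    then have "x [^] (p ^ e) \<otimes> y \<in> trace_ideal S T P" using x I.I_l_closed by simp
    then have "\<psi> (x [^] (p ^ e) \<otimes> y) \<in> Q" using \<psi>_trace_ideal[OF P] sub by blast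
    then have "x \<otimes> \<psi> y \<in> Q" using \<psi>_linear[OF yS x(1)] by simp
    then show ?thesis using Q.I_prime[OF x(1) \<psi>_closed[OF yS]] x(2) by blast
  qed
  then show ?thesis using Q.primeideal by (auto simp: CSpec_def spec_def)
qed

lemma CSpec_iff_primes_over:
  assumes P: "primeideal P R"
  shows "P \<in> CSpec R \<phi> \<longleftrightarrow> primes_over R S \<theta> P \<subseteq> CSpec S \<psi>"
    and "primes_over R S \<theta> P \<subseteq> CSpec S \<psi> \<longleftrightarrow> primes_over R S \<theta> P \<inter> CSpec S \<psi> \<noteq> {}"
proof -
  have "P \<in> CSpec R \<phi>" if ne: "primes_over R S \<theta> P \<inter> CSpec S \<psi> \<noteq> {}"
  proof -
    obtain Q where "Q \<in> CSpec S \<psi>" "contraction R \<theta> Q = P" using ne by (auto simp: primes_over_def)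
    then show ?thesis using CSpec_contraction by blast
  qed
  then show "P \<in> CSpec R \<phi> \<longleftrightarrow> primes_over R S \<theta> P \<subseteq> CSpec S \<psi>"
    and "primes_over R S \<theta> P \<subseteq> CSpec S \<psi> \<longleftrightarrow> primes_over R S \<theta> P \<inter> CSpec S \<psi> \<noteq> {}"
    using CSpec_over primes_over_nonempty[OF P] by blast+
qed

subsection \<open>The transposition is fibered\<close>

text \<open>Traces of multiples of \<open>\<psi>\<^sup>n(s r)\<close> are values of \<open>\<phi>\<^sup>n\<close> on multiples of \<open>r\<close>, so \<open>\<psi>\<^sup>n(s r)\<close> lies in the trace
  ideal of the contraction of \<open>Q\<close>, hence in \<open>Q\<close>.\<close>

lemma \<beta>_contraction_subset:
  assumes Q: "primeideal Q S"
  shows "\<beta> R \<phi> (contraction R \<theta> Q) \<subseteq> contraction R \<theta> (\<beta> S \<psi> Q)"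
proof
  let ?P = "contraction R \<theta> Q"
  have P: "ideal ?P R" using primeideal_contraction[OF Q] primeideal.axioms(1) by blast
  fix r assume r: "r \<in> \<beta> R \<phi> ?P"
  then have rR: "r \<in> carrier R" by (simp add: \<beta>_def)
  have \<phi>n: "(\<phi> ^^ n) (a \<otimes>\<^bsub>R\<^esub> r) \<in> ?P" if "a \<in> carrier R" for n a
    using r that by (auto simp: \<beta>_def cgenideal_def)
  have "(\<psi> ^^ n) (s \<otimes> \<theta> r) \<in> Q" if s: "s \<in> carrier S" for n s
  proof -
    note it = iterate_transpose(1,2)[where n = n]
    have cl: "(\<psi> ^^ n) (s \<otimes> \<theta> r) \<in> carrier S" using frob_linearD(1)[OF it(1)] s rR by simp
    have "T (t \<otimes> (\<psi> ^^ n) (s \<otimes> \<theta> r)) \<in> ?P" if t: "t \<in> carrier S" for t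
    proof -
      let ?z = "t [^] ((p ^ e) ^ n) \<otimes> s"
      have z: "?z \<in> carrier S" using s t by simp
      have "t \<otimes> (\<psi> ^^ n) (s \<otimes> \<theta> r) = (\<psi> ^^ n) (\<theta> r \<otimes> ?z)"
        using frob_linearD(3)[OF it(1), of "s \<otimes> \<theta> r" t] s t rR by (simp add: m_ac)
      then have "T (t \<otimes> (\<psi> ^^ n) (s \<otimes> \<theta> r)) = (\<phi> ^^ n) (T ?z \<otimes>\<^bsub>R\<^esub> r)"
        using it(2)[of "\<theta> r \<otimes> ?z"] T_linear[OF rR z] z rR by (simp add: R.m_comm)
      then show ?thesis using \<phi>n z by simp
    qed
    then have "(\<psi> ^^ n) (s \<otimes> \<theta> r) \<in> trace_ideal S T ?P" using cl by (simp add: mem_trace_ideal_iff)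
    moreover have "trace_ideal S T ?P \<subseteq> Q"
      by (rule trace_ideal_subset_prime[OF P Q]) (auto simp: contraction_def)
    ultimately show ?thesis by blast
  qed
  then show "r \<in> contraction R \<theta> (\<beta> S \<psi> Q)"
    using rR by (auto simp: contraction_def \<beta>_def cgenideal_def)
qed

context
  fixes P assumes P: "P \<in> CSpec R \<phi>"
begin

interpretation P: primeideal P R by (rule CSpec_R_D(1)[OF P])

interpretation LR: ring_localization R "carrier R - P" by (rule P.ring_localization_compl)

interpretation LS: ring_localization S "fiber_mset R \<theta> P"
proof
  show "fiber_mset R \<theta> P \<subseteq> carrier S" by (auto simp: fiber_mset_def)
  show "\<one> \<in> fiber_mset R \<theta> P" unfolding fiber_mset_def using LR.one_in_M \<theta>.hom_one by (metis image_eqI)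
  fix s t assume "s \<in> fiber_mset R \<theta> P" "t \<in> fiber_mset R \<theta> P"
  then obtain a b where ab: "a \<in> carrier R - P" "s = \<theta> a" "b \<in> carrier R - P" "t = \<theta> b"
    by (auto simp: fiber_mset_def)
  then have "\<theta> (a \<otimes>\<^bsub>R\<^esub> b) \<in> fiber_mset R \<theta> P" unfolding fiber_mset_def using LR.M_mult_closed by blast
  then show "s \<otimes> t \<in> fiber_mset R \<theta> P" using ab by simp
qed

lemma fiber_cases:
  assumes "x \<in> carrier (loc_fiber R S \<theta> P)"
  obtains a m where "x = frac S (fiber_mset R \<theta> P) a (\<theta> m)" "a \<in> carrier S" "m \<in> carrier R - P"
    "\<theta> m \<in> fiber_mset R \<theta> P"
proof -
  obtain a s where "x = frac S (fiber_mset R \<theta> P) a s" "a \<in> carrier S" "s \<in> fiber_mset R \<theta> P"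
    using assms by (rule LS.frac_cases)
  then show thesis using that by (auto simp: fiber_mset_def)
qed

lemma \<theta>_fiber_mset: "m \<in> carrier R - P \<Longrightarrow> \<theta> m \<in> fiber_mset R \<theta> P"
  by (auto simp: fiber_mset_def)

text \<open>The trace ideal of a compatible prime is radical and saturated with respect to \<open>R - P\<close>, so its
  localization is already the radical of the extension of \<open>P\<close>.\<close>

lemma fiber_nilrad_eq: "fiber_nilrad R S \<theta> P = LS.fractions_of (trace_ideal S T P)"
proof
  have PR: "\<theta> ` P \<subseteq> carrier S" using P.Icarr by auto
  have I: "ideal (trace_ideal S T P) S" by (rule ideal_trace_ideal[OF P.is_ideal])
  show "fiber_nilrad R S \<theta> P \<subseteq> LS.fractions_of (trace_ideal S T P)"
  proof
    fix x assume "x \<in> fiber_nilrad R S \<theta> P"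
    then obtain n where x: "x \<in> carrier LS.L"
      and n: "x [^]\<^bsub>LS.L\<^esub> (n::nat) \<in> extend_loc S (fiber_mset R \<theta> P) (\<theta> ` P)"
      by (auto simp: fiber_nilrad_def radical_def)
    obtain a m where a: "x = LS.fr a (\<theta> m)" "a \<in> carrier S" "m \<in> carrier R - P" "\<theta> m \<in> fiber_mset R \<theta> P"
      by (rule fiber_cases[OF x])
    have "\<theta> ` P \<subseteq> trace_ideal S T P" using \<theta>_mem_trace_ideal[OF P.is_ideal] by blast
    from subsetD[OF LS.extend_loc_subset[OF I this] n]
    have "LS.fr (a [^] n) (\<theta> m [^] n) \<in> LS.fractions_of (trace_ideal S T P)"
      unfolding a(1) LS.pow_frac[OF a(2,4)] .
    then have "\<exists>u\<in>fiber_mset R \<theta> P. u \<otimes> a [^] n \<in> trace_ideal S T P"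
      using LS.frac_in_fractions_of_iff[OF I, of "a [^] n" "\<theta> m [^] n"] a(2,4) by simp
    then obtain u where u: "u \<in> fiber_mset R \<theta> P" "u \<otimes> a [^] n \<in> trace_ideal S T P" by blast
    have uS: "u \<in> carrier S" using u by blast
    have "(u \<otimes> a) [^] Suc n = (u [^] n \<otimes> a) \<otimes> (u \<otimes> a [^] n)"
      using uS a by (simp add: nat_pow_distrib m_ac)
    then have "(u \<otimes> a) [^] Suc n \<in> trace_ideal S T P" using ideal.I_l_closed[OF I u(2)] uS a by simp
    then have "u \<otimes> a \<in> trace_ideal S T P" using trace_ideal_radical[OF P, of "u \<otimes> a" "Suc n"] uS a by blast
    then show "x \<in> LS.fractions_of (trace_ideal S T P)"
      unfolding a(1) using LS.frac_in_fractions_of_iff[OF I a(2,4)] u(1) by blast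
  qed
  show "LS.fractions_of (trace_ideal S T P) \<subseteq> fiber_nilrad R S \<theta> P"
  proof
    fix x assume "x \<in> LS.fractions_of (trace_ideal S T P)"
    then obtain a s where a: "a \<in> trace_ideal S T P" "s \<in> fiber_mset R \<theta> P" "x = LS.fr a s"
      by (rule LS.fractions_ofE)
    then obtain n where n: "a \<in> carrier S" "a [^] (n::nat) \<in> Idl (\<theta> ` P)"
      using trace_ideal_subset_radical[OF P.is_ideal] by (auto simp: radical_def)
    have "LS.fr (a [^] n) (s [^] n) \<in> LS.fractions_of (Idl (\<theta> ` P))"
      using n(2) a(2) by (intro LS.fractions_ofI LS.M_pow_closed)
    from subsetD[OF LS.fractions_of_Idl_subset[OF PR] this]
    have "x [^]\<^bsub>LS.L\<^esub> n \<in> extend_loc S (fiber_mset R \<theta> P) (\<theta> ` P)"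
      unfolding a(3) LS.pow_frac[OF n(1) a(2)] .
    moreover have "x \<in> carrier LS.L" unfolding a(3) by (rule LS.frac_closed[OF n(1) a(2)])
    ultimately show "x \<in> fiber_nilrad R S \<theta> P" unfolding fiber_nilrad_def radical_def by blast
  qed
qed

lemma extend_loc_R_eq: "extend_loc R (carrier R - P) P = LR.fractions_of P"
  by (rule LR.extend_loc_ideal[OF P.is_ideal])

text \<open>The value does not depend on the representative: representatives have denominators in \<open>\<theta>(R - P)\<close>,
  so the \<open>R\<close>-linear map \<open>T\<close> carries the cross-multiplied equality in \<open>S\<close> over to \<open>R\<close>.\<close>

lemma loc_trace_frac:
  assumes a: "a \<in> carrier S" and m: "m \<in> carrier R - P"
  shows "loc_trace R \<theta> T P (LS.fr a (\<theta> m)) = LR.fr (T a) m"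
proof -
  have eq: "LR.fr (T s) m' = LR.fr (T a) m" if m': "m' \<in> carrier R - P" and s: "(s, \<theta> m') \<in> LS.fr a (\<theta> m)" for m' s
  proof -
    note sD = LS.mem_fracD[OF s]
    obtain u where u: "u \<in> fiber_mset R \<theta> P" "u \<otimes> (s \<otimes> \<theta> m) = u \<otimes> (a \<otimes> \<theta> m')"
      using LS.frac_eqE[OF sD(3) sD(1) a sD(2) \<theta>_fiber_mset[OF m]] by blast
    then obtain r where r: "r \<in> carrier R - P" "u = \<theta> r" by (auto simp: fiber_mset_def)
    have lin: "T (\<theta> r \<otimes> (x \<otimes> \<theta> y)) = r \<otimes>\<^bsub>R\<^esub> (T x \<otimes>\<^bsub>R\<^esub> y)" if "x \<in> carrier S" "y \<in> carrier R" for x y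
      using that r T_linear[of r "x \<otimes> \<theta> y"] T_linear[of y x] by (simp add: m_comm R.m_comm)
    have "r \<otimes>\<^bsub>R\<^esub> (T s \<otimes>\<^bsub>R\<^esub> m) = r \<otimes>\<^bsub>R\<^esub> (T a \<otimes>\<^bsub>R\<^esub> m')"
      using lin[OF sD(1), of m] lin[OF a, of m'] u(2) m m' unfolding r(2) by auto
    then have "\<exists>u\<in>carrier R - P. u \<otimes>\<^bsub>R\<^esub> (T s \<otimes>\<^bsub>R\<^esub> m) = u \<otimes>\<^bsub>R\<^esub> (T a \<otimes>\<^bsub>R\<^esub> m')" using r(1) by blast
    then show ?thesis using LR.frac_eq_iff[of "T s" "T a" m' m] sD(1) a m m' by simp
  qed
  show ?thesis unfolding loc_trace_def
  proof (intro equalityI UN_least)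
    fix m' s assume "m' \<in> carrier R - P" "s \<in> {s. (s, \<theta> m') \<in> LS.fr a (\<theta> m)}"
    then show "LR.fr (T s) m' \<subseteq> LR.fr (T a) m" using eq[of m' s] by simp
  next
    have "a \<in> {s. (s, \<theta> m) \<in> LS.fr a (\<theta> m)}"
      using LS.mem_frac_self[OF a \<theta>_fiber_mset[OF m]] by simp
    then show "LR.fr (T a) m
        \<subseteq> (\<Union>m'\<in>carrier R - P. \<Union>s\<in>{s. (s, \<theta> m') \<in> LS.fr a (\<theta> m)}. LR.fr (T s) m')"
      using m by (intro SUP_upper2[of m] SUP_upper2[of a] order.refl)
  qed
qed

lemma loc_trace_closed: "x \<in> carrier LS.L \<Longrightarrow> loc_trace R \<theta> T P x \<in> carrier LR.L"
  by (erule fiber_cases) (auto simp: loc_trace_frac)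

lemma loc_trace_add:
  assumes "x \<in> carrier LS.L" "y \<in> carrier LS.L"
  shows "loc_trace R \<theta> T P (x \<oplus>\<^bsub>LS.L\<^esub> y) = loc_trace R \<theta> T P x \<oplus>\<^bsub>LR.L\<^esub> loc_trace R \<theta> T P y"
proof -
  obtain a m where a: "x = LS.fr a (\<theta> m)" "a \<in> carrier S" "m \<in> carrier R - P" "\<theta> m \<in> fiber_mset R \<theta> P"
    by (rule fiber_cases[OF assms(1)])
  obtain b l where b: "y = LS.fr b (\<theta> l)" "b \<in> carrier S" "l \<in> carrier R - P" "\<theta> l \<in> fiber_mset R \<theta> P"
    by (rule fiber_cases[OF assms(2)])
  have ml: "m \<in> carrier R" "l \<in> carrier R" "m \<otimes>\<^bsub>R\<^esub> l \<in> carrier R - P" using a b LR.M_mult_closed by auto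
  have "x \<oplus>\<^bsub>LS.L\<^esub> y = LS.fr (a \<otimes> \<theta> l \<oplus> b \<otimes> \<theta> m) (\<theta> (m \<otimes>\<^bsub>R\<^esub> l))"
    using LS.add_frac[OF a(2,4) b(2,4)] a(1) b(1) ml by simp
  then have "loc_trace R \<theta> T P (x \<oplus>\<^bsub>LS.L\<^esub> y) = LR.fr (T (a \<otimes> \<theta> l \<oplus> b \<otimes> \<theta> m)) (m \<otimes>\<^bsub>R\<^esub> l)"
    using loc_trace_frac[OF _ ml(3)] a b ml by simp
  also have "T (a \<otimes> \<theta> l \<oplus> b \<otimes> \<theta> m) = T a \<otimes>\<^bsub>R\<^esub> l \<oplus>\<^bsub>R\<^esub> T b \<otimes>\<^bsub>R\<^esub> m"
    using T_linear[of l a] T_linear[of m b] a(2) b(2) ml by (simp add: T_add m_comm R.m_comm)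
  also have "LR.fr (T a \<otimes>\<^bsub>R\<^esub> l \<oplus>\<^bsub>R\<^esub> T b \<otimes>\<^bsub>R\<^esub> m) (m \<otimes>\<^bsub>R\<^esub> l) = LR.fr (T a) m \<oplus>\<^bsub>LR.L\<^esub> LR.fr (T b) l"
    using LR.add_frac[of "T a" m "T b" l] a b by simp
  finally show ?thesis using loc_trace_frac a b by simp
qed

lemma loc_trace_nilrad:
  "loc_trace R \<theta> T P ` fiber_nilrad R S \<theta> P \<subseteq> extend_loc R (carrier R - P) P"
  unfolding fiber_nilrad_eq extend_loc_R_eq
proof clarify
  fix x assume "x \<in> LS.fractions_of (trace_ideal S T P)"
  then obtain a s where a: "a \<in> trace_ideal S T P" "s \<in> fiber_mset R \<theta> P" "x = LS.fr a s"
    by (rule LS.fractions_ofE)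
  then obtain m where m: "m \<in> carrier R - P" "s = \<theta> m" by (auto simp: fiber_mset_def)
  have "a \<in> carrier S" using a(1) by (simp add: mem_trace_ideal_iff)
  then show "loc_trace R \<theta> T P x \<in> LR.fractions_of P"
    using loc_trace_frac[of a m] m a(3) LR.fractions_ofI[OF T_mem_if_mem_trace_ideal[OF a(1)] m(1)] by simp
qed

lemma loc_map_nilrad:
  "loc_map S (fiber_mset R \<theta> P) (p ^ e) \<psi> ` fiber_nilrad R S \<theta> P \<subseteq> fiber_nilrad R S \<theta> P"
  unfolding fiber_nilrad_eq
  by (rule LS.loc_map_fractions_of[OF \<psi> q_bounds(2) ideal_trace_ideal[OF P.is_ideal] \<psi>_trace_ideal[OF P]])

lemma loc_trace_loc_map:
  assumes "x \<in> carrier LS.L"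
  shows "loc_trace R \<theta> T P (loc_map S (fiber_mset R \<theta> P) (p ^ e) \<psi> x)
    = loc_map R (carrier R - P) (p ^ e) \<phi> (loc_trace R \<theta> T P x)"
proof -
  obtain a m where a: "x = LS.fr a (\<theta> m)" "a \<in> carrier S" "m \<in> carrier R - P" "\<theta> m \<in> fiber_mset R \<theta> P"
    by (rule fiber_cases[OF assms])
  let ?k = "p ^ e - 1"
  have mR: "m \<in> carrier R" using a by blast
  have "a \<otimes> \<theta> m [^] ?k = \<theta> (m [^]\<^bsub>R\<^esub> ?k) \<otimes> a" using a mR by (simp add: m_comm \<theta>.hom_nat_pow)
  then have "T (a \<otimes> \<theta> m [^] ?k) = T a \<otimes>\<^bsub>R\<^esub> m [^]\<^bsub>R\<^esub> ?k"
    using T_linear[of "m [^]\<^bsub>R\<^esub> ?k" a] a mR by (simp add: R.m_comm)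
  moreover have "a \<otimes> \<theta> m [^] ?k \<in> carrier S" using a mR by simp
  ultimately show ?thesis
    using LS.loc_map_frac[OF \<psi> q_bounds(2) a(2,4)] LR.loc_map_frac[OF \<phi> q_bounds(2), of "T a" m]
      loc_trace_frac[OF _ a(3)] a(1,2,3) \<psi>_closed transpose by simp
qed

lemma ideal_nilrad: "ideal (fiber_nilrad R S \<theta> P) LS.L"
  unfolding fiber_nilrad_eq by (rule LS.ideal_fractions_of[OF ideal_trace_ideal[OF P.is_ideal]])

lemma ideal_extend_loc_R: "ideal (extend_loc R (carrier R - P) P) LR.L"
  unfolding extend_loc_R_eq by (rule LR.ideal_fractions_of[OF P.is_ideal])

lemma fiber_map_coset:
  assumes "x \<in> carrier LS.L"
  shows "fiber_map R S \<theta> (p ^ e) \<psi> P (fiber_nilrad R S \<theta> P +>\<^bsub>LS.L\<^esub> x)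
    = fiber_nilrad R S \<theta> P +>\<^bsub>LS.L\<^esub> loc_map S (fiber_mset R \<theta> P) (p ^ e) \<psi> x"
  unfolding fiber_map_def
  by (rule quot_map_coset[OF ideal_nilrad ideal_nilrad LS.loc_map_closed[OF \<psi> q_bounds(2)]
        LS.loc_map_add[OF \<psi> q_bounds(2)] loc_map_nilrad assms])

lemma fiber_trace_coset:
  assumes "x \<in> carrier LS.L"
  shows "fiber_trace R \<theta> T P (fiber_nilrad R S \<theta> P +>\<^bsub>LS.L\<^esub> x)
    = extend_loc R (carrier R - P) P +>\<^bsub>LR.L\<^esub> loc_trace R \<theta> T P x"
  unfolding fiber_trace_def
  by (rule quot_map_coset[OF ideal_nilrad ideal_extend_loc_R loc_trace_closed loc_trace_add
        loc_trace_nilrad assms])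

lemma carrier_reduced_fiber:
  "carrier (reduced_fiber R S \<theta> P) = (\<lambda>x. fiber_nilrad R S \<theta> P +>\<^bsub>LS.L\<^esub> x) ` carrier LS.L"
  by (auto simp: reduced_fiber_def FactRing_def A_RCOSETS_def')

lemma fiber_trace_fiber_map:
  assumes "x \<in> carrier (reduced_fiber R S \<theta> P)"
  shows "fiber_trace R \<theta> T P (fiber_map R S \<theta> (p ^ e) \<psi> P x)
    = residue_map R (p ^ e) \<phi> P (fiber_trace R \<theta> T P x)"
proof -
  obtain y where y: "y \<in> carrier LS.L" "x = fiber_nilrad R S \<theta> P +>\<^bsub>LS.L\<^esub> y"
    using assms carrier_reduced_fiber by auto
  show ?thesis unfolding y(2)
    using fiber_map_coset[OF y(1)] fiber_trace_coset[OF y(1)] fiber_trace_coset loc_trace_loc_map[OF y(1)]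
      LS.loc_map_closed[OF \<psi> q_bounds(2) y(1)]
      residue_map_coset[OF R.is_cring \<phi> q_bounds(2) P loc_trace_closed[OF y(1)]] by simp
qed

text \<open>With \<open>\<psi>(d) = 1\<close>, the fraction \<open>a\<^sup>q d / s\<^sup>q\<close> is mapped to \<open>a / s\<close>.\<close>

lemma fiber_map_surj:
  "fiber_map R S \<theta> (p ^ e) \<psi> P ` carrier (reduced_fiber R S \<theta> P) = carrier (reduced_fiber R S \<theta> P)"
proof -
  obtain d where d: "d \<in> carrier S" "\<psi> d = \<one>" using \<psi>_takes_one by blast
  have "\<exists>x\<in>carrier LS.L. loc_map S (fiber_mset R \<theta> P) (p ^ e) \<psi> x = y" if y: "y \<in> carrier LS.L" for y
  proof -
    obtain a s where a: "y = LS.fr a s" "a \<in> carrier S" "s \<in> fiber_mset R \<theta> P"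
      using y by (rule LS.frac_cases)
    have sS: "s \<in> carrier S" using a by blast
    let ?w = "s [^] (p ^ e)"
    have w: "?w \<in> fiber_mset R \<theta> P" using a(3) by simp
    have "?w [^] (p ^ e - 1) = (s [^] (p ^ e - 1)) [^] (p ^ e)" using sS by (simp add: nat_pow_pow mult.commute)
    then have "(a [^] (p ^ e) \<otimes> d) \<otimes> ?w [^] (p ^ e - 1) = (a \<otimes> s [^] (p ^ e - 1)) [^] (p ^ e) \<otimes> d"
      using a(2) sS d(1) by (simp add: nat_pow_distrib m_ac)
    then have "\<psi> ((a [^] (p ^ e) \<otimes> d) \<otimes> ?w [^] (p ^ e - 1)) = a \<otimes> s [^] (p ^ e - 1)"
      using \<psi>_linear[OF d(1), of "a \<otimes> s [^] (p ^ e - 1)"] a(2) sS d(2) by simp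
    then have "loc_map S (fiber_mset R \<theta> P) (p ^ e) \<psi> (LS.fr (a [^] (p ^ e) \<otimes> d) ?w)
        = LS.fr (a \<otimes> s [^] (p ^ e - 1)) ?w"
      using LS.loc_map_frac[OF \<psi> q_bounds(2) _ w, of "a [^] (p ^ e) \<otimes> d"] a(2) d(1) by simp
    also have "\<dots> = LS.fr a s"
      using a(2,3) sS w pow_q_Suc(1)[OF sS] by (intro LS.frac_eqI) (auto simp: m_ac)
    finally show ?thesis using a(1,2) d(1) w by (intro bexI[of _ "LS.fr (a [^] (p ^ e) \<otimes> d) ?w"]) auto
  qed
  then show ?thesis using fiber_map_coset LS.loc_map_closed[OF \<psi> q_bounds(2)]
    unfolding carrier_reduced_fiber image_image by (auto simp: image_iff)
qed

end

lemma fibered_transposition: "fibered R S \<theta> T (p ^ e) \<phi> \<psi>"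
proof -
  \<comment> \<open>no compatible prime has a vanishing residue map, so the clause on such primes is vacuous\<close>
  have nz: "\<not> zero_on (residue_field R P) (residue_map R (p ^ e) \<phi> P)" if "P \<in> CSpec R \<phi>" for P
    using Schpec_R that by (auto simp: Schpec_def)
  have rad: "radical S (trace_ideal S T P) = trace_ideal S T P" if P: "P \<in> CSpec R \<phi>" for P
  proof
    show "radical S (trace_ideal S T P) \<subseteq> trace_ideal S T P"
      using trace_ideal_radical[OF P] by (auto simp: radical_def)
    show "trace_ideal S T P \<subseteq> radical S (trace_ideal S T P)"
    proof
      fix x assume x: "x \<in> trace_ideal S T P"
      then have xS: "x \<in> carrier S" by (simp add: mem_trace_ideal_iff)
      then have "x [^] (1::nat) \<in> trace_ideal S T P" using x by simp
      then show "x \<in> radical S (trace_ideal S T P)" using xS unfolding radical_def by blast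
    qed
  qed
  show ?thesis
    unfolding fibered_def
    using \<beta>_contraction_subset rad loc_map_nilrad loc_trace_nilrad fiber_trace_fiber_map fiber_map_surj nz
    by (simp add: spec_def)
qed

subsection \<open>Homeomorphism for \<open>p\<close>-groups\<close>

text \<open>For a \<open>p\<close>-group the image of a large power of \<open>q\<close> is trivial and the projection that preserves \<open>Q\<close> is
  the trace. So \<open>T(Q S)\<close> lies in the contraction, which is one inclusion; the other holds for
  all primes of \<open>S\<close>.\<close>

lemma CSpec_eq_trace_ideal:
  assumes n: "order \<Gamma> = p ^ n" and Q: "Q \<in> CSpec S \<psi>"
  shows "Q = trace_ideal S T (contraction R \<theta> Q)"
proof
  let ?H = "(\<lambda>\<gamma>. \<gamma> [^]\<^bsub>\<Gamma>\<^esub> ((p ^ e) ^ n)) ` carrier \<Gamma>"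
  interpret Q: primeideal Q S using Q by (auto simp: CSpec_def spec_def)
  have "\<gamma> [^]\<^bsub>\<Gamma>\<^esub> ((p ^ e) ^ n) = \<one>\<^bsub>\<Gamma>\<^esub>" if g: "\<gamma> \<in> carrier \<Gamma>" for \<gamma>
  proof -
    have "e * n = n + (e - 1) * n" using e by (cases e) simp_all
    then have "(p ^ e) ^ n = p ^ (n + (e - 1) * n)" by (simp flip: power_mult)
    then have "(p ^ e) ^ n = order \<Gamma> * p ^ ((e - 1) * n)" by (simp add: power_add n)
    then show ?thesis
      using G.nat_pow_pow[OF g, of "order \<Gamma>" "p ^ ((e - 1) * n)"] G.pow_order_eq_1[OF g] by simp
  qed
  then have H: "?H = {\<one>\<^bsub>\<Gamma>\<^esub>}" using G.one_closed by auto
  have TQ: "\<theta> (T x) \<in> Q" if x: "x \<in> Q" for x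
  proof -
    have xS: "x \<in> carrier S" using x Q.Icarr by blast
    have "prs {\<one>\<^bsub>\<Gamma>\<^esub>} x = \<theta> (T x)" unfolding prs_def using xS by (simp add: pr_one)
    then show ?thesis using prs_iterate_mem[OF Q x, of n] H by simp
  qed
  show "Q \<subseteq> trace_ideal S T (contraction R \<theta> Q)"
  proof
    fix x assume x: "x \<in> Q"
    then have xS: "x \<in> carrier S" using Q.Icarr by blast
    have "T (t \<otimes> x) \<in> contraction R \<theta> Q" if "t \<in> carrier S" for t
      using TQ[OF Q.I_l_closed[OF x that]] that xS by (simp add: contraction_def)
    then show "x \<in> trace_ideal S T (contraction R \<theta> Q)" using xS by (simp add: mem_trace_ideal_iff)
  qed
  show "trace_ideal S T (contraction R \<theta> Q) \<subseteq> Q"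
    using primeideal.axioms(1)[OF primeideal_contraction[OF Q.primeideal]] Q.primeideal
    by (rule trace_ideal_subset_prime) (auto simp: contraction_def)
qed

lemma contraction_trace_ideal:
  assumes n: "order \<Gamma> = p ^ n" and P: "P \<in> CSpec R \<phi>"
  shows "trace_ideal S T P \<in> CSpec S \<psi>" and "contraction R \<theta> (trace_ideal S T P) = P"
proof -
  obtain Q where Q: "Q \<in> primes_over R S \<theta> P" using primes_over_nonempty[OF CSpec_R_D(1)[OF P]] by blast
  then have "Q \<in> CSpec S \<psi>" "contraction R \<theta> Q = P" using CSpec_over[OF P] by (auto simp: primes_over_def)
  then show "trace_ideal S T P \<in> CSpec S \<psi>" and "contraction R \<theta> (trace_ideal S T P) = P"
    using CSpec_eq_trace_ideal[OF n] by auto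
qed

text \<open>The inverse \<open>P \<mapsto> P\<^sup>T\<close> is continuous because \<open>E \<subseteq> P\<^sup>T\<close> is equivalent to \<open>T(E S) \<subseteq> P\<close>.\<close>

lemma homeomorphic_contraction:
  assumes n: "order \<Gamma> = p ^ n"
  shows "homeomorphic_map (schpec_space S (p ^ e) \<psi>) (schpec_space R (p ^ e) \<phi>) (contraction R \<theta>)"
proof -
  let ?X = "schpec_space S (p ^ e) \<psi>" and ?Y = "schpec_space R (p ^ e) \<phi>"
  note sp = topspace_schpec_space[OF is_cring, of "p ^ e" \<psi>] topspace_schpec_space[OF R.is_cring, of "p ^ e" \<phi>]
  have "continuous_map ?X ?Y (contraction R \<theta>)"
    unfolding continuous_map_def sp Schpec_R Schpec_S openin_schpec_space
  proof (intro conjI allI impI)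
    show "contraction R \<theta> \<in> CSpec S \<psi> \<rightarrow> CSpec R \<phi>" using CSpec_contraction by blast
    fix U assume "\<exists>E\<subseteq>carrier R. U = {P \<in> CSpec R \<phi>. \<not> E \<subseteq> P}"
    then obtain E where E: "E \<subseteq> carrier R" "U = {P \<in> CSpec R \<phi>. \<not> E \<subseteq> P}" by blast
    have "{Q \<in> CSpec S \<psi>. contraction R \<theta> Q \<in> U} = {Q \<in> CSpec S \<psi>. \<not> \<theta> ` E \<subseteq> Q}"
      unfolding E(2) using CSpec_contraction E(1) by (auto simp: contraction_def)
    moreover have "\<theta> ` E \<subseteq> carrier S" using E(1) by auto
    ultimately show "\<exists>F\<subseteq>carrier S. {Q \<in> CSpec S \<psi>. contraction R \<theta> Q \<in> U} = {Q \<in> CSpec S \<psi>. \<not> F \<subseteq> Q}"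
      by blast
  qed
  moreover have "continuous_map ?Y ?X (trace_ideal S T)"
    unfolding continuous_map_def sp Schpec_R Schpec_S openin_schpec_space
  proof (intro conjI allI impI)
    show "trace_ideal S T \<in> CSpec R \<phi> \<rightarrow> CSpec S \<psi>" using contraction_trace_ideal(1)[OF n] by blast
    fix U assume "\<exists>E\<subseteq>carrier S. U = {Q \<in> CSpec S \<psi>. \<not> E \<subseteq> Q}"
    then obtain E where E: "E \<subseteq> carrier S" "U = {Q \<in> CSpec S \<psi>. \<not> E \<subseteq> Q}" by blast
    let ?F = "{T (t \<otimes> s) | t s. t \<in> carrier S \<and> s \<in> E}"
    have "E \<subseteq> trace_ideal S T P \<longleftrightarrow> ?F \<subseteq> P" for P
      using E(1) by (auto simp: subset_iff mem_trace_ideal_iff)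
    then have "{P \<in> CSpec R \<phi>. trace_ideal S T P \<in> U} = {P \<in> CSpec R \<phi>. \<not> ?F \<subseteq> P}"
      unfolding E(2) using contraction_trace_ideal(1)[OF n] by blast
    moreover have "?F \<subseteq> carrier R" using E(1) by auto
    ultimately show "\<exists>F\<subseteq>carrier R. {P \<in> CSpec R \<phi>. trace_ideal S T P \<in> U} = {P \<in> CSpec R \<phi>. \<not> F \<subseteq> P}"
      by blast
  qed
  ultimately have "homeomorphic_maps ?X ?Y (contraction R \<theta>) (trace_ideal S T)"
    unfolding homeomorphic_maps_def sp Schpec_R Schpec_S
    using CSpec_eq_trace_ideal[OF n] contraction_trace_ideal(2)[OF n] by auto
  then show ?thesis using homeomorphic_map_maps by blast
qed

end

section \<open>Divisorial algebras\<close>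

text \<open>A proper factorization of the characteristic would give zero divisors.\<close>

lemma (in field) prime_ring_char:
  assumes "ring_char R = p" "0 < p"
  shows "Factorial_Ring.prime p" and "[p] \<cdot> \<one> = \<zero>"
proof -
  let ?Z = "\<lambda>n::nat. 0 < n \<and> [n] \<cdot> \<one> = \<zero>"
  have ex: "\<exists>n. ?Z n" and p: "p = (LEAST n. ?Z n)"
    using assms unfolding ring_char_def by (metis less_irrefl)+
  have Zp: "?Z p" unfolding p by (rule LeastI_ex[OF ex])
  then show "[p] \<cdot> \<one> = \<zero>" by simp
  have least: "\<not> ?Z n" if "n < p" for n using that not_less_Least unfolding p by blast
  have "p \<noteq> 1" using Zp by auto
  then have "1 < p" using assms(2) by linarith
  moreover have "m = 1 \<or> m = p" if m: "m dvd p" for m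
  proof (rule ccontr)
    assume neg: "\<not> (m = 1 \<or> m = p)"
    obtain l where l: "p = m * l" using m by blast
    have pos: "0 < m" "0 < l" using assms(2) l by auto
    have "m < p" using dvd_imp_le[OF m assms(2)] neg by linarith
    have "1 < m" using neg pos by linarith
    then have "l < p" using n_less_m_mult_n[OF pos(2), of m] l by simp
    have "([m] \<cdot> \<one>) \<otimes> ([l] \<cdot> \<one>) = [m] \<cdot> ([l] \<cdot> \<one>)" by (simp add: add_pow_ldistr)
    also have "\<dots> = \<zero>" using Zp l by (simp add: add.nat_pow_pow mult.commute)
    finally have "[m] \<cdot> \<one> = \<zero> \<or> [l] \<cdot> \<one> = \<zero>" by (simp add: integral_iff)
    then show False using least \<open>m < p\<close> \<open>l < p\<close> pos by blast
  qed
  ultimately show "Factorial_Ring.prime p" by (simp add: prime_nat_iff)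
qed

lemma ring_hom_nat_multiple:
  assumes "ring k" "ring R" "h \<in> ring_hom k R"
  shows "h ([(n::nat)] \<cdot>\<^bsub>k\<^esub> \<one>\<^bsub>k\<^esub>) = [n] \<cdot>\<^bsub>R\<^esub> \<one>\<^bsub>R\<^esub>"
proof -
  interpret h: ring_hom_ring k R h by (rule ring_hom_ringI2[OF assms])
  show ?thesis by (induction n) (simp_all add: h.R.add.nat_pow_Suc h.S.add.nat_pow_Suc)
qed

text \<open>A nonunit generates a proper ideal, and a maximal element among the proper ideals containing it is
  the maximal ideal.\<close>

lemma local_ring_Units:
  fixes R (structure)
  assumes "noetherian_ring R" "local_ring R \<mm>" "r \<in> carrier R" "r \<notin> \<mm>"
  shows "r \<in> Units R"
proof (rule ccontr)
  interpret cring R using assms(2) by (simp add: local_ring_def)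
  assume not_unit: "r \<notin> Units R"
  let ?F = "{J. ideal J R \<and> r \<in> J \<and> \<one> \<notin> J}"
  have "\<one> \<notin> PIdl r"
  proof
    assume "\<one> \<in> PIdl r"
    then obtain x where "x \<in> carrier R" "\<one> = x \<otimes> r" by (auto simp: cgenideal_def)
    then show False using not_unit assms(3) m_comm[of x r] unfolding Units_def by auto
  qed
  then have "PIdl r \<in> ?F" using cgenideal_ideal[OF assms(3)] cgenideal_self[OF assms(3)] by simp
  then have "\<exists>J\<in>?F. \<forall>J'\<in>?F. J \<subseteq> J' \<longrightarrow> J' = J"
    by (intro noetherian_ring.exists_maximal_ideal_in[OF assms(1)]) auto
  then obtain J where J: "ideal J R" "r \<in> J" "\<one> \<notin> J"
    and max: "\<And>J'. ideal J' R \<Longrightarrow> r \<in> J' \<Longrightarrow> \<one> \<notin> J' \<Longrightarrow> J \<subseteq> J' \<Longrightarrow> J' = J" by auto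
  have "maximalideal J R"
  proof (rule maximalidealI[OF J(1)])
    show "carrier R \<noteq> J" using J(3) by auto
    fix J' assume J': "ideal J' R" "J \<subseteq> J'" "J' \<subseteq> carrier R"
    then show "J' = J \<or> J' = carrier R" using max[of J'] J(2) ideal.one_imp_carrier[OF J'(1)] by blast
  qed
  then show False using assms(2,4) J(2) by (auto simp: local_ring_def)
qed

locale divisorial_algebra_data = normal_noetherian_domain K A + G: comm_group \<Gamma>
  for K (structure) and A and \<Gamma> :: "('g, 'n) monoid_scheme" +
  fixes D :: "'g \<Rightarrow> ('a set \<Rightarrow>\<^sub>0 int)" and \<kappa> :: "'g \<Rightarrow> 'g \<Rightarrow> 'a"
  assumes finite_\<Gamma> [simp]: "finite (carrier \<Gamma>)" and data: "divisorial_data K A \<Gamma> D \<kappa>"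
begin

abbreviation "S \<equiv> divisorial_algebra K A \<Gamma> D \<kappa>"
abbreviation "\<theta> \<equiv> deg0_incl K \<Gamma>"

definition component :: "'g \<Rightarrow> ('g \<Rightarrow> 'a) \<Rightarrow> 'g \<Rightarrow> 'a" where
  "component \<gamma> s = (\<lambda>\<delta>\<in>carrier \<Gamma>. if \<delta> = \<gamma> then s \<gamma> else \<zero>)"

sublocale S: cring S using data by (simp add: divisorial_data_def)

lemma \<kappa>: "\<gamma> \<in> carrier \<Gamma> \<Longrightarrow> \<delta> \<in> carrier \<Gamma> \<Longrightarrow> \<kappa> \<gamma> \<delta> \<in> carrier K \<and> \<kappa> \<gamma> \<delta> \<noteq> \<zero>"
  and div_\<kappa>: "\<gamma> \<in> carrier \<Gamma> \<Longrightarrow> \<delta> \<in> carrier \<Gamma> \<Longrightarrow>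
    div_of K A (\<kappa> \<gamma> \<delta>) + D (\<gamma> \<otimes>\<^bsub>\<Gamma>\<^esub> \<delta>) = D \<gamma> + D \<delta>"
  and D_one: "D \<one>\<^bsub>\<Gamma>\<^esub> = 0"
  using data by (auto simp: divisorial_data_def)

lemma mem_S_iff:
  "s \<in> carrier S \<longleftrightarrow> (\<forall>\<gamma>\<in>carrier \<Gamma>. s \<gamma> \<in> sections K A (D \<gamma>)) \<and> s \<in> extensional (carrier \<Gamma>)"
  by (auto simp: divisorial_algebra_def PiE_def)

lemma S_section: "s \<in> carrier S \<Longrightarrow> \<gamma> \<in> carrier \<Gamma> \<Longrightarrow> s \<gamma> \<in> sections K A (D \<gamma>)"
  by (simp add: mem_S_iff)

lemma S_value [simp]: "s \<in> carrier S \<Longrightarrow> \<gamma> \<in> carrier \<Gamma> \<Longrightarrow> s \<gamma> \<in> carrier K"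
  using S_section sections_carrier by blast

lemma S_eqI:
  "s \<in> extensional (carrier \<Gamma>) \<Longrightarrow> t \<in> extensional (carrier \<Gamma>) \<Longrightarrow>
    (\<And>\<gamma>. \<gamma> \<in> carrier \<Gamma> \<Longrightarrow> s \<gamma> = t \<gamma>) \<Longrightarrow> s = t"
  by (rule extensionalityI)

lemma S_ext: "s \<in> carrier S \<Longrightarrow> s \<in> extensional (carrier \<Gamma>)"
  by (simp add: mem_S_iff)

lemma add_S [simp]: "\<gamma> \<in> carrier \<Gamma> \<Longrightarrow> (s \<oplus>\<^bsub>S\<^esub> t) \<gamma> = s \<gamma> \<oplus> t \<gamma>"
  and zero_S [simp]: "\<gamma> \<in> carrier \<Gamma> \<Longrightarrow> \<zero>\<^bsub>S\<^esub> \<gamma> = \<zero>"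
  and one_S: "\<one>\<^bsub>S\<^esub> = \<theta> \<one>"
  and mult_S: "\<delta> \<in> carrier \<Gamma> \<Longrightarrow> (s \<otimes>\<^bsub>S\<^esub> t) \<delta> =
    (\<Oplus>\<gamma>\<in>carrier \<Gamma>. \<kappa> \<gamma> (inv\<^bsub>\<Gamma>\<^esub> \<gamma> \<otimes>\<^bsub>\<Gamma>\<^esub> \<delta>) \<otimes> (s \<gamma> \<otimes> t (inv\<^bsub>\<Gamma>\<^esub> \<gamma> \<otimes>\<^bsub>\<Gamma>\<^esub> \<delta>)))"
  by (simp_all add: divisorial_algebra_def deg0_incl_def)

lemma component_closed [simp]: "s \<in> carrier S \<Longrightarrow> \<gamma> \<in> carrier \<Gamma> \<Longrightarrow> component \<gamma> s \<in> carrier S"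
  by (auto simp: mem_S_iff component_def mem_sections_iff)

lemma component_apply [simp]: "\<delta> \<in> carrier \<Gamma> \<Longrightarrow> component \<gamma> s \<delta> = (if \<delta> = \<gamma> then s \<gamma> else \<zero>)"
  by (simp add: component_def)

lemma component_ext [simp]: "component \<gamma> s \<in> extensional (carrier \<Gamma>)"
  by (simp add: component_def)

lemma component_mult:
  assumes s: "s \<in> carrier S" "t \<in> carrier S" and g: "\<gamma> \<in> carrier \<Gamma>" and d: "\<delta> \<in> carrier \<Gamma>"
  shows "(component \<gamma> s \<otimes>\<^bsub>S\<^esub> t) \<delta>
    = \<kappa> \<gamma> (inv\<^bsub>\<Gamma>\<^esub> \<gamma> \<otimes>\<^bsub>\<Gamma>\<^esub> \<delta>) \<otimes> (s \<gamma> \<otimes> t (inv\<^bsub>\<Gamma>\<^esub> \<gamma> \<otimes>\<^bsub>\<Gamma>\<^esub> \<delta>))"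
proof -
  have "(component \<gamma> s \<otimes>\<^bsub>S\<^esub> t) \<delta>
      = (\<Oplus>\<gamma>'\<in>{\<gamma>}. \<kappa> \<gamma>' (inv\<^bsub>\<Gamma>\<^esub> \<gamma>' \<otimes>\<^bsub>\<Gamma>\<^esub> \<delta>) \<otimes> (component \<gamma> s \<gamma>' \<otimes> t (inv\<^bsub>\<Gamma>\<^esub> \<gamma>' \<otimes>\<^bsub>\<Gamma>\<^esub> \<delta>)))"
    unfolding mult_S[OF d] using s g d \<kappa> by (intro add.finprod_mono_neutral_cong_right) auto
  then show ?thesis using s g d \<kappa> by simp
qed

text \<open>This is the unit law \<open>1 \<cdot> 1 = 1\<close> of \<open>S\<close>, read in degree one.\<close>

lemma \<kappa>_one: "\<kappa> \<one>\<^bsub>\<Gamma>\<^esub> \<one>\<^bsub>\<Gamma>\<^esub> = \<one>"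
proof -
  have one: "component \<one>\<^bsub>\<Gamma>\<^esub> \<one>\<^bsub>S\<^esub> = \<one>\<^bsub>S\<^esub>"
    by (rule S_eqI) (auto simp: one_S deg0_incl_def)
  have "\<one>\<^bsub>S\<^esub> \<one>\<^bsub>\<Gamma>\<^esub> = (component \<one>\<^bsub>\<Gamma>\<^esub> \<one>\<^bsub>S\<^esub> \<otimes>\<^bsub>S\<^esub> \<one>\<^bsub>S\<^esub>) \<one>\<^bsub>\<Gamma>\<^esub>" unfolding one by simp
  also have "\<dots> = \<kappa> \<one>\<^bsub>\<Gamma>\<^esub> \<one>\<^bsub>\<Gamma>\<^esub> \<otimes> (\<one>\<^bsub>S\<^esub> \<one>\<^bsub>\<Gamma>\<^esub> \<otimes> \<one>\<^bsub>S\<^esub> \<one>\<^bsub>\<Gamma>\<^esub>)"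
    using component_mult[OF S.one_closed S.one_closed G.one_closed G.one_closed] by simp
  finally show ?thesis using \<kappa>[OF G.one_closed G.one_closed] by (simp add: one_S deg0_incl_def)
qed

lemma \<theta>_apply [simp]: "\<gamma> \<in> carrier \<Gamma> \<Longrightarrow> \<theta> r \<gamma> = (if \<gamma> = \<one>\<^bsub>\<Gamma>\<^esub> then r else \<zero>)"
  by (simp add: deg0_incl_def)

lemma \<theta>_ext: "\<theta> r \<in> extensional (carrier \<Gamma>)"
  by (simp add: deg0_incl_def)

lemma \<theta>_closed [simp]: "r \<in> A \<Longrightarrow> \<theta> r \<in> carrier S"
proof -
  assume "r \<in> A"
  then have "r \<in> sections K A (D \<one>\<^bsub>\<Gamma>\<^esub>)" by (simp add: D_one sections_zero)
  moreover have "\<zero> \<in> sections K A (D \<gamma>)" for \<gamma> by (simp add: mem_sections_iff)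
  ultimately show ?thesis by (auto simp: mem_S_iff \<theta>_ext)
qed

lemma component_\<theta>: "component \<one>\<^bsub>\<Gamma>\<^esub> (\<theta> r) = \<theta> r"
  by (rule S_eqI) (auto simp: \<theta>_ext)

lemma \<theta>_mult_apply:
  assumes "r \<in> A" "s \<in> carrier S" "\<gamma> \<in> carrier \<Gamma>"
  shows "(\<theta> r \<otimes>\<^bsub>S\<^esub> s) \<gamma> = \<kappa> \<one>\<^bsub>\<Gamma>\<^esub> \<gamma> \<otimes> (r \<otimes> s \<gamma>)"
  using component_mult[of "\<theta> r" s "\<one>\<^bsub>\<Gamma>\<^esub>" \<gamma>] assms by (simp add: component_\<theta>)

lemma \<theta>_ring_hom: "\<theta> \<in> ring_hom (sub K A) S"
proof (rule ring_hom_memI; simp)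
  fix a b assume ab: "a \<in> A" "b \<in> A"
  show "\<theta> (a \<otimes> b) = \<theta> a \<otimes>\<^bsub>S\<^esub> \<theta> b"
    by (rule S_eqI) (use ab \<kappa> in \<open>auto simp: \<theta>_ext S_ext \<theta>_mult_apply \<kappa>_one\<close>)
  show "\<theta> (a \<oplus> b) = \<theta> a \<oplus>\<^bsub>S\<^esub> \<theta> b"
    by (rule S_eqI) (use ab in \<open>auto simp: \<theta>_ext S_ext\<close>)
qed (simp add: one_S)

lemma finsum_S_apply:
  assumes "\<And>i. i \<in> I \<Longrightarrow> f i \<in> carrier S" "\<gamma> \<in> carrier \<Gamma>"
  shows "(finsum S f I) \<gamma> = (\<Oplus>i\<in>I. f i \<gamma>)"
  using assms(1)
proof (induction I rule: infinite_finite_induct)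
  case (insert i I)
  then have "f \<in> I \<rightarrow> carrier S" "(\<lambda>i. f i \<gamma>) \<in> I \<rightarrow> carrier K" using assms(2) by auto
  then show ?case using insert assms(2) by simp
qed (use assms(2) in auto)

text \<open>In the degree where it can live, the power is a product of nonzero elements of the field \<open>K\<close>.\<close>

lemma component_pow_nonzero:
  assumes s: "s \<in> carrier S" and g: "\<gamma> \<in> carrier \<Gamma>" and nz: "s \<gamma> \<noteq> \<zero>"
  shows "(component \<gamma> s [^]\<^bsub>S\<^esub> (n::nat)) (\<gamma> [^]\<^bsub>\<Gamma>\<^esub> n) \<noteq> \<zero>"
proof (induction n)
  case 0
  then show ?case by (simp add: one_S)
next
  case (Suc n)
  let ?x = "component \<gamma> s" and ?d = "\<gamma> [^]\<^bsub>\<Gamma>\<^esub> n"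
  have x: "?x \<in> carrier S" "?x [^]\<^bsub>S\<^esub> n \<in> carrier S" "?d \<in> carrier \<Gamma>" using s g by auto
  have "?x [^]\<^bsub>S\<^esub> Suc n = ?x \<otimes>\<^bsub>S\<^esub> ?x [^]\<^bsub>S\<^esub> n" using x by (simp add: S.m_comm)
  moreover have "\<gamma> [^]\<^bsub>\<Gamma>\<^esub> Suc n = \<gamma> \<otimes>\<^bsub>\<Gamma>\<^esub> ?d" using g by (simp add: G.m_comm)
  moreover have "inv\<^bsub>\<Gamma>\<^esub> \<gamma> \<otimes>\<^bsub>\<Gamma>\<^esub> (\<gamma> \<otimes>\<^bsub>\<Gamma>\<^esub> ?d) = ?d" using g by (simp flip: G.m_assoc)
  ultimately have "(?x [^]\<^bsub>S\<^esub> Suc n) (\<gamma> [^]\<^bsub>\<Gamma>\<^esub> Suc n) = \<kappa> \<gamma> ?d \<otimes> (s \<gamma> \<otimes> (?x [^]\<^bsub>S\<^esub> n) ?d)"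
    using component_mult[OF s x(2) g, of "\<gamma> \<otimes>\<^bsub>\<Gamma>\<^esub> ?d"] g x by simp
  then show ?case using Suc nz \<kappa>[OF g x(3)] s g x by (simp add: nonzero_mult)
qed

lemma graded_algebra_S: "graded_algebra S (sub K A) \<Gamma> \<theta> (deg0_proj \<Gamma>) component"
proof (intro graded_algebra.intro graded_algebra_axioms.intro)
  show "cring S" "cring (sub K A)" "comm_group \<Gamma>" "finite (carrier \<Gamma>)" "\<theta> \<in> ring_hom (sub K A) S"
    by (simp_all add: S.is_cring A.is_cring G.comm_group_axioms \<theta>_ring_hom)
  fix s t :: "'g \<Rightarrow> 'a" assume s: "s \<in> carrier S"
  show "deg0_proj \<Gamma> s \<in> carrier (sub K A)"
    using S_section[OF s G.one_closed] sections_zero by (simp add: deg0_proj_def D_one)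
  show "(\<Oplus>\<^bsub>S\<^esub>\<gamma>\<in>carrier \<Gamma>. component \<gamma> s) = s"
  proof (rule S_eqI)
    have c: "(\<Oplus>\<^bsub>S\<^esub>\<gamma>\<in>carrier \<Gamma>. component \<gamma> s) \<in> carrier S" using s by (intro S.finsum_closed) auto
    show "(\<Oplus>\<^bsub>S\<^esub>\<gamma>\<in>carrier \<Gamma>. component \<gamma> s) \<in> extensional (carrier \<Gamma>)" by (rule S_ext[OF c])
    show "s \<in> extensional (carrier \<Gamma>)" by (rule S_ext[OF s])
    fix \<delta> assume d: "\<delta> \<in> carrier \<Gamma>"
    have "(\<Oplus>\<^bsub>S\<^esub>\<gamma>\<in>carrier \<Gamma>. component \<gamma> s) \<delta> = (\<Oplus>\<gamma>\<in>carrier \<Gamma>. component \<gamma> s \<delta>)"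
      using s d by (intro finsum_S_apply) auto
    also have "\<dots> = (\<Oplus>\<gamma>\<in>carrier \<Gamma>. if \<delta> = \<gamma> then s \<gamma> else \<zero>)"
      using s d by (intro add.finprod_cong') auto
    also have "\<dots> = s \<delta>" using s d by (intro add.finprod_singleton) auto
    finally show "(\<Oplus>\<^bsub>S\<^esub>\<gamma>\<in>carrier \<Gamma>. component \<gamma> s) \<delta> = s \<delta>" .
  qed
  show "component \<one>\<^bsub>\<Gamma>\<^esub> s = \<theta> (deg0_proj \<Gamma> s)"
    by (simp add: component_def deg0_incl_def deg0_proj_def)
  show "deg0_proj \<Gamma> (\<theta> r \<otimes>\<^bsub>S\<^esub> s) = r \<otimes>\<^bsub>sub K A\<^esub> deg0_proj \<Gamma> s" if "r \<in> carrier (sub K A)" for r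
    using that s by (simp add: deg0_proj_def \<theta>_mult_apply \<kappa>_one)
  fix \<gamma> assume g: "\<gamma> \<in> carrier \<Gamma>"
  show "component \<gamma> s \<in> carrier S" using s g by simp
  show "component \<gamma> s = \<zero>\<^bsub>S\<^esub>" if "component \<gamma> s [^]\<^bsub>S\<^esub> (n::nat) = \<zero>\<^bsub>S\<^esub>" for n
  proof (cases "s \<gamma> = \<zero>")
    case True
    show ?thesis by (rule S_eqI) (use True in \<open>auto simp: S_ext\<close>)
  next
    case False
    then show ?thesis using component_pow_nonzero[OF s g False, of n] that g by simp
  qed
  show "component \<gamma> (component \<delta> s) = (if \<gamma> = \<delta> then component \<delta> s else \<zero>\<^bsub>S\<^esub>)"
    if "\<delta> \<in> carrier \<Gamma>" for \<delta>
    by (rule S_eqI) (use g that in \<open>auto simp: S_ext\<close>)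
  assume t: "t \<in> carrier S"
  show "component \<gamma> (s \<oplus>\<^bsub>S\<^esub> t) = component \<gamma> s \<oplus>\<^bsub>S\<^esub> component \<gamma> t"
    by (rule S_eqI) (use s t g in \<open>auto simp: S_ext\<close>)
  show "component (\<gamma> \<otimes>\<^bsub>\<Gamma>\<^esub> \<delta>) (component \<gamma> s \<otimes>\<^bsub>S\<^esub> component \<delta> t) = component \<gamma> s \<otimes>\<^bsub>S\<^esub> component \<delta> t"
    if d: "\<delta> \<in> carrier \<Gamma>" for \<delta>
  proof (rule S_eqI)
    fix \<epsilon> assume eps: "\<epsilon> \<in> carrier \<Gamma>"
    have "inv\<^bsub>\<Gamma>\<^esub> \<gamma> \<otimes>\<^bsub>\<Gamma>\<^esub> \<epsilon> = \<delta> \<longleftrightarrow> \<epsilon> = \<gamma> \<otimes>\<^bsub>\<Gamma>\<^esub> \<delta>"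
      using G.inv_solve_left[of \<epsilon> \<gamma> \<delta>] g d eps by (metis G.inv_solve_left G.inv_closed)
    then show "component (\<gamma> \<otimes>\<^bsub>\<Gamma>\<^esub> \<delta>) (component \<gamma> s \<otimes>\<^bsub>S\<^esub> component \<delta> t) \<epsilon>
        = (component \<gamma> s \<otimes>\<^bsub>S\<^esub> component \<delta> t) \<epsilon>"
      using component_mult[OF s component_closed[OF t d] g eps] g d eps s \<kappa> by auto
  qed (use s t g d in \<open>auto simp: S_ext\<close>)
next
  fix s t :: "'g \<Rightarrow> 'a"
  show "deg0_proj \<Gamma> (s \<oplus>\<^bsub>S\<^esub> t) = deg0_proj \<Gamma> s \<oplus>\<^bsub>sub K A\<^esub> deg0_proj \<Gamma> t"
    by (simp add: deg0_proj_def)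
next
  fix r assume "r \<in> carrier (sub K A)"
  show "deg0_proj \<Gamma> (\<theta> r) = r" by (simp add: deg0_proj_def)
qed

text \<open>A unit in degree one that is a product from opposite degrees would make \<open>D \<gamma>\<close> principal, against the
  injectivity of the map to the class group.\<close>

lemma deg0_mult_not_unit:
  assumes inj: "inj_on (\<lambda>\<gamma>. divisor_class K A (D \<gamma>)) (carrier \<Gamma>)"
    and g: "\<gamma> \<in> carrier \<Gamma>" "\<gamma> \<noteq> \<one>\<^bsub>\<Gamma>\<^esub>" and s: "s \<in> carrier S" "component \<gamma> s = s" and t: "t \<in> carrier S"
  shows "(s \<otimes>\<^bsub>S\<^esub> t) \<one>\<^bsub>\<Gamma>\<^esub> \<notin> Units (sub K A)"
proof
  assume unit: "(s \<otimes>\<^bsub>S\<^esub> t) \<one>\<^bsub>\<Gamma>\<^esub> \<in> Units (sub K A)"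
  let ?h = "inv\<^bsub>\<Gamma>\<^esub> \<gamma>"
  have h: "?h \<in> carrier \<Gamma>" using g by simp
  have eq: "(s \<otimes>\<^bsub>S\<^esub> t) \<one>\<^bsub>\<Gamma>\<^esub> = \<kappa> \<gamma> ?h \<otimes> (s \<gamma> \<otimes> t ?h)"
    using component_mult[OF s(1) t g(1) G.one_closed] s(2) h by simp
  obtain y where y: "y \<in> A" "(s \<otimes>\<^bsub>S\<^esub> t) \<one>\<^bsub>\<Gamma>\<^esub> \<otimes> y = \<one>" "(s \<otimes>\<^bsub>S\<^esub> t) \<one>\<^bsub>\<Gamma>\<^esub> \<in> A"
    using unit by (auto simp: Units_def)
  have "\<exists>h\<in>carrier K - {\<zero>}. D \<gamma> = div_of K A h"
  proof (rule principal_if_product_unit)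
    show "s \<gamma> \<in> sections K A (D \<gamma>)" "t ?h \<in> sections K A (D ?h)" using S_section s t g h by auto
    show "\<kappa> \<gamma> ?h \<in> carrier K" "\<kappa> \<gamma> ?h \<noteq> \<zero>" using \<kappa> g h by auto
    show "div_of K A (\<kappa> \<gamma> ?h) = D \<gamma> + D ?h" using div_\<kappa>[OF g(1) h] g by (simp add: D_one)
  qed (use y eq in auto)
  then have "divisor_class K A (D \<gamma>) = divisor_class K A (D \<one>\<^bsub>\<Gamma>\<^esub>)"
    using divisor_class_eq_if_principal D_one by auto
  then have "\<gamma> = \<one>\<^bsub>\<Gamma>\<^esub>" using inj g(1) by (auto dest: inj_onD)
  then show False using g(2) by blast
qed

end

section \<open>Centers of F-purity of divisorial algebras\<close>

theorem theorem6p22: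
  fixes k :: "('c, 'l) ring_scheme"
    and K :: "('a, 'm) ring_scheme" and A \<mm> :: "'a set"
    and \<iota> :: "'c \<Rightarrow> 'a"
    and \<Gamma> :: "('g, 'n) monoid_scheme"
    and D :: "'g \<Rightarrow> ('a set \<Rightarrow>\<^sub>0 int)" and \<kappa> :: "'g \<Rightarrow> 'g \<Rightarrow> 'a"
    and p e :: nat and \<phi> :: "'a \<Rightarrow> 'a" and \<psi> :: "('g \<Rightarrow> 'a) \<Rightarrow> ('g \<Rightarrow> 'a)"
  defines "R \<equiv> sub K A"
    and "S \<equiv> divisorial_algebra K A \<Gamma> D \<kappa>"
    and "\<theta> \<equiv> deg0_incl K \<Gamma>"
    and "T \<equiv> deg0_proj \<Gamma>"
  assumes "field k" and "ring_char k = p" and "0 < p"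
    and "is_fraction_field K A" and "integrally_closed K A"
    and "noetherian_ring R" and "local_ring R \<mm>" and "R Quot \<mm> \<simeq> k"
    and "\<iota> \<in> ring_hom k R"
    and "F_finite R p"
    and "comm_group \<Gamma>" and "finite (carrier \<Gamma>)"
    and "divisorial_data K A \<Gamma> D \<kappa>"
    and "(\<lambda>\<gamma>. divisor_class K A (D \<gamma>)) \<in> mon \<Gamma> (Cl K A)"
    and "1 \<le> e"
    and "frob_linear R (p ^ e) \<phi>" and "\<phi> ` carrier R = carrier R"
    and "is_transpose S T (p ^ e) \<phi> \<psi>"
  shows "(\<forall>P \<in> Schpec R (p ^ e) \<phi>. tamely_ramified S \<theta> T P) \<and>
    fibered R S \<theta> T (p ^ e) \<phi> \<psi> \<and>
    (\<forall>P \<in> spec R.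
       (P \<in> Schpec R (p ^ e) \<phi> \<longleftrightarrow> primes_over R S \<theta> P \<subseteq> Schpec S (p ^ e) \<psi>) \<and>
       (primes_over R S \<theta> P \<subseteq> Schpec S (p ^ e) \<psi> \<longleftrightarrow>
          primes_over R S \<theta> P \<inter> Schpec S (p ^ e) \<psi> \<noteq> {})) \<and>
    ((\<exists>n. order \<Gamma> = p ^ n) \<longrightarrow>
       homeomorphic_map (schpec_space S (p ^ e) \<psi>) (schpec_space R (p ^ e) \<phi>) (contraction R \<theta>))"
proof -
  interpret k: field k by fact
  have "field K" using assms by (simp add: is_fraction_field_def)
  then interpret dat: divisorial_algebra_data K A \<Gamma> D \<kappa>
    using assms
    by (intro divisorial_algebra_data.intro normal_noetherian_domain.intro
        normal_noetherian_domain_axioms.intro divisorial_algebra_data_axioms.intro) (simp_all add: R_def)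
  interpret gr: graded_algebra S R \<Gamma> \<theta> T dat.component
    unfolding S_def R_def \<theta>_def T_def by (rule dat.graded_algebra_S)
  note prime = k.prime_ring_char[OF \<open>ring_char k = p\<close> \<open>0 < p\<close>]
  have charR: "[p] \<cdot>\<^bsub>R\<^esub> \<one>\<^bsub>R\<^esub> = \<zero>\<^bsub>R\<^esub>"
  proof -
    interpret \<iota>: ring_hom_ring k R \<iota>
      by (rule ring_hom_ringI2) (use assms k.ring_axioms gr.R.ring_axioms in auto)
    show ?thesis using ring_hom_nat_multiple[OF k.ring_axioms gr.R.ring_axioms \<open>\<iota> \<in> ring_hom k R\<close>, of p]
      prime(2) by simp
  qed
  have "\<one>\<^bsub>R\<^esub> \<in> \<phi> ` carrier R" using assms by simp
  then obtain c where c: "c \<in> carrier R" "\<phi> c = \<one>\<^bsub>R\<^esub>" by auto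
  have \<mm>: "maximalideal \<mm> R" using \<open>local_ring R \<mm>\<close> by (simp add: local_ring_def)
  then interpret m: maximalideal \<mm> R .
  have inj: "inj_on (\<lambda>\<gamma>. divisor_class K A (D \<gamma>)) (carrier \<Gamma>)" using assms by (simp add: mon_def)
  have Tm: "T (s \<otimes>\<^bsub>S\<^esub> t) \<in> \<mm>"
    if "gr.homogeneous \<gamma> s" "gr.homogeneous (inv\<^bsub>\<Gamma>\<^esub> \<gamma>) t" "\<gamma> \<noteq> \<one>\<^bsub>\<Gamma>\<^esub>" for \<gamma> s t
  proof (rule ccontr)
    assume not: "T (s \<otimes>\<^bsub>S\<^esub> t) \<notin> \<mm>"
    have st: "s \<in> carrier S" "t \<in> carrier S" "dat.component \<gamma> s = s" "\<gamma> \<in> carrier \<Gamma>"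
      using that by (auto simp: gr.homogeneous_def)
    have "T (s \<otimes>\<^bsub>S\<^esub> t) \<in> carrier R" using st(1,2) by (intro gr.T_closed gr.m_closed)
    then have "T (s \<otimes>\<^bsub>S\<^esub> t) \<in> Units R"
      using not \<open>noetherian_ring R\<close> \<open>local_ring R \<mm>\<close> by (intro local_ring_Units)
    then show False
      using dat.deg0_mult_not_unit[OF inj st(4) that(3) _ st(3), of t] st(1,2)
      by (simp add: S_def R_def T_def deg0_proj_def)
  qed
  interpret tr: graded_transposition S R \<Gamma> \<theta> T dat.component p e \<phi> \<psi> c \<mm>
  proof
    show "r \<in> Units R" if "r \<in> carrier R" "r \<notin> \<mm>" for r
      by (rule local_ring_Units[OF \<open>noetherian_ring R\<close> \<open>local_ring R \<mm>\<close> that])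
    show "\<one>\<^bsub>R\<^esub> \<notin> \<mm>" using m.one_imp_carrier m.I_notcarr by auto
    show "frob_linear S (p ^ e) \<psi>" "\<And>s. s \<in> carrier S \<Longrightarrow> T (\<psi> s) = \<phi> (T s)"
      using \<open>is_transpose S T (p ^ e) \<phi> \<psi>\<close> by (auto simp: is_transpose_def)
  qed (use prime charR assms c Tm m.is_ideal in auto)
  show ?thesis
    unfolding tr.Schpec_R tr.Schpec_S tamely_ramified_def
    using tr.trace_ideal_eq_radical tr.fibered_transposition tr.CSpec_iff_primes_over
      tr.homeomorphic_contraction by (auto simp: spec_def)
qed

end
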